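(* Let $\alpha\in\mathbb{R}$, $\beta>0$, and let $\sigma(u)=\sigma_1u+\sigma_0$ with constants $\sigma_0,\sigma_1\in\mathbb R$. Fix one of the three boundary conditions (Neumann, Dirichlet, or periodic), and for each $L\ge1$ let $u=u_L$ be the mild solution on $[0,L]$ of $\partial_t u=\frac{\beta}{2}\partial_x^2u-\alpha u+\sigma(u)\dot W$ with initial condition $u_0\equiv1$ and the chosen boundary condition. Put $f_0(t)=e^{-2\alpha t}$ and, for $k\ge1$, $$f_k(t)=\sigma_1^{2(k-1)}e^{-2\alpha t}\int_{0<r_k<\dots<r_1<t}p_{2\beta(t-r_1)}(0)\,p_{2\beta(r_1-r_2)}(0)\cdots p_{2\beta(r_{k-1}-r_k)}(0)\,(\sigma_1+e^{\alpha r_k}\sigma_0)^2\,dr_k\cdots dr_1 .$$ Then for every $t>0$, $$\lim_{L\to\infty}\frac1L\int_0^LE[\sigma(u(t,x))^2]\,dx=\sigma_1^2\sum_{k=0}^\infty f_k(t)+2\sigma_1\sigma_0e^{-\alpha t}+\sigma_0^2=:f_\sigma(t).$$ Moreover, $$f_\sigma(t)\le e^{-2\alpha t}(|\sigma_1|+e^{|\alpha|t}|\sigma_0|)^2\,\bigl(f(\sigma_1^4t/\beta)-1\bigr)+(\sigma_1e^{-\alpha t}+\sigma_0)^2,$$ where $$f(t):=2e^{t/4}\int_{-\infty}^{\sqrt{t/2}}\frac1{\sqrt{2\pi}}e^{-y^2/2}\,dy .$$ In particular, $f_\sigma\in L^1([0,T])$ for all $T>0$.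
   Context: Setting. $\dot W$ is a space-time white noise on $[0,\infty)\times\mathbb{R}$ (restricted to $[0,T]\times[0,L]$ for a time horizon $T>0$, which may be taken arbitrarily large), with generated filtration $(\mathcal F_s)_s$. The Gaussian heat kernel is $p_t(z)=(2\pi t)^{-1/2}e^{-z^2/(2t)}$. The Green's function $G_t(x,y)$, $t>0$, $x,y\in[0,L]$, of $\partial_t u=\frac\beta2\partial_x^2u-\alpha u$ is: Neumann: $G_t(x,y)=e^{-\alpha t}\sum_{n\in\mathbb Z}(p_{\beta t}(x-y+2nL)+p_{\beta t}(x+y+2nL))$; Dirichlet: $G_t(x,y)=e^{-\alpha t}\sum_{n\in\mathbb Z}(p_{\beta t}(x-y+2nL)-p_{\beta t}(x+y+2nL))$; periodic: $G_t(x,y)=e^{-\alpha t}\sum_{n\in\mathbb Z}p_{\beta t}(x-y+nL)$. The mild solution $u$ (depending on $L$) is the unique adapted random field, with second moments finite (uniformly bounded on $[0,T]\times[0,L]$), satisfying $$u(t,x)=\int_0^L G_t(x,y)\,dy+\int_0^t\int_0^L G_{t-s}(x,y)\,\sigma(u(s,y))\,W(ds,dy)$$ with the stochastic integral in the Itô–Walsh sense, and $u(0,x)=1$. Conventions: in the product defining $f_k$, for $k=1$ only the factor $p_{2\beta(t-r_1)}(0)$ appears; $\sigma_1^{0}=1$ even if $\sigma_1=0$. *)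

theory Defs
  imports "HOL-Probability.Probability"
begin

section \<open>Space-time white noise and its filtration\<close>

definition noise_sets :: "(real \<times> real) set set" where
  "noise_sets = {A \<in> sets borel. A \<subseteq> {0..} \<times> UNIV \<and> emeasure lborel A < \<infinity>}"

text \<open>
  White noise on \<open>[0,\<infinity>) \<times> \<real>\<close> (first coordinate time, second coordinate space) as an
  independently scattered Gaussian random measure with Lebesgue control measure, defined on
  the Borel sets of finite Lebesgue measure. These conditions make \<open>W\<close> a centred Gaussian family
  with covariance \<open>E[W(A) W(B)] = |A \<inter> B|\<close>. The law \<open>N(0,0)\<close> has no density and is a separate
  case.
\<close>

locale white_noise = prob_space M for M :: "'w measure" +
  fixes W :: "(real \<times> real) set \<Rightarrow> 'w \<Rightarrow> real"
  assumes noise_measurable: "A \<in> noise_sets \<Longrightarrow> W A \<in> borel_measurable M"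
    and noise_normal: "A \<in> noise_sets \<Longrightarrow> measure lborel A > 0 \<Longrightarrow>
      distributed M lborel (W A) (\<lambda>z. ennreal (normal_density 0 (sqrt (measure lborel A)) z))"
    and noise_null: "A \<in> noise_sets \<Longrightarrow> measure lborel A = 0 \<Longrightarrow> AE \<omega> in M. W A \<omega> = 0"
    and noise_additive: "A \<in> noise_sets \<Longrightarrow> B \<in> noise_sets \<Longrightarrow> A \<inter> B = {} \<Longrightarrow>
      AE \<omega> in M. W (A \<union> B) \<omega> = W A \<omega> + W B \<omega>"
    and noise_indep: "\<A> \<subseteq> noise_sets \<Longrightarrow> finite \<A> \<Longrightarrow> disjoint \<A> \<Longrightarrow>
      indep_vars (\<lambda>_. borel) W \<A>"

text \<open>The generated filtration, augmented as usual by the null sets.\<close>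

definition noise_filtration ::
  "'w measure \<Rightarrow> ((real \<times> real) set \<Rightarrow> 'w \<Rightarrow> real) \<Rightarrow> real \<Rightarrow> 'w measure" where
  "noise_filtration M W s = sigma (space M)
     (null_sets M \<union>
      {W A -` B \<inter> space M | A B. A \<in> noise_sets \<and> A \<subseteq> {0..s} \<times> UNIV \<and> B \<in> sets borel})"


section \<open>The Ito--Walsh integral\<close>

text \<open>
  A tuple \<open>(a, b, A, X)\<close> stands for the elementary field \<open>X(\<omega>) 1_(a,b](s) 1_A(y)\<close>, and a list of
  tuples for the sum of its members.
\<close>

type_synonym 'w elementary = "real \<times> real \<times> real set \<times> ('w \<Rightarrow> real)"

definition elementary_on ::
  "'w measure \<Rightarrow> ((real \<times> real) set \<Rightarrow> 'w \<Rightarrow> real) \<Rightarrow> real \<Rightarrow> real \<Rightarrow> 'w elementary set" where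
  "elementary_on M W t L = {(a, b, A, X).
     0 \<le> a \<and> a \<le> b \<and> b \<le> t \<and> A \<in> sets borel \<and> A \<subseteq> {0..L} \<and>
     X \<in> borel_measurable (noise_filtration M W a) \<and>
     (\<exists>K. \<forall>\<omega>\<in>space M. \<bar>X \<omega>\<bar> \<le> K)}"

definition simple_field :: "'w elementary list \<Rightarrow> real \<Rightarrow> real \<Rightarrow> 'w \<Rightarrow> real" where
  "simple_field \<xi> s y \<omega> = (\<Sum>(a, b, A, X)\<leftarrow>\<xi>. X \<omega> * indicator ({a<..b} \<times> A) (s, y))"

definition simple_integral ::
  "((real \<times> real) set \<Rightarrow> 'w \<Rightarrow> real) \<Rightarrow> 'w elementary list \<Rightarrow> 'w \<Rightarrow> real" where
  "simple_integral W \<xi> \<omega> = (\<Sum>(a, b, A, X)\<leftarrow>\<xi>. X \<omega> * W ({a<..b} \<times> A) \<omega>)"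

text \<open>
  \<open>has_walsh_integral M W t L \<Phi> I\<close>: the random variable \<open>I\<close> is a version of the integral of
  \<open>\<Phi>(s,y)\<close> against \<open>W(ds,dy)\<close> over \<open>[0,t] \<times> [0,L]\<close>, obtained by extending the integral of simple
  fields by \<open>L\<^sup>2\<close>-continuity. The integrands are thus the \<open>L\<^sup>2(P \<otimes> ds \<otimes> dy)\<close>-limits of simple
  fields. Joint measurability of \<open>\<Phi>\<close> is required because \<open>nn_integral\<close> is only a lower integral
  on non-measurable functions.
\<close>

definition has_walsh_integral ::
  "'w measure \<Rightarrow> ((real \<times> real) set \<Rightarrow> 'w \<Rightarrow> real) \<Rightarrow> real \<Rightarrow> real \<Rightarrow>
   (real \<Rightarrow> real \<Rightarrow> 'w \<Rightarrow> real) \<Rightarrow> ('w \<Rightarrow> real) \<Rightarrow> bool" where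
  "has_walsh_integral M W t L \<Phi> I \<longleftrightarrow>
     (let D = restrict_space lborel ({0..t} \<times> {0..L}) in
      (\<lambda>(\<omega>, s, y). \<Phi> s y \<omega>) \<in> borel_measurable (M \<Otimes>\<^sub>M D) \<and>
      I \<in> borel_measurable M \<and>
      (\<exists>\<xi> :: nat \<Rightarrow> 'w elementary list.
         (\<forall>n. set (\<xi> n) \<subseteq> elementary_on M W t L) \<and>
         (\<lambda>n. \<integral>\<^sup>+(\<omega>, s, y). ennreal ((\<Phi> s y \<omega> - simple_field (\<xi> n) s y \<omega>)\<^sup>2) \<partial>(M \<Otimes>\<^sub>M D))
           \<longlonglongrightarrow> 0 \<and>
         (\<lambda>n. \<integral>\<^sup>+\<omega>. ennreal ((I \<omega> - simple_integral W (\<xi> n) \<omega>)\<^sup>2) \<partial>M) \<longlonglongrightarrow> 0))"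


section \<open>Green's functions and mild solutions\<close>

definition heat_kernel :: "real \<Rightarrow> real \<Rightarrow> real" where
  "heat_kernel t z = exp (- z\<^sup>2 / (2 * t)) / sqrt (2 * pi * t)"

datatype boundary_condition = Neumann | Dirichlet | Periodic

definition green ::
  "boundary_condition \<Rightarrow> real \<Rightarrow> real \<Rightarrow> real \<Rightarrow> real \<Rightarrow> real \<Rightarrow> real \<Rightarrow> real" where
  "green bc \<alpha> \<beta> L t x y = exp (- \<alpha> * t) *
     (case bc of
        Neumann \<Rightarrow> (\<Sum>\<^sub>\<infinity>n\<in>(UNIV :: int set).
          heat_kernel (\<beta> * t) (x - y + 2 * of_int n * L) +
          heat_kernel (\<beta> * t) (x + y + 2 * of_int n * L))
      | Dirichlet \<Rightarrow> (\<Sum>\<^sub>\<infinity>n\<in>(UNIV :: int set).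
          heat_kernel (\<beta> * t) (x - y + 2 * of_int n * L) -
          heat_kernel (\<beta> * t) (x + y + 2 * of_int n * L))
      | Periodic \<Rightarrow> (\<Sum>\<^sub>\<infinity>n\<in>(UNIV :: int set).
          heat_kernel (\<beta> * t) (x - y + of_int n * L)))"

text \<open>
  Mild solutions on \<open>[0,T] \<times> [0,L]\<close> started from \<open>1\<close>, as fields \<open>u t x \<omega>\<close>; only the values for
  \<open>t \<in> [0,T]\<close> and \<open>x \<in> [0,L]\<close> matter. In the stochastic integral the value of the integrand on the
  null set \<open>s = t\<close> is irrelevant (\<open>green\<close> vanishes at time \<open>0\<close> because \<open>1 / 0 = 0\<close>).
\<close>

definition mild_solution ::
  "'w measure \<Rightarrow> ((real \<times> real) set \<Rightarrow> 'w \<Rightarrow> real) \<Rightarrow> boundary_condition \<Rightarrow> real \<Rightarrow> real \<Rightarrow>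
   (real \<Rightarrow> real) \<Rightarrow> real \<Rightarrow> real \<Rightarrow> (real \<Rightarrow> real \<Rightarrow> 'w \<Rightarrow> real) \<Rightarrow> bool" where
  "mild_solution M W bc \<alpha> \<beta> \<sigma> T L u \<longleftrightarrow>
     (\<lambda>(\<omega>, s, y). u s y \<omega>)
       \<in> borel_measurable (M \<Otimes>\<^sub>M restrict_space lborel ({0..T} \<times> {0..L})) \<and>
     (\<forall>t\<in>{0..T}. \<forall>x\<in>{0..L}. u t x \<in> borel_measurable (noise_filtration M W t)) \<and>
     (\<exists>C::real. \<forall>t\<in>{0..T}. \<forall>x\<in>{0..L}. (\<integral>\<^sup>+\<omega>. ennreal ((u t x \<omega>)\<^sup>2) \<partial>M) \<le> ennreal C) \<and>
     (\<forall>x\<in>{0..L}. AE \<omega> in M. u 0 x \<omega> = 1) \<and>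
     (\<forall>t\<in>{0<..T}. \<forall>x\<in>{0..L}. \<exists>I.
        has_walsh_integral M W t L (\<lambda>s y \<omega>. green bc \<alpha> \<beta> L (t - s) x y * \<sigma> (u s y \<omega>)) I \<and>
        (AE \<omega> in M. u t x \<omega> = (LINT y:{0..L}|lborel. green bc \<alpha> \<beta> L t x y) + I \<omega>))"


section \<open>The limiting energy\<close>

text \<open>
  The integral is taken over \<open>(r\<^sub>1,\<dots>,r\<^sub>k) \<in> \<real>\<^sup>k\<close>, with \<open>r\<^sub>0 = t\<close> in the chain and the product.
\<close>

definition f_term :: "real \<Rightarrow> real \<Rightarrow> real \<Rightarrow> real \<Rightarrow> nat \<Rightarrow> real \<Rightarrow> real" where
  "f_term \<alpha> \<beta> \<sigma>\<^sub>1 \<sigma>\<^sub>0 k t =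
     (if k = 0 then exp (- 2 * \<alpha> * t)
      else \<sigma>\<^sub>1 ^ (2 * (k - 1)) * exp (- 2 * \<alpha> * t) *
        (LINT r | (\<Pi>\<^sub>M i\<in>{1..k}. (lborel :: real measure)).
           (let r' = r(0 := t) in
            of_bool (0 < r' k \<and> (\<forall>i\<in>{1..k}. r' i < r' (i - 1))) *
            (\<Prod>i\<in>{1..k}. heat_kernel (2 * \<beta> * (r' (i - 1) - r' i)) 0) *
            (\<sigma>\<^sub>1 + exp (\<alpha> * r' k) * \<sigma>\<^sub>0)\<^sup>2)))"

definition f_sigma :: "real \<Rightarrow> real \<Rightarrow> real \<Rightarrow> real \<Rightarrow> real \<Rightarrow> real" where
  "f_sigma \<alpha> \<beta> \<sigma>\<^sub>1 \<sigma>\<^sub>0 t =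
     \<sigma>\<^sub>1\<^sup>2 * (\<Sum>k. f_term \<alpha> \<beta> \<sigma>\<^sub>1 \<sigma>\<^sub>0 k t) + 2 * \<sigma>\<^sub>1 * \<sigma>\<^sub>0 * exp (- \<alpha> * t) + \<sigma>\<^sub>0\<^sup>2"

definition f_bound :: "real \<Rightarrow> real" where
  "f_bound t = 2 * exp (t / 4) *
     (LINT y:{..sqrt (t / 2)}|lborel. 1 / sqrt (2 * pi) * exp (- y\<^sup>2 / 2))"

end

theory Submission
  imports Defs "HOL-Library.Nat_Bijection"
begin

text \<open>
  By the Ito--Walsh isometry the second moments \<open>V(t,x) = e\<^bsup>2\<alpha>t\<^esup> E[\<sigma>(u(t,x))\<^sup>2]\<close> satisfy a closed linear
  Volterra equation whose kernel is the square of \<open>e\<^bsup>\<alpha>t\<^esup> G\<^sub>t\<close>. By the method of images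
  \<open>e\<^bsup>\<alpha>t\<^esup> G\<^sub>t(x,y) = p\<^bsub>\<beta>t\<^esub>(x - y) + R(x,y)\<close>, where the integral of \<open>\<bar>R\<bar>\<close> over \<open>y \<in> [0,L]\<close> is at most the mass
  that the heat kernel sends out of \<open>[0,L]\<close>; integrated over the starting point this is at most
  \<open>E\<bar>Z\<bar> = O(1)\<close> for a Gaussian \<open>Z\<close>. Since \<open>V\<close> is bounded uniformly in \<open>L\<close>, the integral of \<open>V\<close> over
  \<open>[0,L]\<close> satisfies, up to an error \<open>O(1)\<close>, the scalar Volterra equation with kernel
  \<open>\<sigma>\<^sub>1\<^sup>2 p\<^bsub>2\<beta>(t - s)\<^esub>(0)\<close>, whose solution is the series defining \<open>f\<^sub>\<sigma>\<close>; dividing by \<open>L\<close> gives the limit with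
  rate \<open>1/L\<close>. The explicit bound comes from \<open>K\<^sup>k 1 = (t/4\<beta>)\<^bsup>k/2\<^esup> / \<Gamma>(k/2 + 1)\<close> for the Volterra operator \<open>K\<close>
  and from the differential inequality \<open>S' \<le> 2/\<surd>\<pi> + 2 z S\<close> for the partial sums \<open>S\<close> of
  \<open>\<Sum> z\<^sup>k / \<Gamma>(k/2 + 1)\<close>.
\<close>

section \<open>White noise and its filtration\<close>

text \<open>What has to be controlled is the boundary error at short time lags. At lag
  \<open>s\<close> the kernels are of size \<open>1 / sqrt s\<close>, while the image part,
  integrated over both space variables, is at most \<open>sqrt s\<close>: only a boundary layer of
  about that width feels the boundary. The two powers cancel, so replacing the squared image kernel
  by the squared heat kernel costs a constant for each lag, free of L and integrable in time. This
  constant contains a bound on the second moments that must be uniform in L, whereas a mild solution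
  only brings a bound that may depend on L; a first Volterra iteration on the pointwise moments
  removes that dependence. Equations are kept in \<open>ennreal\<close> as pairs of inequalities
  with the errors added, never subtracted, so Tonelli and iteration need no integrability. On the
  probabilistic side, independence is given only for finite disjoint families of sets and additivity
  only almost surely; the isometry needs independence between the augmented past and later noise,
  hence the cutting into atoms and the classes of events that are almost surely cylinders.\<close>

lemma noise_sets_Int: "A \<in> noise_sets \<Longrightarrow> B \<in> sets borel \<Longrightarrow> A \<inter> B \<in> noise_sets"
  unfolding noise_sets_def
  by (auto intro: le_less_trans[OF emeasure_mono[of "A \<inter> B" A]])

lemma noise_sets_Diff: "A \<in> noise_sets \<Longrightarrow> B \<in> sets borel \<Longrightarrow> A - B \<in> noise_sets"
  using noise_sets_Int[of A "- B"] by (simp add: Diff_eq)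

lemma noise_sets_Un: "A \<in> noise_sets \<Longrightarrow> B \<in> noise_sets \<Longrightarrow> A \<union> B \<in> noise_sets"
  unfolding noise_sets_def
  by (auto intro!: le_less_trans[OF emeasure_subadditive] simp: ennreal_add_less_top)

lemma noise_sets_borel: "A \<in> noise_sets \<Longrightarrow> A \<in> sets borel"
  by (simp add: noise_sets_def)

lemma noise_sets_empty [simp]: "{} \<in> noise_sets"
  by (simp add: noise_sets_def)

lemma noise_sets_finite_Union:
  "finite \<D> \<Longrightarrow> \<D> \<subseteq> noise_sets \<Longrightarrow> \<Union>\<D> \<in> noise_sets"
  by (induction rule: finite_induct) (auto intro: noise_sets_Un)

lemma noise_sets_rect:
  fixes a b :: real and A :: "real set"
  assumes "0 \<le> a" "A \<in> sets borel" "A \<subseteq> {0..L}"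
  shows "{a<..b} \<times> A \<in> noise_sets"
proof -
  have "emeasure lborel ({a<..b} \<times> A) = emeasure lborel {a<..b} * emeasure lborel A"
    unfolding lborel_prod[symmetric]
    by (rule lborel.emeasure_pair_measure_Times) (use assms in auto)
  also have "emeasure lborel A \<le> emeasure lborel {0..L}"
    by (rule emeasure_mono) (use assms in auto)
  then have "emeasure lborel A < \<infinity>"
    by (rule le_less_trans) (simp add: emeasure_lborel_Icc_eq)
  then have "emeasure lborel {a<..b} * emeasure lborel A < \<infinity>"
    by (cases "a \<le> b") (simp_all add: ennreal_mult_less_top)
  finally show ?thesis
    using assms by (auto simp: noise_sets_def intro!: borel_Times)
qed

text \<open>Points are grouped by the set of members that contain them. Independence is given only
  for disjoint families, so finite families are cut into such atoms. The empty pattern is left out: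
  its atom is the complement of \<open>\<Union>\<A>\<close>, which has infinite measure.\<close>

lemma noise_atoms:
  assumes "finite \<A>" "\<A> \<subseteq> noise_sets"
  obtains \<D> where "finite \<D>" "\<D> \<subseteq> noise_sets" "disjoint \<D>" "{} \<notin> \<D>" "\<Union>\<D> \<subseteq> \<Union>\<A>"
    "\<And>A. A \<in> \<A> \<Longrightarrow> A = \<Union>{D \<in> \<D>. D \<subseteq> A}"
proof
  define atom where "atom S = {x. {A \<in> \<A>. x \<in> A} = S}" for S
  define \<D> where "\<D> = atom ` (Pow \<A> - {{}}) - {{}}"
  show "finite \<D>" using assms by (simp add: \<D>_def)
  show "{} \<notin> \<D>" by (simp add: \<D>_def)
  show "disjoint \<D>"
  proof (rule disjointI)
    fix a b assume "a \<in> \<D>" "b \<in> \<D>" "a \<noteq> b"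
    then obtain S R where "a = atom S" "b = atom R" "S \<noteq> R" unfolding \<D>_def by blast
    then show "a \<inter> b = {}" unfolding atom_def by blast
  qed
  show "\<Union>\<D> \<subseteq> \<Union>\<A>"
  proof
    fix x assume "x \<in> \<Union>\<D>"
    then obtain S where "S \<subseteq> \<A>" "S \<noteq> {}" "x \<in> atom S" unfolding \<D>_def by blast
    then have "{A \<in> \<A>. x \<in> A} \<noteq> {}" unfolding atom_def by simp
    then show "x \<in> \<Union>\<A>" by blast
  qed
  have "atom S \<in> noise_sets" if "S \<subseteq> \<A>" "S \<noteq> {}" for S
  proof -
    obtain A where A: "A \<in> S" using \<open>S \<noteq> {}\<close> by blast
    have fin: "finite S" "finite (\<A> - S)" using that assms by (auto intro: finite_subset)
    have eq: "atom S = A \<inter> ((\<Inter>X\<in>S. X) \<inter> (- \<Union>(\<A> - S)))"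
      using that A unfolding atom_def by blast
    have "(\<Inter>X\<in>S. X) \<in> sets borel"
      using that fin assms(2) noise_sets_borel by (intro sets.finite_INT) blast+
    moreover have "\<Union>(\<A> - S) \<in> sets borel"
      using fin assms(2) noise_sets_borel by (intro sets.finite_Union) blast+
    ultimately show ?thesis unfolding eq using A that assms(2) by (intro noise_sets_Int) auto
  qed
  then show "\<D> \<subseteq> noise_sets" unfolding \<D>_def by blast
  show "A = \<Union>{D \<in> \<D>. D \<subseteq> A}" if "A \<in> \<A>" for A
  proof (intro equalityI subsetI)
    fix x assume x: "x \<in> A"
    have "x \<in> atom {B \<in> \<A>. x \<in> B}" by (simp add: atom_def)
    moreover have "atom {B \<in> \<A>. x \<in> B} \<subseteq> A" using x that by (auto simp: atom_def)
    moreover have "{B \<in> \<A>. x \<in> B} \<in> Pow \<A> - {{}}" using x that by auto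
    ultimately have "atom {B \<in> \<A>. x \<in> B} \<in> {D \<in> \<D>. D \<subseteq> A}" unfolding \<D>_def by blast
    then show "x \<in> \<Union>{D \<in> \<D>. D \<subseteq> A}" using \<open>x \<in> atom _\<close> by blast
  qed auto
qed

section \<open>Moments and covariance of the noise\<close>

context white_noise
begin

lemma noise_square:
  assumes "A \<in> noise_sets"
  shows "integrable M (\<lambda>\<omega>. (W A \<omega>)\<^sup>2)" "expectation (\<lambda>\<omega>. (W A \<omega>)\<^sup>2) = measure lborel A"
proof -
  note [measurable] = noise_measurable[OF assms]
  have *: "integrable M (\<lambda>\<omega>. (W A \<omega>)\<^sup>2) \<and> expectation (\<lambda>\<omega>. (W A \<omega>)\<^sup>2) = measure lborel A"
  proof (cases "measure lborel A > 0")
    case True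
    note D = noise_normal[OF assms True]
    have s: "0 < sqrt (measure lborel A)" using True by simp
    have E: "expectation (W A) = 0" by (rule normal_distributed_expectation[OF s D])
    have V: "variance (W A) = (sqrt (measure lborel A))\<^sup>2" by (rule normal_distributed_variance[OF s D])
    have "integrable M (\<lambda>\<omega>. (W A \<omega>)\<^sup>2)"
      using integrable_normal_moment[OF s, of 0 2]
        distributed_integrable[OF D, of "\<lambda>x. x\<^sup>2"] normal_density_nonneg by simp
    then show ?thesis using E V True by simp
  next
    case False
    then have 0: "measure lborel A = 0" using measure_nonneg[of lborel A] by linarith
    have "AE \<omega> in M. (W A \<omega>)\<^sup>2 = 0" using noise_null[OF assms 0] by auto
    then show ?thesis using 0 integrable_cong_AE[of "\<lambda>\<omega>. (W A \<omega>)\<^sup>2" M "\<lambda>_. 0"]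
        integral_cong_AE[of "\<lambda>\<omega>. (W A \<omega>)\<^sup>2" M "\<lambda>_. 0"] by simp
  qed
  then show "integrable M (\<lambda>\<omega>. (W A \<omega>)\<^sup>2)" "expectation (\<lambda>\<omega>. (W A \<omega>)\<^sup>2) = measure lborel A"
    by auto
qed

lemma noise_integrable: "A \<in> noise_sets \<Longrightarrow> integrable M (W A)"
  using square_integrable_imp_integrable[OF noise_measurable noise_square(1)] by simp

lemma noise_mean:
  assumes "A \<in> noise_sets"
  shows "expectation (W A) = 0"
proof (cases "measure lborel A > 0")
  case True
  then show ?thesis using normal_distributed_expectation[OF _ noise_normal[OF assms True]] by simp
next
  case False
  then have 0: "measure lborel A = 0" using measure_nonneg[of lborel A] by linarith
  then show ?thesis
    using integral_cong_AE[OF noise_measurable[OF assms] _ noise_null[OF assms 0]] by simp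
qed

lemma noise_finite_additive:
  assumes "finite \<D>" "\<D> \<subseteq> noise_sets" "disjoint \<D>"
  shows "AE \<omega> in M. W (\<Union>\<D>) \<omega> = (\<Sum>D\<in>\<D>. W D \<omega>)"
  using assms
proof (induction rule: finite_induct)
  case empty
  then show ?case using noise_null[of "{}"] by simp
next
  case (insert D \<D>)
  have "disjoint \<D>" using insert.prems(2) by (auto simp: disjoint_def)
  then have "AE \<omega> in M. W (\<Union>\<D>) \<omega> = (\<Sum>D\<in>\<D>. W D \<omega>)" using insert by auto
  moreover have "D \<inter> \<Union>\<D> = {}" using insert.prems(2) insert.hyps(2)
    by (auto simp: disjoint_def)
  then have "AE \<omega> in M. W (D \<union> \<Union>\<D>) \<omega> = W D \<omega> + W (\<Union>\<D>) \<omega>"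
    using insert by (intro noise_additive noise_sets_finite_Union) auto
  ultimately show ?case using insert.hyps by (auto simp: sum.insert)
qed

lemma noise_mult_integrable:
  assumes A: "A \<in> noise_sets" and B: "B \<in> noise_sets"
  shows "integrable M (\<lambda>\<omega>. W A \<omega> * W B \<omega>)"
proof (rule Bochner_Integration.integrable_bound)
  note [measurable] = noise_measurable[OF A] noise_measurable[OF B]
  show "integrable M (\<lambda>\<omega>. (W A \<omega>)\<^sup>2 + (W B \<omega>)\<^sup>2)"
    using noise_square A B by (intro Bochner_Integration.integrable_add) auto
  show "AE \<omega> in M. norm (W A \<omega> * W B \<omega>) \<le> norm ((W A \<omega>)\<^sup>2 + (W B \<omega>)\<^sup>2)"
  proof (rule AE_I2)
    fix \<omega>
    have "2 * (\<bar>W A \<omega>\<bar> * \<bar>W B \<omega>\<bar>) \<le> (W A \<omega>)\<^sup>2 + (W B \<omega>)\<^sup>2"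
      using sum_squares_bound[of "\<bar>W A \<omega>\<bar>" "\<bar>W B \<omega>\<bar>"] by simp
    moreover have "0 \<le> \<bar>W A \<omega>\<bar> * \<bar>W B \<omega>\<bar>" by simp
    ultimately have "\<bar>W A \<omega>\<bar> * \<bar>W B \<omega>\<bar> \<le> (W A \<omega>)\<^sup>2 + (W B \<omega>)\<^sup>2" by linarith
    then show "norm (W A \<omega> * W B \<omega>) \<le> norm ((W A \<omega>)\<^sup>2 + (W B \<omega>)\<^sup>2)"
      by (simp add: abs_mult)
  qed
  show "(\<lambda>\<omega>. W A \<omega> * W B \<omega>) \<in> borel_measurable M" by simp
qed

text \<open>Polarisation: the variance is the Lebesgue measure, which is additive over the disjoint
  union, so nothing is left for the cross term.\<close>

lemma noise_disjoint_cov: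
  assumes A: "A \<in> noise_sets" and B: "B \<in> noise_sets" and AB: "A \<inter> B = {}"
  shows "expectation (\<lambda>\<omega>. W A \<omega> * W B \<omega>) = 0"
proof -
  note [measurable] = noise_measurable[OF A] noise_measurable[OF B]
    noise_measurable[OF noise_sets_Un[OF A B]]
  note int = noise_square(1)[OF A] noise_square(1)[OF B] noise_mult_integrable[OF A B]
  have "measure lborel A + measure lborel B = measure lborel (A \<union> B)"
    using A B AB by (intro measure_Union[symmetric]) (auto simp: noise_sets_def)
  also have "\<dots> = expectation (\<lambda>\<omega>. (W (A \<union> B) \<omega>)\<^sup>2)"
    using noise_square(2)[OF noise_sets_Un[OF A B]] by simp
  also have "\<dots> = expectation (\<lambda>\<omega>. (W A \<omega>)\<^sup>2 + (W B \<omega>)\<^sup>2 + 2 * (W A \<omega> * W B \<omega>))"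
    using noise_additive[OF A B AB]
    by (intro integral_cong_AE) (auto simp: power2_eq_square algebra_simps)
  also have "\<dots> = measure lborel A + measure lborel B + 2 * expectation (\<lambda>\<omega>. W A \<omega> * W B \<omega>)"
    using int noise_square(2)[OF A] noise_square(2)[OF B] by simp
  finally show ?thesis by simp
qed

text \<open>Both sets are cut into \<open>A - B\<close>, \<open>B - A\<close> and
  \<open>A \<inter> B\<close>. Products of different pieces have mean zero; only the square on
  \<open>A \<inter> B\<close> survives.\<close>

lemma noise_cov:
  assumes A: "A \<in> noise_sets" and B: "B \<in> noise_sets"
  shows "expectation (\<lambda>\<omega>. W A \<omega> * W B \<omega>) = measure lborel (A \<inter> B)"
proof -
  let ?I = "A \<inter> B"
  have n: "A - B \<in> noise_sets" "B - A \<in> noise_sets" "?I \<in> noise_sets"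
    using A B noise_sets_borel by (auto intro: noise_sets_Int noise_sets_Diff)
  note [measurable] = n[THEN noise_measurable] noise_measurable[OF A] noise_measurable[OF B]
  have "AE \<omega> in M. W ((A - B) \<union> ?I) \<omega> = W (A - B) \<omega> + W ?I \<omega>"
    by (rule noise_additive) (use n in auto)
  moreover have "AE \<omega> in M. W ((B - A) \<union> ?I) \<omega> = W (B - A) \<omega> + W ?I \<omega>"
    by (rule noise_additive) (use n in auto)
  moreover have "(A - B) \<union> ?I = A" "(B - A) \<union> ?I = B" by auto
  ultimately have "AE \<omega> in M. W A \<omega> * W B \<omega> = W (A - B) \<omega> * W (B - A) \<omega>
      + W (A - B) \<omega> * W ?I \<omega> + W (B - A) \<omega> * W ?I \<omega> + (W ?I \<omega>)\<^sup>2"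
    by (auto simp: power2_eq_square algebra_simps)
  then have "expectation (\<lambda>\<omega>. W A \<omega> * W B \<omega>) =
     expectation (\<lambda>\<omega>. W (A - B) \<omega> * W (B - A) \<omega>
      + W (A - B) \<omega> * W ?I \<omega> + W (B - A) \<omega> * W ?I \<omega> + (W ?I \<omega>)\<^sup>2)"
    by (intro integral_cong_AE) auto
  also have "\<dots> = expectation (\<lambda>\<omega>. W (A - B) \<omega> * W (B - A) \<omega>)
      + expectation (\<lambda>\<omega>. W (A - B) \<omega> * W ?I \<omega>) + expectation (\<lambda>\<omega>. W (B - A) \<omega> * W ?I \<omega>)
      + expectation (\<lambda>\<omega>. (W ?I \<omega>)\<^sup>2)"
    using noise_mult_integrable noise_square(1) n by simp
  also have "\<dots> = measure lborel ?I"
  proof -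
    have "(A - B) \<inter> (B - A) = {}" "(A - B) \<inter> ?I = {}" "(B - A) \<inter> ?I = {}" by auto
    then show ?thesis
      using noise_disjoint_cov[OF n(1,2)] noise_disjoint_cov[OF n(1,3)] noise_disjoint_cov[OF n(2,3)]
        noise_square(2)[OF n(3)] by simp
  qed
  finally show ?thesis .
qed

section \<open>The augmented filtration and its independence of later noise\<close>

lemma filtration_space [simp]: "space (noise_filtration M W s) = space M"
  unfolding noise_filtration_def by (rule space_measure_of) (use sets.sets_into_space in auto)

lemma filtration_sets:
  "sets (noise_filtration M W s) = sigma_sets (space M) (null_sets M \<union>
      {W A -` B \<inter> space M | A B. A \<in> noise_sets \<and> A \<subseteq> {0..s} \<times> UNIV \<and> B \<in> sets borel})"
  unfolding noise_filtration_def by (rule sets_measure_of) (use sets.sets_into_space in auto)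

lemma filtration_subset_events: "sets (noise_filtration M W s) \<subseteq> events"
  unfolding filtration_sets
  by (rule sets.sigma_sets_subset) (use noise_measurable in \<open>auto simp: measurable_sets null_setsD2\<close>)

lemma filtration_mono:
  assumes "s \<le> s'"
  shows "sets (noise_filtration M W s) \<subseteq> sets (noise_filtration M W s')"
proof -
  have "A \<subseteq> {0..s'} \<times> UNIV" if "A \<subseteq> {0..s} \<times> UNIV" for A :: "(real \<times> real) set"
    using that assms by fastforce
  then show ?thesis unfolding filtration_sets by (intro sigma_sets_mono') blast
qed

lemma filtration_measurable:
  "X \<in> borel_measurable (noise_filtration M W s) \<Longrightarrow> X \<in> borel_measurable M"
  using filtration_subset_events by (auto simp: measurable_def)

lemma filtration_measurable_mono:
  "X \<in> borel_measurable (noise_filtration M W s) \<Longrightarrow> s \<le> s' \<Longrightarrow>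
    X \<in> borel_measurable (noise_filtration M W s')"
  using filtration_mono by (fastforce simp: measurable_def)

lemma filtration_noise:
  assumes "A \<in> noise_sets" "A \<subseteq> {0..s} \<times> UNIV"
  shows "W A \<in> borel_measurable (noise_filtration M W s)"
proof (rule measurableI)
  fix B :: "real set" assume "B \<in> sets borel"
  then show "W A -` B \<inter> space (noise_filtration M W s) \<in> sets (noise_filtration M W s)"
    unfolding filtration_space filtration_sets using assms by (intro sigma_sets.Basic) blast
qed simp

text \<open>Each noise value is almost surely the sum over its atoms, and the atoms of the two
  families together form one disjoint family, to which \<open>noise_indep\<close> applies. This
  covers members that overlap within one family.\<close>

lemma noise_indep_families:
  assumes A: "finite \<A>" "\<A> \<subseteq> noise_sets" and B: "finite \<B>" "\<B> \<subseteq> noise_sets"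
    and AB: "\<Union>\<A> \<inter> \<Union>\<B> = {}"
    and S: "S \<in> sets (PiM \<A> (\<lambda>_. borel))" and R: "R \<in> sets (PiM \<B> (\<lambda>_. borel))"
  defines "E \<equiv> {\<omega> \<in> space M. (\<lambda>A\<in>\<A>. W A \<omega>) \<in> S}"
    and "F \<equiv> {\<omega> \<in> space M. (\<lambda>B\<in>\<B>. W B \<omega>) \<in> R}"
  shows "E \<in> events" "F \<in> events" "prob (E \<inter> F) = prob E * prob F"
proof -
  have Wm: "(\<lambda>\<omega>. \<lambda>A\<in>\<C>. W A \<omega>) \<in> measurable M (PiM \<C> (\<lambda>_. borel))" if "\<C> \<subseteq> noise_sets" for \<C>
    using that noise_measurable by (intro measurable_restrict) auto
  show E: "E \<in> events" and F: "F \<in> events"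
    using Wm[OF A(2)] Wm[OF B(2)] S R by (auto simp: E_def F_def)
  obtain \<D> where D: "finite \<D>" "\<D> \<subseteq> noise_sets" "disjoint \<D>" "{} \<notin> \<D>" "\<Union>\<D> \<subseteq> \<Union>\<A>"
    "\<And>A. A \<in> \<A> \<Longrightarrow> A = \<Union>{D \<in> \<D>. D \<subseteq> A}" by (rule noise_atoms[OF A]) blast
  obtain \<D>' where D': "finite \<D>'" "\<D>' \<subseteq> noise_sets" "disjoint \<D>'" "{} \<notin> \<D>'" "\<Union>\<D>' \<subseteq> \<Union>\<B>"
    "\<And>A. A \<in> \<B> \<Longrightarrow> A = \<Union>{D \<in> \<D>'. D \<subseteq> A}" by (rule noise_atoms[OF B]) blast
  \<comment> \<open>The two groups of atoms could share only the empty set, which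
    \<open>noise_atoms\<close> excludes.\<close>
  have disj: "\<D> \<inter> \<D>' = {}"
  proof (rule ccontr)
    assume "\<D> \<inter> \<D>' \<noteq> {}"
    then obtain X where "X \<in> \<D>" "X \<in> \<D>'" by auto
    then have "X \<subseteq> \<Union>\<A> \<inter> \<Union>\<B>" using D D' by blast
    then show False using AB \<open>X \<in> \<D>\<close> D(4) by auto
  qed
  have "disjoint (\<D> \<union> \<D>')"
  proof (rule disjoint_union[OF D(3) D'(3)])
    show "\<Union>\<D> \<inter> \<Union>\<D>' = {}" using D(5) D'(5) AB by blast
  qed
  then have "indep_vars (\<lambda>_. borel) W (\<D> \<union> \<D>')"
    using D D' by (intro noise_indep) auto
  from indep_var_restrict[OF this disj]
  have ind: "indep_var (PiM \<D> (\<lambda>_. borel)) (\<lambda>\<omega>. \<lambda>A\<in>\<D>. W A \<omega>)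
      (PiM \<D>' (\<lambda>_. borel)) (\<lambda>\<omega>. \<lambda>A\<in>\<D>'. W A \<omega>)" by auto
  \<comment> \<open>\<open>g\<close> rebuilds the noise of the members from the noise of the atoms.
    As additivity is only almost sure, this yields events \<open>E'\<close> and \<open>F'\<close>
    that agree with \<open>E\<close> and \<open>F\<close> up to null sets.\<close>
  define g where "g \<C> \<E> w = (\<lambda>A\<in>\<C>. \<Sum>D\<in>{D \<in> \<E>. D \<subseteq> A}. w D)"
    for \<C> \<E> :: "(real \<times> real) set set" and w :: "(real \<times> real) set \<Rightarrow> real"
  have gm: "g \<C> \<E> \<in> measurable (PiM \<E> (\<lambda>_. borel)) (PiM \<C> (\<lambda>_. borel))" for \<C> \<E>
    unfolding g_def by (intro measurable_restrict borel_measurable_sum measurable_component_singleton) auto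
  have geq: "AE \<omega> in M. g \<C> \<E> (\<lambda>A\<in>\<E>. W A \<omega>) = (\<lambda>A\<in>\<C>. W A \<omega>)"
    if C: "finite \<C>" and E: "finite \<E>" "\<E> \<subseteq> noise_sets" "disjoint \<E>"
      and U: "\<And>A. A \<in> \<C> \<Longrightarrow> A = \<Union>{D \<in> \<E>. D \<subseteq> A}" for \<C> \<E>
  proof -
    have "AE \<omega> in M. \<forall>A\<in>\<C>. W A \<omega> = (\<Sum>D\<in>{D \<in> \<E>. D \<subseteq> A}. W D \<omega>)"
    proof (rule AE_finite_allI[OF C])
      fix A assume "A \<in> \<C>"
      have "AE \<omega> in M. W (\<Union>{D \<in> \<E>. D \<subseteq> A}) \<omega> = (\<Sum>D\<in>{D \<in> \<E>. D \<subseteq> A}. W D \<omega>)"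
        using E by (intro noise_finite_additive) (auto simp: disjoint_def)
      then show "AE \<omega> in M. W A \<omega> = (\<Sum>D\<in>{D \<in> \<E>. D \<subseteq> A}. W D \<omega>)"
        using U[OF \<open>A \<in> \<C>\<close>] by simp
    qed
    then show ?thesis by eventually_elim (auto simp: g_def fun_eq_iff intro!: sum.cong)
  qed
  note ind' = indep_var_compose[OF ind gm[of \<A> \<D>] gm[of \<B> \<D>']]
  define E' where "E' = {\<omega> \<in> space M. g \<A> \<D> (\<lambda>A\<in>\<D>. W A \<omega>) \<in> S}"
  define F' where "F' = {\<omega> \<in> space M. g \<B> \<D>' (\<lambda>A\<in>\<D>'. W A \<omega>) \<in> R}"
  have m: "E' \<in> events" "F' \<in> events"
    using measurable_compose[OF Wm[OF D(2)] gm[of \<A> \<D>]] measurable_compose[OF Wm[OF D'(2)] gm[of \<B> \<D>']] S R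
    by (auto simp: E'_def F'_def)
  have E': "prob E' = prob E" 
    using geq[OF A(1) D(1,2,3,6)] m E by (intro finite_measure_eq_AE) (auto simp: E_def E'_def)
  have F': "prob F' = prob F" 
    using geq[OF B(1) D'(1,2,3,6)] m F by (intro finite_measure_eq_AE) (auto simp: F_def F'_def)
  have EF': "prob (E' \<inter> F') = prob (E \<inter> F)" 
    using geq[OF A(1) D(1,2,3,6)] geq[OF B(1) D'(1,2,3,6)] m E F
    by (intro finite_measure_eq_AE) (auto simp: F_def F'_def E_def E'_def)
  have "prob (E' \<inter> F') = prob E' * prob F'"
  proof -
    have "E' \<inter> F' = {\<omega> \<in> space M. g \<A> \<D> (\<lambda>A\<in>\<D>. W A \<omega>) \<in> S \<and> g \<B> \<D>' (\<lambda>A\<in>\<D>'. W A \<omega>) \<in> R}"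
      by (auto simp: E'_def F'_def)
    then show ?thesis
      using indep_varD[OF ind' S R] by (simp add: E'_def F'_def vimage_def Int_def conj_commute)
  qed
  then show "prob (E \<inter> F) = prob E * prob F" using E' F' EF' by simp
qed

end

context white_noise
begin

text \<open>Independence is checked on two intersection-stable classes and then extended to the
  sigma-algebras they generate. The sets in \<open>\<B>\<close> lie strictly after time
  \<open>c\<close>, hence are disjoint from every set whose noise generates the past.\<close>

lemma filtration_indep:
  assumes B: "finite \<B>" "\<B> \<subseteq> noise_sets" "\<Union>\<B> \<subseteq> {c<..} \<times> UNIV"
    and X: "X \<in> borel_measurable (noise_filtration M W c)"
    and h: "h \<in> borel_measurable (PiM \<B> (\<lambda>_. borel))"
  shows "indep_var borel X borel (\<lambda>\<omega>. h (\<lambda>B\<in>\<B>. W B \<omega>))"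
proof -
  \<comment> \<open>Agreement with a finite cylinder is asked only almost surely, so that the null
    sets augmenting the filtration belong to \<open>P\<close> too.\<close>
  define P where "P = {E \<in> events. \<exists>\<A> S. finite \<A> \<and> \<A> \<subseteq> {A \<in> noise_sets. A \<subseteq> {0..c} \<times> UNIV} \<and>
    (\<forall>A\<in>\<A>. S A \<in> sets borel) \<and> (AE \<omega> in M. \<omega> \<in> E \<longleftrightarrow> (\<forall>A\<in>\<A>. W A \<omega> \<in> S A))}"
  define Q where "Q = {{\<omega> \<in> space M. (\<lambda>B\<in>\<B>. W B \<omega>) \<in> R} | R. R \<in> sets (PiM \<B> (\<lambda>_. borel))}"
  have Wm: "(\<lambda>\<omega>. \<lambda>A\<in>\<B>. W A \<omega>) \<in> measurable M (PiM \<B> (\<lambda>_. borel))"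
    using B noise_measurable by (intro measurable_restrict) auto
  have "indep_set P Q"
  proof (rule indep_setI)
    show "P \<subseteq> events" by (auto simp: P_def)
    show "Q \<subseteq> events" using Wm by (auto simp: Q_def)
    fix E F assume "E \<in> P" "F \<in> Q"
    then obtain R where R: "R \<in> sets (PiM \<B> (\<lambda>_. borel))" "F = {\<omega> \<in> space M. (\<lambda>B\<in>\<B>. W B \<omega>) \<in> R}"
      by (auto simp: Q_def)
    obtain \<A> S where A: "finite \<A>" "\<A> \<subseteq> {A \<in> noise_sets. A \<subseteq> {0..c} \<times> UNIV}" "\<forall>A\<in>\<A>. S A \<in> sets borel"
      "AE \<omega> in M. \<omega> \<in> E \<longleftrightarrow> (\<forall>A\<in>\<A>. W A \<omega> \<in> S A)" and E: "E \<in> events"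
      using \<open>E \<in> P\<close> unfolding P_def by blast
    define E' where "E' = {\<omega> \<in> space M. (\<lambda>A\<in>\<A>. W A \<omega>) \<in> PiE \<A> S}"
    have "\<Union>\<A> \<inter> \<Union>\<B> = {}" using A(2) B(3) by fastforce
    moreover have "\<A> \<subseteq> noise_sets" using A by blast
    moreover have "PiE \<A> S \<in> sets (PiM \<A> (\<lambda>_. borel))" using A by (intro sets_PiM_I_finite) auto
    ultimately have *: "E' \<in> events" "F \<in> events" "prob (E' \<inter> F) = prob E' * prob F"
      unfolding E'_def R(2) using noise_indep_families[OF A(1) _ B(1,2) _ _ R(1)] by blast+
    have ae: "AE \<omega> in M. \<omega> \<in> E \<longleftrightarrow> \<omega> \<in> E'"
      using A(4) AE_space by eventually_elim (auto simp: E'_def PiE_iff)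
    have "prob (E \<inter> F) = prob (E' \<inter> F)"
      by (rule finite_measure_eq_AE) (use ae * E in auto)
    moreover have "prob E = prob E'"
      by (rule finite_measure_eq_AE) (use ae * E in auto)
    ultimately show "prob (E \<inter> F) = prob E * prob F" using * by simp
  qed
  moreover have "Int_stable P"
  proof (rule Int_stableI)
    fix E1 E2 assume "E1 \<in> P" "E2 \<in> P"
    then obtain \<A>1 S1 \<A>2 S2 where
      1: "finite \<A>1" "\<A>1 \<subseteq> {A \<in> noise_sets. A \<subseteq> {0..c} \<times> UNIV}" "\<forall>A\<in>\<A>1. S1 A \<in> sets borel"
        "AE \<omega> in M. \<omega> \<in> E1 \<longleftrightarrow> (\<forall>A\<in>\<A>1. W A \<omega> \<in> S1 A)" "E1 \<in> events" and
      2: "finite \<A>2" "\<A>2 \<subseteq> {A \<in> noise_sets. A \<subseteq> {0..c} \<times> UNIV}" "\<forall>A\<in>\<A>2. S2 A \<in> sets borel"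
        "AE \<omega> in M. \<omega> \<in> E2 \<longleftrightarrow> (\<forall>A\<in>\<A>2. W A \<omega> \<in> S2 A)" "E2 \<in> events"
      unfolding P_def by blast
    let ?S = "\<lambda>A. (if A \<in> \<A>1 then S1 A else UNIV) \<inter> (if A \<in> \<A>2 then S2 A else UNIV)"
    have "AE \<omega> in M. \<omega> \<in> E1 \<inter> E2 \<longleftrightarrow> (\<forall>A\<in>\<A>1 \<union> \<A>2. W A \<omega> \<in> ?S A)"
      using 1(4) 2(4) by eventually_elim auto
    moreover have "finite (\<A>1 \<union> \<A>2)" "\<A>1 \<union> \<A>2 \<subseteq> {A \<in> noise_sets. A \<subseteq> {0..c} \<times> UNIV}"
      "\<forall>A\<in>\<A>1 \<union> \<A>2. ?S A \<in> sets borel" "E1 \<inter> E2 \<in> events"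
      using 1 2 by auto
    ultimately show "E1 \<inter> E2 \<in> P" unfolding P_def
      by (intro CollectI conjI exI[of _ "\<A>1 \<union> \<A>2"] exI[of _ ?S]) simp_all
  qed
  moreover have "Int_stable Q"
  proof (rule Int_stableI)
    fix E1 E2 assume "E1 \<in> Q" "E2 \<in> Q"
    then obtain R1 R2 where "R1 \<in> sets (PiM \<B> (\<lambda>_. borel))" "E1 = {\<omega> \<in> space M. (\<lambda>B\<in>\<B>. W B \<omega>) \<in> R1}"
      "R2 \<in> sets (PiM \<B> (\<lambda>_. borel))" "E2 = {\<omega> \<in> space M. (\<lambda>B\<in>\<B>. W B \<omega>) \<in> R2}"
      by (auto simp: Q_def)
    then have "R1 \<inter> R2 \<in> sets (PiM \<B> (\<lambda>_. borel))"
      "E1 \<inter> E2 = {\<omega> \<in> space M. (\<lambda>B\<in>\<B>. W B \<omega>) \<in> R1 \<inter> R2}" by auto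
    then show "E1 \<inter> E2 \<in> Q" unfolding Q_def by blast
  qed
  ultimately have ind: "indep_set (sigma_sets (space M) P) (sigma_sets (space M) Q)"
    by (rule indep_set_sigma_sets)
  have FP: "sets (noise_filtration M W c) \<subseteq> sigma_sets (space M) P"
    unfolding filtration_sets
  proof (rule sigma_sets_mono', safe)
    fix N assume N: "N \<in> null_sets M"
    \<comment> \<open>A null set is almost surely the impossible cylinder
      \<open>W {} \<omega> \<in> {}\<close>.\<close>
    have "AE \<omega> in M. \<omega> \<in> N \<longleftrightarrow> (\<forall>A\<in>{{} :: (real \<times> real) set}. W A \<omega> \<in> {})"
      using AE_not_in[OF N] by simp
    then show "N \<in> P" unfolding P_def using N
      by (intro CollectI conjI exI[of _ "{{}}"] exI[of _ "\<lambda>_. {}"]) auto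
  next
    fix A :: "(real \<times> real) set" and S :: "real set"
    assume A: "A \<subseteq> {0..c} \<times> UNIV" "A \<in> noise_sets" "S \<in> sets borel"
    have "AE \<omega> in M. \<omega> \<in> W A -` S \<inter> space M \<longleftrightarrow> (\<forall>A\<in>{A}. W A \<omega> \<in> S)"
      using AE_space by eventually_elim auto
    then show "W A -` S \<inter> space M \<in> P" unfolding P_def using A noise_measurable[OF A(2)]
      by (intro CollectI conjI exI[of _ "{A}"] exI[of _ "\<lambda>_. S"]) (auto intro: measurable_sets)
  qed
  show ?thesis
    unfolding indep_var_eq
  proof (intro conjI)
    show "random_variable borel X" using X by (rule filtration_measurable)
    show "random_variable borel (\<lambda>\<omega>. h (\<lambda>B\<in>\<B>. W B \<omega>))"
      using measurable_compose[OF Wm h] .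
    have 1: "sigma_sets (space M) {X -` A \<inter> space M |A. A \<in> sets borel} \<subseteq> sigma_sets (space M) P"
    proof (rule sigma_sets_mono)
      have "X -` A \<inter> space M \<in> sets (noise_filtration M W c)" if "A \<in> sets borel" for A
        using measurable_sets[OF X that] by simp
      then show "{X -` A \<inter> space M |A. A \<in> sets borel} \<subseteq> sigma_sets (space M) P"
        using FP by blast
    qed
    have 2: "sigma_sets (space M) {(\<lambda>\<omega>. h (\<lambda>B\<in>\<B>. W B \<omega>)) -` A \<inter> space M |A. A \<in> sets borel}
        \<subseteq> sigma_sets (space M) Q"
    proof (rule sigma_sets_mono')
      have "(\<lambda>\<omega>. h (\<lambda>B\<in>\<B>. W B \<omega>)) -` A \<inter> space M \<in> Q" if "A \<in> sets borel" for A
      proof -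
        have "(\<lambda>\<omega>. h (\<lambda>B\<in>\<B>. W B \<omega>)) -` A \<inter> space M =
          {\<omega> \<in> space M. (\<lambda>B\<in>\<B>. W B \<omega>) \<in> h -` A \<inter> space (PiM \<B> (\<lambda>_. borel))}"
          by (auto simp: space_PiM)
        then show ?thesis using measurable_sets[OF h that] unfolding Q_def by blast
      qed
      then show "{(\<lambda>\<omega>. h (\<lambda>B\<in>\<B>. W B \<omega>)) -` A \<inter> space M |A. A \<in> sets borel} \<subseteq> Q" by blast
    qed
    show "indep_set (sigma_sets (space M) {X -` A \<inter> space M |A. A \<in> sets borel})
       (sigma_sets (space M) {(\<lambda>\<omega>. h (\<lambda>B\<in>\<B>. W B \<omega>)) -` A \<inter> space M |A. A \<in> sets borel})"
      using ind 1 2 unfolding indep_sets2_eq by blast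
  qed
qed

lemma filtration_noise_mult:
  assumes X: "X \<in> borel_measurable (noise_filtration M W c)" "integrable M X"
    and C: "C \<in> noise_sets" "C \<subseteq> {c<..} \<times> UNIV"
  shows "integrable M (\<lambda>\<omega>. X \<omega> * W C \<omega>)" "expectation (\<lambda>\<omega>. X \<omega> * W C \<omega>) = 0"
proof -
  have "(\<lambda>w. w C) \<in> borel_measurable (PiM {C} (\<lambda>_. borel :: real measure))"
    by (rule measurable_component_singleton) simp
  from filtration_indep[of "{C}", OF _ _ _ X(1) this] C
  have ind: "indep_var borel X borel (W C)" by auto
  show "integrable M (\<lambda>\<omega>. X \<omega> * W C \<omega>)"
    by (rule indep_var_integrable[OF ind X(2) noise_integrable[OF C(1)]])
  show "expectation (\<lambda>\<omega>. X \<omega> * W C \<omega>) = 0"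
    using indep_var_lebesgue_integral[OF ind X(2) noise_integrable[OF C(1)]] noise_mean[OF C(1)] by simp
qed

lemma filtration_noise_mult2:
  assumes X: "X \<in> borel_measurable (noise_filtration M W c)" "integrable M X"
    and C: "C \<in> noise_sets" "C \<subseteq> {c<..} \<times> UNIV" and D: "D \<in> noise_sets" "D \<subseteq> {c<..} \<times> UNIV"
  shows "integrable M (\<lambda>\<omega>. X \<omega> * (W C \<omega> * W D \<omega>))"
    "expectation (\<lambda>\<omega>. X \<omega> * (W C \<omega> * W D \<omega>)) = expectation X * measure lborel (C \<inter> D)"
proof -
  have "(\<lambda>w. w C * w D) \<in> borel_measurable (PiM {C, D} (\<lambda>_. borel :: real measure))"
    by (intro borel_measurable_times measurable_component_singleton) auto
  from filtration_indep[of "{C, D}", OF _ _ _ X(1) this] C D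
  have ind: "indep_var borel X borel (\<lambda>\<omega>. W C \<omega> * W D \<omega>)" by auto
  note int = noise_mult_integrable[OF C(1) D(1)]
  show "integrable M (\<lambda>\<omega>. X \<omega> * (W C \<omega> * W D \<omega>))"
    by (rule indep_var_integrable[OF ind X(2) int])
  show "expectation (\<lambda>\<omega>. X \<omega> * (W C \<omega> * W D \<omega>)) = expectation X * measure lborel (C \<inter> D)"
    using indep_var_lebesgue_integral[OF ind X(2) int] noise_cov[OF C(1) D(1)] by simp
qed

end

section \<open>The isometry of the Ito--Walsh integral\<close>

abbreviation el_rect :: "'w elementary \<Rightarrow> (real \<times> real) set" where
  "el_rect e \<equiv> {fst e<..fst (snd e)} \<times> fst (snd (snd e))"

abbreviation el_coeff :: "'w elementary \<Rightarrow> 'w \<Rightarrow> real" where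
  "el_coeff e \<equiv> snd (snd (snd e))"

lemma simple_field_sum:
  "simple_field \<xi> s y \<omega> = (\<Sum>i<length \<xi>. el_coeff (\<xi> ! i) \<omega> * indicator (el_rect (\<xi> ! i)) (s, y))"
  unfolding simple_field_def by (simp add: sum_list_sum_nth case_prod_unfold atLeast0LessThan)

lemma simple_integral_sum:
  "simple_integral W \<xi> \<omega> = (\<Sum>i<length \<xi>. el_coeff (\<xi> ! i) \<omega> * W (el_rect (\<xi> ! i)) \<omega>)"
  unfolding simple_integral_def by (simp add: sum_list_sum_nth case_prod_unfold atLeast0LessThan)

lemma (in pair_sigma_finite) integral_mult_Fubini:
  fixes f :: "'a \<Rightarrow> real" and g :: "'b \<Rightarrow> real"
  assumes f: "integrable M1 f" and g: "integrable M2 g"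
  shows "integrable (M1 \<Otimes>\<^sub>M M2) (\<lambda>p. f (fst p) * g (snd p))"
    "(\<integral>p. f (fst p) * g (snd p) \<partial>(M1 \<Otimes>\<^sub>M M2)) = (\<integral>x. f x \<partial>M1) * (\<integral>y. g y \<partial>M2)"
proof -
  have [measurable]: "f \<in> borel_measurable M1" "g \<in> borel_measurable M2" using f g by auto
  have "integrable (M1 \<Otimes>\<^sub>M M2) (\<lambda>(x, y). f x * g y)"
  proof (rule Fubini_integrable)
    show "integrable M1 (\<lambda>x. \<integral>y. norm (case (x, y) of (x, y) \<Rightarrow> f x * g y) \<partial>M2)"
      using f by (simp add: abs_mult integrable_mult_left)
    show "AE x in M1. integrable M2 (\<lambda>y. case (x, y) of (x, y) \<Rightarrow> f x * g y)"
      using g by simp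
  qed simp
  then show int: "integrable (M1 \<Otimes>\<^sub>M M2) (\<lambda>p. f (fst p) * g (snd p))"
    by (simp add: case_prod_unfold)
  show "(\<integral>p. f (fst p) * g (snd p) \<partial>(M1 \<Otimes>\<^sub>M M2)) = (\<integral>x. f x \<partial>M1) * (\<integral>y. g y \<partial>M2)"
    using integral_fst'[OF int] by simp
qed

context white_noise
begin

lemma elementary_onD:
  assumes "e \<in> elementary_on M W t L"
  shows "0 \<le> fst e" "fst e \<le> fst (snd e)" "fst (snd e) \<le> t" "fst (snd (snd e)) \<in> sets borel"
    "fst (snd (snd e)) \<subseteq> {0..L}" "el_rect e \<in> noise_sets" "el_rect e \<subseteq> {0..t} \<times> {0..L}"
    "el_coeff e \<in> borel_measurable (noise_filtration M W (fst e))"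
    "\<exists>K. \<forall>\<omega>\<in>space M. \<bar>el_coeff e \<omega>\<bar> \<le> K"
proof -
  show *: "0 \<le> fst e" "fst e \<le> fst (snd e)" "fst (snd e) \<le> t" "fst (snd (snd e)) \<in> sets borel"
    "fst (snd (snd e)) \<subseteq> {0..L}" 
    "el_coeff e \<in> borel_measurable (noise_filtration M W (fst e))"
    "\<exists>K. \<forall>\<omega>\<in>space M. \<bar>el_coeff e \<omega>\<bar> \<le> K"
    using assms unfolding elementary_on_def by (cases e; simp)+
  show "el_rect e \<in> noise_sets" using * by (intro noise_sets_rect)
  show "el_rect e \<subseteq> {0..t} \<times> {0..L}" using * by auto
qed

lemma integrable_bounded_mult:
  fixes X Y :: "_ \<Rightarrow> real"
  assumes "X \<in> borel_measurable M" "\<exists>K. \<forall>\<omega>\<in>space M. \<bar>X \<omega>\<bar> \<le> K" "integrable M Y"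
  shows "integrable M (\<lambda>\<omega>. X \<omega> * Y \<omega>)"
proof -
  obtain K where K: "\<forall>\<omega>\<in>space M. \<bar>X \<omega>\<bar> \<le> K" using assms by auto
  show ?thesis
  proof (rule Bochner_Integration.integrable_bound)
    show "integrable M (\<lambda>\<omega>. K * Y \<omega>)" using assms by simp
    show "(\<lambda>\<omega>. X \<omega> * Y \<omega>) \<in> borel_measurable M" using assms by simp
    show "AE \<omega> in M. norm (X \<omega> * Y \<omega>) \<le> norm (K * Y \<omega>)"
    proof (rule AE_I2)
      fix \<omega> assume "\<omega> \<in> space M"
      then have "\<bar>X \<omega>\<bar> \<le> \<bar>K\<bar>" using K by fastforce
      then show "norm (X \<omega> * Y \<omega>) \<le> norm (K * Y \<omega>)" by (simp add: abs_mult mult_right_mono)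
    qed
  qed
qed

text \<open>The rectangle that starts first is cut at the start \<open>c\<close> of the other one.
  Its part before \<open>c\<close> belongs to the past together with both coefficients, and the
  centred independent noise of the other rectangle kills it. Its part after \<open>c\<close>
  contributes the covariance of two noises whose product is independent of the coefficients.\<close>

lemma elementary_cov_ordered:
  assumes e: "e \<in> elementary_on M W t L" and f: "f \<in> elementary_on M W t L"
    and le: "fst e \<le> fst f"
  shows "integrable M (\<lambda>\<omega>. (el_coeff e \<omega> * W (el_rect e) \<omega>) * (el_coeff f \<omega> * W (el_rect f) \<omega>)) \<and>
    expectation (\<lambda>\<omega>. (el_coeff e \<omega> * W (el_rect e) \<omega>) * (el_coeff f \<omega> * W (el_rect f) \<omega>)) =
      expectation (\<lambda>\<omega>. el_coeff e \<omega> * el_coeff f \<omega>) * measure lborel (el_rect e \<inter> el_rect f)"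
proof -
  obtain a b A X where e_eq: "e = (a, b, A, X)" by (cases e)
  obtain c d B Y where f_eq: "f = (c, d, B, Y)" by (cases f)
  note E = elementary_onD[OF e, unfolded e_eq fst_conv snd_conv]
  note F = elementary_onD[OF f, unfolded f_eq fst_conv snd_conv]
  have ac: "a \<le> c" using le by (simp add: e_eq f_eq)
  \<comment> \<open>If the first rectangle ends before \<open>c\<close>, then \<open>m = b\<close>
    and the part \<open>?P2\<close> is empty.\<close>
  define m where "m = min b c"
  have m: "a \<le> m" "m \<le> b" "m \<le> c" using E ac by (auto simp: m_def)
  let ?P = "{a<..b} \<times> A" let ?P1 = "{a<..m} \<times> A" let ?P2 = "{m<..b} \<times> A" let ?Q = "{c<..d} \<times> B"
  have n: "?P1 \<in> noise_sets" "?P2 \<in> noise_sets" using E m by (auto intro!: noise_sets_rect)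
  have P: "?P1 \<union> ?P2 = ?P" "?P1 \<inter> ?P2 = {}" using m by auto
  have ae: "AE \<omega> in M. W ?P \<omega> = W ?P1 \<omega> + W ?P2 \<omega>"
    using noise_additive[OF n P(2)] by (simp only: P(1))
  have P2: "?P2 \<subseteq> {c<..} \<times> UNIV" by (auto simp: m_def)
  have Q: "?Q \<subseteq> {c<..} \<times> UNIV" by auto
  have X: "X \<in> borel_measurable (noise_filtration M W c)"
    using filtration_measurable_mono[OF E(8) ac] .
  have P1: "W ?P1 \<in> borel_measurable (noise_filtration M W c)"
    by (rule filtration_noise[OF n(1)]) (use E m in auto)
  obtain K1 K2 where K: "\<forall>\<omega>\<in>space M. \<bar>X \<omega>\<bar> \<le> K1" "\<forall>\<omega>\<in>space M. \<bar>Y \<omega>\<bar> \<le> K2" using E(9) F(9) by auto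
  have bdd: "\<exists>K. \<forall>\<omega>\<in>space M. \<bar>X \<omega> * Y \<omega>\<bar> \<le> K"
  proof (intro exI ballI)
    fix \<omega> assume "\<omega> \<in> space M"
    then have "\<bar>X \<omega>\<bar> \<le> \<bar>K1\<bar>" "\<bar>Y \<omega>\<bar> \<le> \<bar>K2\<bar>" using K by fastforce+
    then show "\<bar>X \<omega> * Y \<omega>\<bar> \<le> \<bar>K1\<bar> * \<bar>K2\<bar>" by (simp add: abs_mult mult_mono)
  qed
  have XYm: "(\<lambda>\<omega>. X \<omega> * Y \<omega>) \<in> borel_measurable (noise_filtration M W c)" using X F(8) by simp
  then have XYM: "(\<lambda>\<omega>. X \<omega> * Y \<omega>) \<in> borel_measurable M" by (rule filtration_measurable)
  have intXY: "integrable M (\<lambda>\<omega>. X \<omega> * Y \<omega>)"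
    using integrable_bounded_mult[OF XYM bdd integrable_const[of 1]] by simp
  have int1: "integrable M (\<lambda>\<omega>. X \<omega> * Y \<omega> * W ?P1 \<omega>)"
    by (rule integrable_bounded_mult[OF XYM bdd noise_integrable[OF n(1)]])
  have "(\<lambda>\<omega>. X \<omega> * Y \<omega> * W ?P1 \<omega>) \<in> borel_measurable (noise_filtration M W c)" using XYm P1 by simp
  note I = filtration_noise_mult[OF this int1 F(6) Q]
  note J = filtration_noise_mult2[OF XYm intXY n(2) P2 F(6) Q]
  have "AE \<omega> in M. (X \<omega> * W ?P \<omega>) * (Y \<omega> * W ?Q \<omega>) =
      X \<omega> * Y \<omega> * W ?P1 \<omega> * W ?Q \<omega> + X \<omega> * Y \<omega> * (W ?P2 \<omega> * W ?Q \<omega>)"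
    using ae by eventually_elim (simp add: algebra_simps)
  moreover have [measurable]: "X \<in> borel_measurable M" "Y \<in> borel_measurable M" 
    "W ?P \<in> borel_measurable M" "W ?P1 \<in> borel_measurable M" "W ?P2 \<in> borel_measurable M" "W ?Q \<in> borel_measurable M"
    using filtration_measurable X F(8) noise_measurable n E(6) F(6) by blast+
  ultimately have "integrable M (\<lambda>\<omega>. (X \<omega> * W ?P \<omega>) * (Y \<omega> * W ?Q \<omega>)) =
     integrable M (\<lambda>\<omega>. X \<omega> * Y \<omega> * W ?P1 \<omega> * W ?Q \<omega> + X \<omega> * Y \<omega> * (W ?P2 \<omega> * W ?Q \<omega>))"
    "expectation (\<lambda>\<omega>. (X \<omega> * W ?P \<omega>) * (Y \<omega> * W ?Q \<omega>)) =
     expectation (\<lambda>\<omega>. X \<omega> * Y \<omega> * W ?P1 \<omega> * W ?Q \<omega> + X \<omega> * Y \<omega> * (W ?P2 \<omega> * W ?Q \<omega>))"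
    by (intro integrable_cong_AE integral_cong_AE; simp)+
  moreover have "?P2 \<inter> ?Q = ?P \<inter> ?Q" using m by auto
  ultimately show ?thesis using I J by (simp add: e_eq f_eq)
qed

lemma elementary_cov:
  assumes e: "e \<in> elementary_on M W t L" and f: "f \<in> elementary_on M W t L"
  shows "integrable M (\<lambda>\<omega>. (el_coeff e \<omega> * W (el_rect e) \<omega>) * (el_coeff f \<omega> * W (el_rect f) \<omega>))"
    "expectation (\<lambda>\<omega>. (el_coeff e \<omega> * W (el_rect e) \<omega>) * (el_coeff f \<omega> * W (el_rect f) \<omega>)) =
      expectation (\<lambda>\<omega>. el_coeff e \<omega> * el_coeff f \<omega>) * measure lborel (el_rect e \<inter> el_rect f)"
  using elementary_cov_ordered[OF e f] elementary_cov_ordered[OF f e]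
  by (cases "fst e \<le> fst f"; simp add: mult.commute Int_commute)+

lemma simple_integral_mean:
  assumes "set \<xi> \<subseteq> elementary_on M W t L"
  shows "integrable M (simple_integral W \<xi>)" "expectation (simple_integral W \<xi>) = 0"
proof -
  have e: "integrable M (\<lambda>\<omega>. el_coeff (\<xi> ! i) \<omega> * W (el_rect (\<xi> ! i)) \<omega>) \<and>
    expectation (\<lambda>\<omega>. el_coeff (\<xi> ! i) \<omega> * W (el_rect (\<xi> ! i)) \<omega>) = 0" if "i < length \<xi>" for i
  proof -
    note E = elementary_onD[OF subsetD[OF assms nth_mem[OF that]]]
    have "integrable M (el_coeff (\<xi> ! i))"
      using integrable_bounded_mult[OF filtration_measurable[OF E(8)] E(9) integrable_const[of 1]] by simp
    moreover have "el_rect (\<xi> ! i) \<subseteq> {fst (\<xi> ! i)<..} \<times> UNIV" by auto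
    ultimately show ?thesis using filtration_noise_mult[OF E(8) _ E(6)] by blast
  qed
  have eq: "simple_integral W \<xi> = (\<lambda>\<omega>. \<Sum>i<length \<xi>. el_coeff (\<xi> ! i) \<omega> * W (el_rect (\<xi> ! i)) \<omega>)"
    by (rule ext) (rule simple_integral_sum)
  show "integrable M (simple_integral W \<xi>)"
    unfolding eq using e by (intro Bochner_Integration.integrable_sum) auto
  show "expectation (simple_integral W \<xi>) = 0"
    unfolding eq using e by (subst Bochner_Integration.integral_sum) auto
qed

text \<open>Both squares expand into the same double sum \<open>?S\<close>, the field by Fubini on
  product functions and the integral by \<open>elementary_cov\<close>. Overlapping rectangles in the
  list are covered, since the covariance already accounts for the overlap.\<close>

lemma simple_isometry:
  fixes t L :: real and \<xi> :: "'w elementary list"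
  assumes xi: "set \<xi> \<subseteq> elementary_on M W t L"
  defines "D \<equiv> restrict_space lborel ({0..t} \<times> {0..L})"
  shows "(\<lambda>(\<omega>, s, y). simple_field \<xi> s y \<omega>) \<in> borel_measurable (M \<Otimes>\<^sub>M D)"
    "(\<integral>\<^sup>+(\<omega>, s, y). ennreal ((simple_field \<xi> s y \<omega>)\<^sup>2) \<partial>(M \<Otimes>\<^sub>M D)) =
      (\<integral>\<^sup>+\<omega>. ennreal ((simple_integral W \<xi> \<omega>)\<^sup>2) \<partial>M)"
    "(\<integral>\<^sup>+\<omega>. ennreal ((simple_integral W \<xi> \<omega>)\<^sup>2) \<partial>M) < \<infinity>"
proof -
  let ?n = "length \<xi>"
  let ?X = "\<lambda>i. el_coeff (\<xi> ! i)" and ?R = "\<lambda>i. el_rect (\<xi> ! i)"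
  have "finite_measure D"
  proof (rule finite_measureI)
    have "emeasure D (space D) = emeasure lborel ({0..t} \<times> {0..L})"
      unfolding D_def by (simp add: emeasure_restrict_space space_restrict_space borel_Times)
    also have "{0..t} \<times> {0..L} = cbox (0, 0) (t, L)" by (simp add: cbox_Pair_eq)
    finally show "emeasure D (space D) \<noteq> \<infinity>" by (simp add: emeasure_lborel_cbox_eq)
  qed
  then interpret D: finite_measure D .
  interpret MD: pair_sigma_finite M D ..
  note E = elementary_onD[OF subsetD[OF xi nth_mem]]
  have [measurable]: "?X i \<in> borel_measurable M" if "i < ?n" for i
    using filtration_measurable[OF E(8)] that by simp
  have Rm: "?R i \<in> sets D" if "i < ?n" for i
    using E(6,7)[OF that] by (auto simp: D_def sets_restrict_space_iff noise_sets_borel borel_Times)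
  have intX: "integrable M (\<lambda>\<omega>. ?X i \<omega> * ?X j \<omega>)" if "i < ?n" "j < ?n" for i j
    using integrable_bounded_mult[OF _ E(9), OF _ that(1), of "?X j"]
      integrable_bounded_mult[OF _ E(9) integrable_const[of 1], OF _ that(2)] that by simp
  have intR: "integrable D (indicator (?R i \<inter> ?R j) :: _ \<Rightarrow> real)" if "i < ?n" "j < ?n" for i j
    using Rm that by (intro integrable_real_indicator) (auto simp: D.emeasure_finite less_top[symmetric])
  have meas: "measure D (?R i \<inter> ?R j) = measure lborel (?R i \<inter> ?R j)" if "i < ?n" "j < ?n" for i j
    unfolding D_def using E(7)[OF that(1)] by (intro measure_restrict_space) (auto simp: borel_Times)
  note F = MD.integral_mult_Fubini[OF intX intR]
  have sq: "(simple_field \<xi> s y \<omega>)\<^sup>2 = (\<Sum>i<?n. \<Sum>j<?n. (?X i \<omega> * ?X j \<omega>) * indicator (?R i \<inter> ?R j) (s, y))"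
    for s y \<omega>
    unfolding simple_field_sum power2_eq_square sum_product
    by (intro sum.cong refl) (auto simp: indicator_inter_arith)
  have sq': "(simple_integral W \<xi> \<omega>)\<^sup>2 = (\<Sum>i<?n. \<Sum>j<?n. (?X i \<omega> * W (?R i) \<omega>) * (?X j \<omega> * W (?R j) \<omega>))"
    for \<omega>
    unfolding simple_integral_sum power2_eq_square sum_product ..
  let ?S = "\<Sum>i<?n. \<Sum>j<?n. expectation (\<lambda>\<omega>. ?X i \<omega> * ?X j \<omega>) * measure lborel (?R i \<inter> ?R j)"
  have "(\<lambda>p. simple_field \<xi> (fst (snd p)) (snd (snd p)) (fst p)) \<in> borel_measurable (M \<Otimes>\<^sub>M D)"
  proof -
    have "(\<lambda>p. indicator (?R i) (snd p) :: real) \<in> borel_measurable (M \<Otimes>\<^sub>M D)" if "i < ?n" for i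
      using Rm[OF that] by measurable
    then show ?thesis
      unfolding simple_field_sum by (intro borel_measurable_sum borel_measurable_times) auto
  qed
  then show "(\<lambda>(\<omega>, s, y). simple_field \<xi> s y \<omega>) \<in> borel_measurable (M \<Otimes>\<^sub>M D)"
    by (simp add: case_prod_unfold)
  have I1: "integrable (M \<Otimes>\<^sub>M D) (\<lambda>p. (simple_field \<xi> (fst (snd p)) (snd (snd p)) (fst p))\<^sup>2)"
    unfolding sq prod.collapse using F by (intro Bochner_Integration.integrable_sum) auto
  have I2: "(\<integral>p. (simple_field \<xi> (fst (snd p)) (snd (snd p)) (fst p))\<^sup>2 \<partial>(M \<Otimes>\<^sub>M D)) = ?S"
  proof -
    have "(\<integral>p. (simple_field \<xi> (fst (snd p)) (snd (snd p)) (fst p))\<^sup>2 \<partial>(M \<Otimes>\<^sub>M D)) =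
      (\<Sum>i<?n. \<Sum>j<?n. \<integral>p. (?X i (fst p) * ?X j (fst p)) * indicator (?R i \<inter> ?R j) (snd p) \<partial>(M \<Otimes>\<^sub>M D))"
      unfolding sq prod.collapse using F
      by (subst Bochner_Integration.integral_sum;
          (intro sum.cong refl Bochner_Integration.integral_sum Bochner_Integration.integrable_sum)?; auto)
    also have "\<dots> = ?S"
      using F(2) Rm by (intro sum.cong refl) (simp add: meas)
    finally show ?thesis .
  qed
  note G = elementary_cov[OF subsetD[OF xi nth_mem] subsetD[OF xi nth_mem]]
  have J1: "integrable M (\<lambda>\<omega>. (simple_integral W \<xi> \<omega>)\<^sup>2)"
    unfolding sq' using G by (intro Bochner_Integration.integrable_sum) auto
  have J2: "expectation (\<lambda>\<omega>. (simple_integral W \<xi> \<omega>)\<^sup>2) = ?S"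
  proof -
    have "expectation (\<lambda>\<omega>. (simple_integral W \<xi> \<omega>)\<^sup>2) =
      (\<Sum>i<?n. \<Sum>j<?n. expectation (\<lambda>\<omega>. (?X i \<omega> * W (?R i) \<omega>) * (?X j \<omega> * W (?R j) \<omega>)))"
      unfolding sq' using G
      by (subst Bochner_Integration.integral_sum;
          (intro sum.cong refl Bochner_Integration.integral_sum Bochner_Integration.integrable_sum)?; auto)
    also have "\<dots> = ?S"
      using G(2) by (intro sum.cong refl) simp
    finally show ?thesis .
  qed
  have "(\<integral>\<^sup>+(\<omega>, s, y). ennreal ((simple_field \<xi> s y \<omega>)\<^sup>2) \<partial>(M \<Otimes>\<^sub>M D)) = ennreal ?S"
    using nn_integral_eq_integral[OF I1] I2 by (simp add: case_prod_unfold)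
  moreover have *: "(\<integral>\<^sup>+\<omega>. ennreal ((simple_integral W \<xi> \<omega>)\<^sup>2) \<partial>M) = ennreal ?S"
    using nn_integral_eq_integral[OF J1] J2 by simp
  ultimately show "(\<integral>\<^sup>+(\<omega>, s, y). ennreal ((simple_field \<xi> s y \<omega>)\<^sup>2) \<partial>(M \<Otimes>\<^sub>M D)) =
      (\<integral>\<^sup>+\<omega>. ennreal ((simple_integral W \<xi> \<omega>)\<^sup>2) \<partial>M)" by simp
  show "(\<integral>\<^sup>+\<omega>. ennreal ((simple_integral W \<xi> \<omega>)\<^sup>2) \<partial>M) < \<infinity>" using * by simp
qed

end

text \<open>Young's inequality, from \<open>(r * g - (f - g))^2 / r \<ge> 0\<close>. It stands in
  for Minkowski's inequality where integrals may be infinite; the weights are such that the factor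
  of the main term tends to 1 with \<open>r\<close>.\<close>

lemma nn_integral_square_le:
  fixes f g :: "'a \<Rightarrow> real"
  assumes [measurable]: "f \<in> borel_measurable N" "g \<in> borel_measurable N" and r: "0 < r"
  shows "(\<integral>\<^sup>+x. ennreal ((f x)\<^sup>2) \<partial>N) \<le>
    ennreal (1 + r) * (\<integral>\<^sup>+x. ennreal ((g x)\<^sup>2) \<partial>N) + ennreal (1 + 1 / r) * (\<integral>\<^sup>+x. ennreal ((f x - g x)\<^sup>2) \<partial>N)"
proof -
  have *: "(f x)\<^sup>2 \<le> (1 + r) * (g x)\<^sup>2 + (1 + 1 / r) * (f x - g x)\<^sup>2" for x
  proof -
    have "0 \<le> (r * g x - (f x - g x))\<^sup>2 / r" using r by simp
    also have "\<dots> = (1 + r) * (g x)\<^sup>2 + (1 + 1 / r) * (f x - g x)\<^sup>2 - (f x)\<^sup>2"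
      using r by (simp add: power2_eq_square field_simps)
    finally show ?thesis by simp
  qed
  have "(\<integral>\<^sup>+x. ennreal ((f x)\<^sup>2) \<partial>N) \<le>
    (\<integral>\<^sup>+x. ennreal (1 + r) * ennreal ((g x)\<^sup>2) + ennreal (1 + 1 / r) * ennreal ((f x - g x)\<^sup>2) \<partial>N)"
    using * r by (intro nn_integral_mono)
      (simp add: ennreal_mult[symmetric] ennreal_plus[symmetric] ennreal_leI del: ennreal_plus)
  also have "\<dots> = ennreal (1 + r) * (\<integral>\<^sup>+x. ennreal ((g x)\<^sup>2) \<partial>N) + ennreal (1 + 1 / r) * (\<integral>\<^sup>+x. ennreal ((f x - g x)\<^sup>2) \<partial>N)"
    by (simp add: nn_integral_add nn_integral_cmult)
  finally show ?thesis .
qed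

text \<open>First \<open>n\<close> tends to infinity with \<open>r\<close> fixed, which removes the
  errors and leaves the factor \<open>(1 + r) * (1 + r)\<close>; then \<open>r\<close> tends to zero
  along \<open>1 / Suc n\<close>. The second limit is taken for finite \<open>b\<close>, the
  infinite case being trivial.\<close>

lemma L2_limits_le:
  fixes a b :: ennreal and c d e :: "nat \<Rightarrow> ennreal"
  assumes a: "\<And>r n. 0 < r \<Longrightarrow> a \<le> ennreal (1 + r) * c n + ennreal (1 + 1 / r) * d n"
    and b: "\<And>r n. 0 < r \<Longrightarrow> c n \<le> ennreal (1 + r) * b + ennreal (1 + 1 / r) * e n"
    and d: "d \<longlonglongrightarrow> 0" and e: "e \<longlonglongrightarrow> 0" 
  shows "a \<le> b"
proof (cases "b = \<infinity>")
  case False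
  have 1: "a \<le> ennreal ((1 + r) * (1 + r)) * b" if r: "0 < r" for r
  proof (rule LIMSEQ_le_const)
    show "(\<lambda>n. ennreal (1 + r) * (ennreal (1 + r) * b + ennreal (1 + 1 / r) * e n) + ennreal (1 + 1 / r) * d n)
      \<longlonglongrightarrow> ennreal ((1 + r) * (1 + r)) * b"
    proof -
      have "(\<lambda>n. ennreal (1 + r) * (ennreal (1 + r) * b + ennreal (1 + 1 / r) * e n) + ennreal (1 + 1 / r) * d n)
        \<longlonglongrightarrow> ennreal (1 + r) * (ennreal (1 + r) * b + ennreal (1 + 1 / r) * 0) + ennreal (1 + 1 / r) * 0"
        by (intro tendsto_add ennreal_tendsto_cmult tendsto_const d e) auto
      then show ?thesis using r by (simp add: ennreal_mult mult.assoc)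
    qed
    show "\<exists>N. \<forall>n\<ge>N. a \<le> ennreal (1 + r) * (ennreal (1 + r) * b + ennreal (1 + 1 / r) * e n) + ennreal (1 + 1 / r) * d n"
      using order_trans[OF a[OF r] add_right_mono[OF mult_left_mono[OF b[OF r]]]] by auto
  qed
  obtain b' where b': "b = ennreal b'" "0 \<le> b'" using False by (cases b) auto
  show ?thesis
  proof (rule LIMSEQ_le_const)
    have "(\<lambda>n. (1 + 1 / real (Suc n)) * (1 + 1 / real (Suc n)) * b') \<longlonglongrightarrow> (1 + 0) * (1 + 0) * b'"
      by (intro tendsto_intros LIMSEQ_Suc[OF lim_1_over_n])
    then show "(\<lambda>n. ennreal ((1 + 1 / real (Suc n)) * (1 + 1 / real (Suc n)) * b')) \<longlonglongrightarrow> b"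
      using tendsto_ennrealI b' by fastforce
    show "\<exists>N. \<forall>n\<ge>N. a \<le> ennreal ((1 + 1 / real (Suc n)) * (1 + 1 / real (Suc n)) * b')"
      using 1[of "1 / real (Suc n)" for n] b' by (auto simp: ennreal_mult)
  qed
qed simp

text \<open>The approximants have equal norms on the two spaces, so they link the two limit norms;
  \<open>L2_limits_le\<close> is applied once in each direction.\<close>

lemma L2_isometry_limit:
  fixes f :: "'a \<Rightarrow> real" and g :: "'b \<Rightarrow> real" and F G
  assumes [measurable]: "f \<in> borel_measurable N" "\<And>n. F n \<in> borel_measurable N"
    "g \<in> borel_measurable N'" "\<And>n. G n \<in> borel_measurable N'"
    and iso: "\<And>n. (\<integral>\<^sup>+x. ennreal ((F n x)\<^sup>2) \<partial>N) = (\<integral>\<^sup>+x. ennreal ((G n x)\<^sup>2) \<partial>N')"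
    and f: "(\<lambda>n. \<integral>\<^sup>+x. ennreal ((f x - F n x)\<^sup>2) \<partial>N) \<longlonglongrightarrow> 0"
    and g: "(\<lambda>n. \<integral>\<^sup>+x. ennreal ((g x - G n x)\<^sup>2) \<partial>N') \<longlonglongrightarrow> 0"
  shows "(\<integral>\<^sup>+x. ennreal ((f x)\<^sup>2) \<partial>N) = (\<integral>\<^sup>+x. ennreal ((g x)\<^sup>2) \<partial>N')"
proof (rule antisym; rule L2_limits_le)
  show "(\<integral>\<^sup>+x. ennreal ((f x)\<^sup>2) \<partial>N) \<le> ennreal (1 + r) * (\<integral>\<^sup>+x. ennreal ((F n x)\<^sup>2) \<partial>N)
      + ennreal (1 + 1 / r) * (\<integral>\<^sup>+x. ennreal ((f x - F n x)\<^sup>2) \<partial>N)" if "0 < r" for r n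
    by (rule nn_integral_square_le) (use that in auto)
  show "(\<integral>\<^sup>+x. ennreal ((g x)\<^sup>2) \<partial>N') \<le> ennreal (1 + r) * (\<integral>\<^sup>+x. ennreal ((F n x)\<^sup>2) \<partial>N)
      + ennreal (1 + 1 / r) * (\<integral>\<^sup>+x. ennreal ((g x - G n x)\<^sup>2) \<partial>N')" if "0 < r" for r n
    unfolding iso by (rule nn_integral_square_le) (use that in auto)
  show "(\<integral>\<^sup>+x. ennreal ((F n x)\<^sup>2) \<partial>N) \<le> ennreal (1 + r) * (\<integral>\<^sup>+x. ennreal ((f x)\<^sup>2) \<partial>N)
      + ennreal (1 + 1 / r) * (\<integral>\<^sup>+x. ennreal ((f x - F n x)\<^sup>2) \<partial>N)" if "0 < r" for r n
    using nn_integral_square_le[of "F n" N f r] that by (simp add: power2_commute[of "F n x" "f x" for x])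
  show "(\<integral>\<^sup>+x. ennreal ((F n x)\<^sup>2) \<partial>N) \<le> ennreal (1 + r) * (\<integral>\<^sup>+x. ennreal ((g x)\<^sup>2) \<partial>N')
      + ennreal (1 + 1 / r) * (\<integral>\<^sup>+x. ennreal ((g x - G n x)\<^sup>2) \<partial>N')" if "0 < r" for r n
    unfolding iso using nn_integral_square_le[of "G n" N' g r] that
      by (simp add: power2_commute[of "G n x" "g x" for x])
qed (fact f g)+

context white_noise
begin

lemma walsh_isometry:
  fixes t L :: real
  assumes "has_walsh_integral M W t L \<Phi> I"
  defines "D \<equiv> restrict_space lborel ({0..t} \<times> {0..L})"
  shows "integrable M I" "expectation I = 0" "integrable M (\<lambda>\<omega>. (I \<omega>)\<^sup>2)"
    "(\<integral>\<^sup>+\<omega>. ennreal ((I \<omega>)\<^sup>2) \<partial>M) = (\<integral>\<^sup>+(\<omega>, s, y). ennreal ((\<Phi> s y \<omega>)\<^sup>2) \<partial>(M \<Otimes>\<^sub>M D))"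
proof -
  from assms obtain \<xi> where \<Phi>: "(\<lambda>(\<omega>, s, y). \<Phi> s y \<omega>) \<in> borel_measurable (M \<Otimes>\<^sub>M D)"
    and I[measurable]: "I \<in> borel_measurable M"
    and xi: "\<And>n. set (\<xi> n) \<subseteq> elementary_on M W t L"
    and lim: "(\<lambda>n. \<integral>\<^sup>+(\<omega>, s, y). ennreal ((\<Phi> s y \<omega> - simple_field (\<xi> n) s y \<omega>)\<^sup>2) \<partial>(M \<Otimes>\<^sub>M D)) \<longlonglongrightarrow> 0"
    and lim': "(\<lambda>n. \<integral>\<^sup>+\<omega>. ennreal ((I \<omega> - simple_integral W (\<xi> n) \<omega>)\<^sup>2) \<partial>M) \<longlonglongrightarrow> 0"
    unfolding has_walsh_integral_def Let_def D_def by blast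
  note iso = simple_isometry[OF xi, folded D_def]
  note mean = simple_integral_mean[OF xi]
  have [measurable]: "simple_integral W (\<xi> n) \<in> borel_measurable M" for n using mean by auto
  have "(\<integral>\<^sup>+p. ennreal ((case p of (\<omega>, s, y) \<Rightarrow> \<Phi> s y \<omega>)\<^sup>2) \<partial>(M \<Otimes>\<^sub>M D)) = (\<integral>\<^sup>+\<omega>. ennreal ((I \<omega>)\<^sup>2) \<partial>M)"
  proof (rule L2_isometry_limit[where F = "\<lambda>n (\<omega>, s, y). simple_field (\<xi> n) s y \<omega>"
        and G = "\<lambda>n. simple_integral W (\<xi> n)"])
    show "(\<lambda>n. \<integral>\<^sup>+\<omega>. ennreal ((I \<omega> - simple_integral W (\<xi> n) \<omega>)\<^sup>2) \<partial>M) \<longlonglongrightarrow> 0" by fact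
    show "(\<lambda>n. \<integral>\<^sup>+p. ennreal (((case p of (\<omega>, s, y) \<Rightarrow> \<Phi> s y \<omega>) -
        (case p of (\<omega>, s, y) \<Rightarrow> simple_field (\<xi> n) s y \<omega>))\<^sup>2) \<partial>(M \<Otimes>\<^sub>M D)) \<longlonglongrightarrow> 0"
      using lim by (simp add: case_prod_unfold)
    show "(\<integral>\<^sup>+p. ennreal ((case p of (\<omega>, s, y) \<Rightarrow> simple_field (\<xi> n) s y \<omega>)\<^sup>2) \<partial>(M \<Otimes>\<^sub>M D)) =
        (\<integral>\<^sup>+\<omega>. ennreal ((simple_integral W (\<xi> n) \<omega>)\<^sup>2) \<partial>M)" for n
      using iso(2)[of n] by (simp add: case_prod_unfold)
  qed (use \<Phi> iso(1) in auto)
  then show "(\<integral>\<^sup>+\<omega>. ennreal ((I \<omega>)\<^sup>2) \<partial>M) = (\<integral>\<^sup>+(\<omega>, s, y). ennreal ((\<Phi> s y \<omega>)\<^sup>2) \<partial>(M \<Otimes>\<^sub>M D))"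
    by (simp add: case_prod_unfold)
  have "\<forall>\<^sub>F n in sequentially. (\<integral>\<^sup>+\<omega>. ennreal ((I \<omega> - simple_integral W (\<xi> n) \<omega>)\<^sup>2) \<partial>M) < 1"
    using lim' by (rule order_tendstoD) simp
  then obtain n where n: "(\<integral>\<^sup>+\<omega>. ennreal ((I \<omega> - simple_integral W (\<xi> n) \<omega>)\<^sup>2) \<partial>M) < 1"
    by (auto simp: eventually_sequentially)
  have "(\<integral>\<^sup>+\<omega>. ennreal ((I \<omega>)\<^sup>2) \<partial>M) \<le> ennreal (1 + 1) * (\<integral>\<^sup>+\<omega>. ennreal ((simple_integral W (\<xi> n) \<omega>)\<^sup>2) \<partial>M)
      + ennreal (1 + 1 / 1) * (\<integral>\<^sup>+\<omega>. ennreal ((I \<omega> - simple_integral W (\<xi> n) \<omega>)\<^sup>2) \<partial>M)"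
    by (rule nn_integral_square_le) auto
  also have "\<dots> < \<infinity>" using iso(3)[of n] n
    by (auto simp: ennreal_mult_less_top ennreal_add_less_top intro: less_trans)
  finally show sq: "integrable M (\<lambda>\<omega>. (I \<omega>)\<^sup>2)" by (intro integrableI_bounded) auto
  then show int: "integrable M I" using square_integrable_imp_integrable[OF I] by blast
  \<comment> \<open>Simple integrals are centred, so nonnegativity of the variance of
    \<open>I\<close> minus a simple integral bounds the squared mean of \<open>I\<close> by the
    squared L2 distance, which tends to zero.\<close>
  have "\<bar>expectation I\<bar> \<le> 0"
  proof (rule LIMSEQ_le_const)
    let ?d = "\<lambda>n. \<integral>\<^sup>+\<omega>. ennreal ((I \<omega> - simple_integral W (\<xi> n) \<omega>)\<^sup>2) \<partial>M"
    have "(\<lambda>n. enn2real (?d n)) \<longlonglongrightarrow> 0"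
      by (rule tendsto_enn2real) (use lim' in simp_all)
    then show "(\<lambda>n. sqrt (enn2real (?d n))) \<longlonglongrightarrow> 0"
      using tendsto_real_sqrt by fastforce
    have "\<forall>\<^sub>F n in sequentially. ?d n < 1" using lim' by (rule order_tendstoD) simp
    then obtain N where N: "\<And>n. N \<le> n \<Longrightarrow> ?d n < 1" by (auto simp: eventually_sequentially)
    have "\<bar>expectation I\<bar> \<le> sqrt (enn2real (?d n))" if "N \<le> n" for n
    proof -
      let ?f = "\<lambda>\<omega>. I \<omega> - simple_integral W (\<xi> n) \<omega>"
      have "integrable M (\<lambda>\<omega>. (?f \<omega>)\<^sup>2)"
        using N[OF that] by (intro integrableI_bounded) (auto intro: less_trans)
      then have eq: "enn2real (?d n) = expectation (\<lambda>\<omega>. (?f \<omega>)\<^sup>2)"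
        by (simp add: integral_eq_nn_integral)
      have f: "integrable M ?f" "expectation ?f = expectation I"
        using int mean[of n] by auto
      have "0 \<le> variance ?f" by simp
      also have "variance ?f = expectation (\<lambda>\<omega>. (?f \<omega>)\<^sup>2) - (expectation ?f)\<^sup>2"
        by (rule variance_eq) fact+
      finally have "(expectation I)\<^sup>2 \<le> enn2real (?d n)" using f eq by simp
      then show ?thesis by (simp add: real_le_rsqrt)
    qed
    then show "\<exists>N. \<forall>n\<ge>N. \<bar>expectation I\<bar> \<le> sqrt (enn2real (?d n))" by auto
  qed
  then show "expectation I = 0" by simp
qed

end

section \<open>The Volterra operator\<close>

lemma heat_kernel_nonneg [simp]: "0 \<le> t \<Longrightarrow> 0 \<le> heat_kernel t z"
  by (simp add: heat_kernel_def)

lemma heat_kernel_measurable [measurable]: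
  assumes [measurable]: "f \<in> borel_measurable N" "g \<in> borel_measurable N"
  shows "(\<lambda>x. heat_kernel (f x) (g x)) \<in> borel_measurable N"
  unfolding heat_kernel_def by measurable

text \<open>\<open>heat_kernel (2 * \<beta> * (t - r)) 0\<close> is the integral over the line of
  the squared heat kernel at time \<open>\<beta> * (t - r)\<close>. The operator is thus the effect
  of the stochastic convolution on spatially constant second moments when there is no
  boundary.\<close>

definition volterra :: "real \<Rightarrow> (real \<Rightarrow> ennreal) \<Rightarrow> real \<Rightarrow> ennreal" where
  "volterra \<beta> \<phi> t = (\<integral>\<^sup>+r. ennreal (heat_kernel (2 * \<beta> * (t - r)) 0) * \<phi> r * indicator {0<..<t} r \<partial>lborel)"

lemma volterra_measurable [measurable]:
  assumes [measurable]: "\<phi> \<in> borel_measurable borel"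
  shows "volterra \<beta> \<phi> \<in> borel_measurable borel"
proof -
  have "(\<lambda>t. \<integral>\<^sup>+r. ennreal (heat_kernel (2 * \<beta> * (t - r)) 0) * \<phi> r * of_bool (0 < r \<and> r < t) \<partial>lborel)
    \<in> borel_measurable borel"
    by measurable
  also have "(\<lambda>t. \<integral>\<^sup>+r. ennreal (heat_kernel (2 * \<beta> * (t - r)) 0) * \<phi> r * of_bool (0 < r \<and> r < t) \<partial>lborel) = volterra \<beta> \<phi>"
    unfolding volterra_def by (intro ext nn_integral_cong) (simp add: indicator_def)
  finally show ?thesis .
qed

lemma volterra_iter_measurable [measurable]:
  assumes "\<phi> \<in> borel_measurable borel"
  shows "(volterra \<beta> ^^ k) \<phi> \<in> borel_measurable borel"
  by (induction k) (use assms in auto)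

lemma volterra_mono:
  assumes "\<And>r. 0 < r \<Longrightarrow> r < t \<Longrightarrow> \<phi> r \<le> \<psi> r"
  shows "volterra \<beta> \<phi> t \<le> volterra \<beta> \<psi> t"
  unfolding volterra_def
  using assms by (intro nn_integral_mono) (auto simp: indicator_def intro!: mult_left_mono)

lemma volterra_cong:
  assumes "\<And>r. 0 < r \<Longrightarrow> r < t \<Longrightarrow> \<phi> r = \<psi> r"
  shows "volterra \<beta> \<phi> t = volterra \<beta> \<psi> t"
  using assms by (intro antisym volterra_mono) auto

lemma volterra_iter_mono:
  assumes "\<And>r. 0 < r \<Longrightarrow> r \<le> t \<Longrightarrow> \<phi> r \<le> \<psi> r" "0 < t"
  shows "(volterra \<beta> ^^ k) \<phi> t \<le> (volterra \<beta> ^^ k) \<psi> t"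
  using assms
proof (induction k arbitrary: t)
  case (Suc k)
  then show ?case by (auto intro!: volterra_mono)
qed auto

lemma volterra_cmult:
  assumes [measurable]: "\<phi> \<in> borel_measurable borel"
  shows "volterra \<beta> (\<lambda>r. c * \<phi> r) t = c * volterra \<beta> \<phi> t"
  unfolding volterra_def by (subst nn_integral_cmult[symmetric]) (simp_all add: ac_simps)

lemma volterra_iter_cmult:
  assumes "\<phi> \<in> borel_measurable borel"
  shows "(volterra \<beta> ^^ k) (\<lambda>r. c * \<phi> r) t = c * (volterra \<beta> ^^ k) \<phi> t"
proof (induction k arbitrary: t)
  case (Suc k)
  have "(volterra \<beta> ^^ Suc k) (\<lambda>r. c * \<phi> r) t = volterra \<beta> (\<lambda>r. c * (volterra \<beta> ^^ k) \<phi> r) t"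
    using Suc by (auto intro!: volterra_cong)
  then show ?case using assms by (simp add: volterra_cmult)
qed simp

lemma volterra_add:
  assumes [measurable]: "\<phi> \<in> borel_measurable borel" "\<psi> \<in> borel_measurable borel"
  shows "volterra \<beta> (\<lambda>r. \<phi> r + \<psi> r) t = volterra \<beta> \<phi> t + volterra \<beta> \<psi> t"
  unfolding volterra_def
  by (subst nn_integral_add[symmetric]) (simp_all add: distrib_left distrib_right)

lemma volterra_iter_add:
  assumes "\<phi> \<in> borel_measurable borel" "\<psi> \<in> borel_measurable borel"
  shows "(volterra \<beta> ^^ k) (\<lambda>r. \<phi> r + \<psi> r) t = (volterra \<beta> ^^ k) \<phi> t + (volterra \<beta> ^^ k) \<psi> t"
proof (induction k arbitrary: t)
  case (Suc k)
  have "(volterra \<beta> ^^ Suc k) (\<lambda>r. \<phi> r + \<psi> r) t =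
      volterra \<beta> (\<lambda>r. (volterra \<beta> ^^ k) \<phi> r + (volterra \<beta> ^^ k) \<psi> r) t"
    using Suc by (auto intro!: volterra_cong)
  then show ?case using assms by (simp add: volterra_add)
qed simp

lemma volterra_sum:
  assumes "\<And>i. \<phi> i \<in> borel_measurable borel"
  shows "volterra \<beta> (\<lambda>r. \<Sum>i<n. \<phi> i r) t = (\<Sum>i<(n::nat). volterra \<beta> (\<phi> i) t)"
proof (induction n)
  case 0
  then show ?case by (simp add: volterra_def)
next
  case (Suc n)
  then show ?case using assms by (simp add: volterra_add)
qed

text \<open>The substitution \<open>r = t * x\<close> gives a Beta integral. The exponent of
  \<open>t\<close> collects 1 from the substitution and \<open>- 1 / 2\<close> and
  \<open>c - 1\<close> from the integrand.\<close>

lemma nn_integral_Beta_scaled: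
  fixes t :: real
  assumes t: "0 < t" and c: "0 < c"
  shows "(\<integral>\<^sup>+r. ennreal ((t - r) powr (- 1 / 2) * r powr (c - 1)) * indicator {0<..<t} r \<partial>lborel)
    = ennreal (t powr (c - 1 / 2) * Beta c (1 / 2))"
proof -
  have "(\<integral>\<^sup>+r. ennreal ((t - r) powr (- 1 / 2) * r powr (c - 1)) * indicator {0<..<t} r \<partial>lborel)
    = ennreal \<bar>t\<bar> * (\<integral>\<^sup>+x. ennreal ((t - (0 + t * x)) powr (- 1 / 2) * (0 + t * x) powr (c - 1)) * indicator {0<..<t} (0 + t * x) \<partial>lborel)"
    by (rule nn_integral_real_affine) (use t in auto)
  also have "(\<integral>\<^sup>+x. ennreal ((t - (0 + t * x)) powr (- 1 / 2) * (0 + t * x) powr (c - 1)) * indicator {0<..<t} (0 + t * x) \<partial>lborel)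
    = (\<integral>\<^sup>+x. ennreal (t powr (c - 3 / 2)) * (ennreal (x powr (c - 1) * (1 - x) powr (1 / 2 - 1)) * indicator {0..1} x) \<partial>lborel)"
  proof (rule nn_integral_cong_AE, use AE_lborel_singleton[of 0] AE_lborel_singleton[of 1] in eventually_elim)
    fix x :: real assume x: "x \<noteq> 0" "x \<noteq> 1"
    show "ennreal ((t - (0 + t * x)) powr (- 1 / 2) * (0 + t * x) powr (c - 1)) * indicator {0<..<t} (0 + t * x) =
      ennreal (t powr (c - 3 / 2)) * (ennreal (x powr (c - 1) * (1 - x) powr (1 / 2 - 1)) * indicator {0..1} x)"
    proof (cases "0 < x \<and> x < 1")
      case True
      have "t - t * x = t * (1 - x)" by (simp add: algebra_simps)
      then have "(t - t * x) powr (- 1 / 2) * (t * x) powr (c - 1) =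
         (t powr (- 1 / 2) * t powr (c - 1)) * (x powr (c - 1) * (1 - x) powr (- 1 / 2))"
        using True t by (simp add: powr_mult)
      also have "t powr (- 1 / 2) * t powr (c - 1) = t powr (c - 3 / 2)"
        by (simp add: powr_add[symmetric])
      finally show ?thesis using True t by (simp add: ennreal_mult[symmetric])
    next
      case False
      then have "\<not> (0 < t * x \<and> t * x < t)" "x \<notin> {0..1}" using t x
        by (auto simp: zero_less_mult_iff)
      then show ?thesis by auto
    qed
  qed
  also have "\<dots> = ennreal (t powr (c - 3 / 2)) * ennreal (Beta c (1 / 2))"
  proof -
    have "(\<integral>\<^sup>+x. ennreal (x powr (c - 1) * (1 - x) powr (1 / 2 - 1)) * indicator {0..1} x \<partial>lborel) = ennreal (Beta c (1 / 2))"
      by (rule nn_integral_has_integral_lebesgue'[OF _ has_integral_Beta_real[OF c]]) auto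
    then show ?thesis by (subst nn_integral_cmult) auto
  qed
  also have "ennreal \<bar>t\<bar> * (ennreal (t powr (c - 3 / 2)) * ennreal (Beta c (1 / 2))) =
    ennreal (t powr (c - 1 / 2) * Beta c (1 / 2))"
  proof -
    have "t * t powr (c - 3 / 2) = t powr (c - 1 / 2)"
      using t powr_mult_base[of t "c - 3 / 2"] by (simp add: add.commute)
    moreover have "0 \<le> Beta c (1 / 2)"
      using c by (simp add: Beta_def Gamma_real_nonneg)
    ultimately show ?thesis using t by (simp add: ennreal_mult[symmetric] mult.assoc[symmetric])
  qed
  finally show ?thesis .
qed

lemma heat_kernel_0: "0 < \<beta> \<Longrightarrow> 0 < s \<Longrightarrow> heat_kernel (2 * \<beta> * s) 0 = s powr (- 1 / 2) / sqrt (4 * pi * \<beta>)"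
  unfolding heat_kernel_def by (simp add: powr_minus powr_half_sqrt real_sqrt_mult divide_simps)

text \<open>Up to the factor \<open>1 / sqrt (4 * \<beta>)\<close> the operator is the
  Riemann-Liouville integral of order one half. In \<open>Beta c (1 / 2)\<close> the factor
  \<open>Gamma c\<close> cancels the normalisation, and \<open>Gamma (1 / 2) = sqrt pi\<close>
  cancels the \<open>pi\<close> of the heat kernel.\<close>

lemma volterra_powr:
  assumes \<beta>: "0 < \<beta>" and t: "0 < t" and c: "0 < c"
  shows "volterra \<beta> (\<lambda>r. ennreal (r powr (c - 1) / Gamma c)) t =
    ennreal (t powr (c - 1 / 2) / (sqrt (4 * \<beta>) * Gamma (c + 1 / 2)))"
proof -
  have G: "0 < Gamma c" using c by (rule Gamma_real_pos)
  have "volterra \<beta> (\<lambda>r. ennreal (r powr (c - 1) / Gamma c)) t =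
     (\<integral>\<^sup>+r. ennreal (1 / (sqrt (4 * pi * \<beta>) * Gamma c)) * (ennreal ((t - r) powr (- 1 / 2) * r powr (c - 1)) * indicator {0<..<t} r) \<partial>lborel)"
    unfolding volterra_def
  proof (intro nn_integral_cong)
    fix r
    show "ennreal (heat_kernel (2 * \<beta> * (t - r)) 0) * ennreal (r powr (c - 1) / Gamma c) * indicator {0<..<t} r =
      ennreal (1 / (sqrt (4 * pi * \<beta>) * Gamma c)) * (ennreal ((t - r) powr (- 1 / 2) * r powr (c - 1)) * indicator {0<..<t} r)"
    proof (cases "0 < r \<and> r < t")
      case True
      then have "heat_kernel (2 * \<beta> * (t - r)) 0 = (t - r) powr (- 1 / 2) / sqrt (4 * pi * \<beta>)"
        using heat_kernel_0[OF \<beta>, of "t - r"] by simp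
      then have "heat_kernel (2 * \<beta> * (t - r)) 0 * (r powr (c - 1) / Gamma c) =
        1 / (sqrt (4 * pi * \<beta>) * Gamma c) * ((t - r) powr (- 1 / 2) * r powr (c - 1))"
        by simp
      then show ?thesis using G \<beta> True
        by (simp add: ennreal_mult[symmetric] del: real_sqrt_mult times_divide_eq_left)
    qed auto
  qed
  also have "\<dots> = ennreal (1 / (sqrt (4 * pi * \<beta>) * Gamma c)) * ennreal (t powr (c - 1 / 2) * Beta c (1 / 2))"
    by (subst nn_integral_cmult) (measurable, simp only: nn_integral_Beta_scaled[OF t c])
  also have "\<dots> = ennreal (1 / (sqrt (4 * pi * \<beta>) * Gamma c) * (t powr (c - 1 / 2) * Beta c (1 / 2)))"
    by (rule ennreal_mult'[symmetric]) (use G \<beta> in simp)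
  also have "1 / (sqrt (4 * pi * \<beta>) * Gamma c) * (t powr (c - 1 / 2) * Beta c (1 / 2)) =
     t powr (c - 1 / 2) / (sqrt (4 * \<beta>) * Gamma (c + 1 / 2))"
    using G \<beta> by (simp add: Beta_def Gamma_one_half_real real_sqrt_mult field_simps)
  finally show ?thesis .
qed

lemma volterra_iter_one:
  assumes \<beta>: "0 < \<beta>" and t: "0 < t"
  shows "(volterra \<beta> ^^ k) (\<lambda>_. 1) t = ennreal (sqrt (t / (4 * \<beta>)) ^ k / Gamma (real k / 2 + 1))"
  using t
proof (induction k arbitrary: t)
  case (Suc k)
  have p: "sqrt (r / (4 * \<beta>)) ^ k = (1 / sqrt (4 * \<beta>)) ^ k * r powr (real k / 2 + 1 - 1)" if "0 < r" for r and k :: nat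
  proof -
    have "sqrt r ^ k = r powr (real k / 2)"
      using that by (simp add: powr_half_sqrt[symmetric] powr_powr powr_realpow[symmetric])
    then show ?thesis by (simp add: real_sqrt_divide power_divide)
  qed
  have c: "0 < real k / 2 + 1" by (simp add: add_nonneg_pos)
  have "(volterra \<beta> ^^ Suc k) (\<lambda>_. 1) t =
     volterra \<beta> (\<lambda>r. ennreal ((1 / sqrt (4 * \<beta>)) ^ k) * ennreal (r powr (real k / 2 + 1 - 1) / Gamma (real k / 2 + 1))) t"
    using \<beta> Gamma_real_pos[OF c] by (auto intro!: volterra_cong simp: Suc.IH p ennreal_mult[symmetric])
  also have "\<dots> = ennreal ((1 / sqrt (4 * \<beta>)) ^ k) * ennreal (t powr (real k / 2 + 1 - 1 / 2) / (sqrt (4 * \<beta>) * Gamma (real k / 2 + 1 + 1 / 2)))"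
    by (subst volterra_cmult) (simp_all only: volterra_powr[OF \<beta> Suc.prems c], measurable)
  also have "\<dots> = ennreal ((1 / sqrt (4 * \<beta>)) ^ k * (t powr (real k / 2 + 1 - 1 / 2) / (sqrt (4 * \<beta>) * Gamma (real k / 2 + 1 + 1 / 2))))"
    by (rule ennreal_mult'[symmetric]) (use \<beta> in simp)
  also have "(1 / sqrt (4 * \<beta>)) ^ k * (t powr (real k / 2 + 1 - 1 / 2) / (sqrt (4 * \<beta>) * Gamma (real k / 2 + 1 + 1 / 2))) =
     sqrt (t / (4 * \<beta>)) ^ Suc k / Gamma (real (Suc k) / 2 + 1)"
  proof -
    have "real k / 2 + 1 - 1 / 2 = real (Suc k) / 2 + 1 - 1" "real k / 2 + 1 + 1 / 2 = real (Suc k) / 2 + 1" by (simp_all add: field_simps)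
    then show ?thesis unfolding p[OF Suc.prems] by (simp only: power_Suc) simp
  qed
  finally show ?case .
qed simp

section \<open>The terms of the limiting series\<close>

lemma chain_coord_measurable:
  fixes t :: real and i n :: nat
  assumes "i \<le> n"
  shows "(\<lambda>r. (r(0 := t)) i) \<in> borel_measurable (\<Pi>\<^sub>M i\<in>{1..n}. (lborel :: real measure))"
proof (cases "i = 0")
  case False
  then have "(\<lambda>r. r i) \<in> measurable (\<Pi>\<^sub>M i\<in>{1..n}. (lborel :: real measure)) lborel"
    using assms by (intro measurable_component_singleton) auto
  then show ?thesis using False by simp
qed simp

text \<open>At a negative time \<open>heat_kernel\<close> takes negative values, since
  \<open>sqrt\<close> is an odd function; the order constraint removes these points.\<close>

lemma chain_nonneg:
  fixes x :: "nat \<Rightarrow> real"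
  assumes "0 < \<beta>"
  shows "0 \<le> of_bool (A \<and> (\<forall>i\<in>I. x i < x (i - 1))) * (\<Prod>i\<in>I. heat_kernel (2 * \<beta> * (x (i - 1) - x i)) 0)"
proof (cases "\<forall>i\<in>I. x i < x (i - 1)")
  case True
  then have "0 \<le> heat_kernel (2 * \<beta> * (x (i - 1) - x i)) 0" if "i \<in> I" for i
    using that assms by (intro heat_kernel_nonneg) (simp add: less_imp_le)
  then show ?thesis by (intro mult_nonneg_nonneg prod_nonneg) auto
next
  case False
  then have "\<not> (A \<and> (\<forall>i\<in>I. x i < x (i - 1)))" by blast
  then show ?thesis by (simp only: of_bool_eq mult_zero_left order_refl)
qed

text \<open>Integrating out the last time variable replaces \<open>\<phi>\<close> by
  \<open>volterra \<beta> \<phi>\<close> at the variable before it. The induction therefore runs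
  over all \<open>\<phi>\<close> and peels off the innermost factor of the iterate. For
  \<open>k = 0\<close> the product space is a point and the chain consists of \<open>t\<close>
  alone.\<close>

lemma chain_integral:
  fixes \<phi> :: "real \<Rightarrow> ennreal"
  assumes [measurable]: "\<phi> \<in> borel_measurable borel" and \<beta>: "0 < \<beta>" and t: "0 < t"
  shows "(\<integral>\<^sup>+r. ennreal (of_bool (0 < (r(0 := t)) k \<and> (\<forall>i\<in>{1..k}. (r(0 := t)) i < (r(0 := t)) (i - 1))) *
        (\<Prod>i\<in>{1..k}. heat_kernel (2 * \<beta> * ((r(0 := t)) (i - 1) - (r(0 := t)) i)) 0)) * \<phi> ((r(0 := t)) k)
      \<partial>(\<Pi>\<^sub>M i\<in>{1..k}. (lborel :: real measure))) = (volterra \<beta> ^^ k) \<phi> t"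
  using assms(1)
proof (induction k arbitrary: \<phi>)
  case 0
  interpret product_sigma_finite "\<lambda>_::nat. lborel :: real measure" ..
  show ?case using t by (simp add: PiM_empty nn_integral_count_space_finite)
next
  case (Suc k)
  note [measurable] = Suc.prems
  interpret product_sigma_finite "\<lambda>_::nat. lborel :: real measure" ..
  define c where "c k r = of_bool (0 < (r(0 := t)) k \<and> (\<forall>i\<in>{1..k}. (r(0 := t)) i < (r(0 := t)) (i - 1))) *
        (\<Prod>i\<in>{1..k}. heat_kernel (2 * \<beta> * ((r(0 := t)) (i - 1) - (r(0 := t)) i)) 0)"
    for k :: nat and r
  have meas: "(\<lambda>r. (r(0 := t)) i) \<in> borel_measurable (\<Pi>\<^sub>M i\<in>{1..n}. (lborel :: real measure))" if "i \<le> n" for i n :: nat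
    using that by (rule chain_coord_measurable)
  have [measurable]: "c n \<in> borel_measurable (\<Pi>\<^sub>M i\<in>{1..n}. (lborel :: real measure))" for n :: nat
  proof -
    have [measurable]: "(\<lambda>r. (r(0 := t)) n) \<in> borel_measurable (\<Pi>\<^sub>M i\<in>{1..n}. (lborel :: real measure))"
      by (rule meas) simp
    have [measurable]: "(\<lambda>r. (r(0 := t)) i) \<in> borel_measurable (\<Pi>\<^sub>M i\<in>{1..n}. (lborel :: real measure))"
      "(\<lambda>r. (r(0 := t)) (i - 1)) \<in> borel_measurable (\<Pi>\<^sub>M i\<in>{1..n}. (lborel :: real measure))" if "i \<in> {1..n}" for i
      using that by (auto intro!: meas simp del: fun_upd_apply One_nat_def)
    show ?thesis unfolding c_def by measurable
  qed
  have [measurable]: "(\<lambda>r. (r(0 := t)) n) \<in> borel_measurable (\<Pi>\<^sub>M i\<in>{1..n}. (lborel :: real measure))" for n :: nat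
      by (rule meas) simp
  have ins: "{1..Suc k} = insert (Suc k) {1..k}" by auto
  have F: "(\<lambda>r. ennreal (c (Suc k) r) * \<phi> ((r(0 := t)) (Suc k)))
    \<in> borel_measurable (\<Pi>\<^sub>M i\<in>{1..Suc k}. (lborel :: real measure))"
    by measurable
  have "(\<integral>\<^sup>+r. ennreal (c (Suc k) r) * \<phi> ((r(0 := t)) (Suc k)) \<partial>(\<Pi>\<^sub>M i\<in>{1..Suc k}. (lborel :: real measure)))
    = (\<integral>\<^sup>+r. \<integral>\<^sup>+y. ennreal (c (Suc k) (r(Suc k := y))) * \<phi> (((r(Suc k := y))(0 := t)) (Suc k)) \<partial>lborel
        \<partial>(\<Pi>\<^sub>M i\<in>{1..k}. (lborel :: real measure)))"
    unfolding ins
    by (rule product_nn_integral_insert) (simp, simp, rule F[unfolded ins])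
  also have "\<dots> = (\<integral>\<^sup>+r. ennreal (c k r) * volterra \<beta> \<phi> ((r(0 := t)) k) \<partial>(\<Pi>\<^sub>M i\<in>{1..k}. (lborel :: real measure)))"
  proof (intro nn_integral_cong)
    fix r :: "nat \<Rightarrow> real"
    let ?x = "(r(0 := t)) k"
    have upd: "((r(Suc k := y))(0 := t)) i = (r(0 := t)) i" if "i \<le> k" for y i using that by simp
    have *: "c (Suc k) (r(Suc k := y)) =
        c k r * (heat_kernel (2 * \<beta> * (?x - y)) 0 * of_bool (0 < y \<and> y < ?x))" for y
    proof -
      have "(\<forall>i\<in>{1..Suc k}. ((r(Suc k := y))(0 := t)) i < ((r(Suc k := y))(0 := t)) (i - 1)) \<longleftrightarrow>
        y < ?x \<and> (\<forall>i\<in>{1..k}. (r(0 := t)) i < (r(0 := t)) (i - 1))"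
      proof -
        have split: "(\<forall>i\<in>{1..Suc k}. P i) \<longleftrightarrow> P (Suc k) \<and> (\<forall>i\<in>{1..k}. P i)" for P
          unfolding ins by blast
        have "((r(Suc k := y))(0 := t)) (Suc k) = y" "((r(Suc k := y))(0 := t)) (Suc k - 1) = ?x"
          by simp_all
        moreover have "(\<forall>i\<in>{1..k}. ((r(Suc k := y))(0 := t)) i < ((r(Suc k := y))(0 := t)) (i - 1)) \<longleftrightarrow>
           (\<forall>i\<in>{1..k}. (r(0 := t)) i < (r(0 := t)) (i - 1))"
        proof (rule ball_cong[OF refl])
          fix i assume "i \<in> {1..k}"
          then have "i \<le> k" "i - 1 \<le> k" by auto
          then show "((r(Suc k := y))(0 := t)) i < ((r(Suc k := y))(0 := t)) (i - 1) \<longleftrightarrow> (r(0 := t)) i < (r(0 := t)) (i - 1)"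
            by (simp only: upd)
        qed
        ultimately show ?thesis unfolding split by (simp only:)
      qed
      moreover have "(\<Prod>i\<in>{1..Suc k}. heat_kernel (2 * \<beta> * (((r(Suc k := y))(0 := t)) (i - 1) - ((r(Suc k := y))(0 := t)) i)) 0)
        = heat_kernel (2 * \<beta> * (?x - y)) 0 * (\<Prod>i\<in>{1..k}. heat_kernel (2 * \<beta> * ((r(0 := t)) (i - 1) - (r(0 := t)) i)) 0)"
        unfolding ins by (subst prod.insert) (auto intro!: prod.cong arg_cong2[where f="(*)"] simp: upd)
      ultimately show ?thesis unfolding c_def by (auto simp: of_bool_def)
    qed
    have c0: "0 \<le> c k r"
      unfolding c_def by (rule chain_nonneg[OF \<beta>])
    have "(\<integral>\<^sup>+y. ennreal (c (Suc k) (r(Suc k := y))) * \<phi> (((r(Suc k := y))(0 := t)) (Suc k)) \<partial>lborel)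
      = (\<integral>\<^sup>+y. ennreal (c k r) * (ennreal (heat_kernel (2 * \<beta> * (?x - y)) 0) * \<phi> y * indicator {0<..<?x} y) \<partial>lborel)"
      using c0 \<beta> by (intro nn_integral_cong) (auto simp: * indicator_def ennreal_mult mult_ac of_bool_def)
    also have "\<dots> = ennreal (c k r) * volterra \<beta> \<phi> ?x"
      unfolding volterra_def by (rule nn_integral_cmult) measurable
    finally show "(\<integral>\<^sup>+y. ennreal (c (Suc k) (r(Suc k := y))) * \<phi> (((r(Suc k := y))(0 := t)) (Suc k)) \<partial>lborel)
      = ennreal (c k r) * volterra \<beta> \<phi> ?x" .
  qed
  also have "\<dots> = (volterra \<beta> ^^ k) (volterra \<beta> \<phi>) t"
    unfolding c_def by (rule Suc.IH) measurable
  finally show ?case unfolding c_def by (simp only: funpow_Suc_right o_apply)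
qed

lemma volterra_iter_bound:
  assumes "0 < \<beta>" "0 < t" "\<And>r. 0 < r \<Longrightarrow> r \<le> t \<Longrightarrow> \<phi> r \<le> ennreal C"
  shows "(volterra \<beta> ^^ k) \<phi> t \<le> ennreal C * ennreal (sqrt (t / (4 * \<beta>)) ^ k / Gamma (real k / 2 + 1))"
proof -
  have "(volterra \<beta> ^^ k) \<phi> t \<le> (volterra \<beta> ^^ k) (\<lambda>r. ennreal C * 1) t"
    using assms by (intro volterra_iter_mono) auto
  then show ?thesis
    using assms by (simp only: volterra_iter_cmult[OF borel_measurable_const] volterra_iter_one)
qed

text \<open>This is \<open>exp (2 * \<alpha> * t)\<close> times the square of
  \<open>\<sigma>\<close> at \<open>exp (- \<alpha> * t)\<close>, the solution without noise and
  without boundary.\<close>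

definition initial_energy :: "real \<Rightarrow> real \<Rightarrow> real \<Rightarrow> real \<Rightarrow> real" where
  "initial_energy \<alpha> \<sigma>\<^sub>1 \<sigma>\<^sub>0 t = (\<sigma>\<^sub>1 + exp (\<alpha> * t) * \<sigma>\<^sub>0)\<^sup>2"

lemma initial_energy_nonneg [simp]: "0 \<le> initial_energy \<alpha> \<sigma>\<^sub>1 \<sigma>\<^sub>0 t"
  by (simp add: initial_energy_def)

lemma initial_energy_measurable [measurable]: "initial_energy \<alpha> \<sigma>\<^sub>1 \<sigma>\<^sub>0 \<in> borel_measurable borel"
  unfolding initial_energy_def by measurable

lemma initial_energy_le:
  assumes "0 \<le> r" "r \<le> t"
  shows "initial_energy \<alpha> \<sigma>\<^sub>1 \<sigma>\<^sub>0 r \<le> (\<bar>\<sigma>\<^sub>1\<bar> + exp (\<bar>\<alpha>\<bar> * t) * \<bar>\<sigma>\<^sub>0\<bar>)\<^sup>2"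
proof -
  have "\<alpha> * r \<le> \<bar>\<alpha>\<bar> * t" using assms by (intro mult_mono) auto
  then have "exp (\<alpha> * r) * \<bar>\<sigma>\<^sub>0\<bar> \<le> exp (\<bar>\<alpha>\<bar> * t) * \<bar>\<sigma>\<^sub>0\<bar>" by (intro mult_right_mono) auto
  then have "\<bar>\<sigma>\<^sub>1 + exp (\<alpha> * r) * \<sigma>\<^sub>0\<bar> \<le> \<bar>\<sigma>\<^sub>1\<bar> + exp (\<bar>\<alpha>\<bar> * t) * \<bar>\<sigma>\<^sub>0\<bar>"
    using abs_triangle_ineq[of \<sigma>\<^sub>1 "exp (\<alpha> * r) * \<sigma>\<^sub>0"] by (simp add: abs_mult)
  then show ?thesis unfolding initial_energy_def by (metis abs_ge_zero power2_abs power_mono)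
qed

text \<open>Stated at \<open>Suc k\<close>, where the exponent \<open>2 * (k - 1)\<close> of the
  definition involves no truncated subtraction. The Bochner integral and \<open>enn2real\<close>
  share the default 0 for a divergent integral, so finiteness can be settled later.\<close>

lemma f_term_volterra:
  assumes \<beta>: "0 < \<beta>" and t: "0 < t"
  shows "f_term \<alpha> \<beta> \<sigma>\<^sub>1 \<sigma>\<^sub>0 (Suc k) t = \<sigma>\<^sub>1 ^ (2 * k) * exp (- 2 * \<alpha> * t) *
    enn2real ((volterra \<beta> ^^ Suc k) (\<lambda>r. ennreal (initial_energy \<alpha> \<sigma>\<^sub>1 \<sigma>\<^sub>0 r)) t)"
proof -
  let ?r = "\<lambda>r. r(0 := t)" and ?k = "Suc k"
  let ?f = "\<lambda>r. of_bool (0 < ?r r ?k \<and> (\<forall>i\<in>{1..?k}. ?r r i < ?r r (i - 1))) *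
            (\<Prod>i\<in>{1..?k}. heat_kernel (2 * \<beta> * (?r r (i - 1) - ?r r i)) 0)"
  have meas: "(\<lambda>r. (?r r) i) \<in> borel_measurable (\<Pi>\<^sub>M i\<in>{1..n}. (lborel :: real measure))" if "i \<le> n" for i n :: nat
    using that by (rule chain_coord_measurable)
  have [measurable]: "?f \<in> borel_measurable (\<Pi>\<^sub>M i\<in>{1..?k}. (lborel :: real measure))"
  proof -
    have [measurable]: "(\<lambda>r. ?r r ?k) \<in> borel_measurable (\<Pi>\<^sub>M i\<in>{1..?k}. (lborel :: real measure))"
      by (rule meas) simp
    have [measurable]: "(\<lambda>r. ?r r i) \<in> borel_measurable (\<Pi>\<^sub>M i\<in>{1..?k}. (lborel :: real measure))"
      "(\<lambda>r. ?r r (i - 1)) \<in> borel_measurable (\<Pi>\<^sub>M i\<in>{1..?k}. (lborel :: real measure))" if "i \<in> {1..?k}" for i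
      using that by (auto intro!: meas simp del: fun_upd_apply One_nat_def)
    show ?thesis by measurable
  qed
  have [measurable]: "(\<lambda>r. initial_energy \<alpha> \<sigma>\<^sub>1 \<sigma>\<^sub>0 (?r r ?k)) \<in> borel_measurable (\<Pi>\<^sub>M i\<in>{1..?k}. (lborel :: real measure))"
    using measurable_compose[OF meas initial_energy_measurable] by blast
  have nn: "0 \<le> ?f r" for r by (rule chain_nonneg[OF \<beta>])
  have "(LINT r | (\<Pi>\<^sub>M i\<in>{1..?k}. (lborel :: real measure)). ?f r * initial_energy \<alpha> \<sigma>\<^sub>1 \<sigma>\<^sub>0 (?r r ?k)) =
    enn2real (\<integral>\<^sup>+r. ennreal (?f r * initial_energy \<alpha> \<sigma>\<^sub>1 \<sigma>\<^sub>0 (?r r ?k)) \<partial>(\<Pi>\<^sub>M i\<in>{1..?k}. (lborel :: real measure)))"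
  proof (rule integral_eq_nn_integral)
    show "(\<lambda>r. ?f r * initial_energy \<alpha> \<sigma>\<^sub>1 \<sigma>\<^sub>0 (?r r ?k)) \<in> borel_measurable (\<Pi>\<^sub>M i\<in>{1..?k}. (lborel :: real measure))"
      by measurable
  qed (intro AE_I2 mult_nonneg_nonneg nn initial_energy_nonneg)
  also have "(\<integral>\<^sup>+r. ennreal (?f r * initial_energy \<alpha> \<sigma>\<^sub>1 \<sigma>\<^sub>0 (?r r ?k)) \<partial>(\<Pi>\<^sub>M i\<in>{1..?k}. (lborel :: real measure))) =
    (\<integral>\<^sup>+r. ennreal (?f r) * ennreal (initial_energy \<alpha> \<sigma>\<^sub>1 \<sigma>\<^sub>0 (?r r ?k)) \<partial>(\<Pi>\<^sub>M i\<in>{1..?k}. (lborel :: real measure)))"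
    using nn by (intro nn_integral_cong ennreal_mult initial_energy_nonneg)
  also have "\<dots> = (volterra \<beta> ^^ ?k) (\<lambda>r. ennreal (initial_energy \<alpha> \<sigma>\<^sub>1 \<sigma>\<^sub>0 r)) t"
    by (rule chain_integral[OF _ \<beta> t]) measurable
  finally show ?thesis unfolding f_term_def Let_def initial_energy_def by simp
qed

section \<open>Comparison with the error function\<close>

text \<open>Splitting off the constant tail below \<open>-1\<close> leaves an integral over a
  compact interval, to which the fundamental theorem of calculus applies. Any negative cut point
  keeps every \<open>x \<ge> 0\<close> in the interior.\<close>

lemma has_real_derivative_gaussian_cdf:
  assumes "0 \<le> x"
  shows "((\<lambda>x. LINT y:{..x}|lborel. std_normal_density y) has_real_derivative std_normal_density x) (at x)"
proof -
  have si: "set_integrable lborel A std_normal_density" if "A \<in> sets borel" for A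
    unfolding set_integrable_def using that by (intro integrable_mult_indicator) (auto simp: integrable_normal_density)
  have eq: "(LINT y:{..u}|lborel. std_normal_density y) =
      (LINT y:{..-1}|lborel. std_normal_density y) + integral {-1..u} std_normal_density" if "-1 < u" for u :: real
  proof -
    have "{..u} = {..-1} \<union> {-1<..u}" using that by auto
    then have "(LINT y:{..u}|lborel. std_normal_density y) =
      (LINT y:{..-1}|lborel. std_normal_density y) + (LINT y:{-1<..u}|lborel. std_normal_density y)"
      by (simp only:) (rule set_integral_Un, use si in auto)
    also have "(LINT y:{-1<..u}|lborel. std_normal_density y) = (LINT y:{-1..u}|lborel. std_normal_density y)"
      by (rule set_integral_cong_set)
        (use AE_lborel_singleton[of "-1"] in \<open>auto simp: set_borel_measurable_def elim!: eventually_mono\<close>)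
    also have "\<dots> = integral {-1..u} std_normal_density"
      by (rule set_borel_integral_eq_integral(2)[OF si]) simp
    finally show ?thesis .
  qed
  have "((\<lambda>u. integral {-1..u} std_normal_density) has_real_derivative std_normal_density x) (at x within {-1..x+1})"
    by (rule integral_has_real_derivative)
      (use assms in \<open>auto simp: normal_density_def intro!: continuous_intros\<close>)
  moreover have "at x within {-1..x+1} = at x"
    using assms by (intro at_within_interior) auto
  ultimately have "((\<lambda>u. (LINT y:{..-1}|lborel. std_normal_density y) + integral {-1..u} std_normal_density)
      has_real_derivative std_normal_density x) (at x)"
    by (auto intro!: derivative_eq_intros)
  then show ?thesis
  proof (rule DERIV_cong_ev[THEN iffD1, rotated -1])
    have "\<forall>\<^sub>F u in nhds x. u \<in> {-1<..}"
      using assms by (intro eventually_nhds_in_open) auto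
    then show "\<forall>\<^sub>F u in nhds x. (LINT y:{..-1}|lborel. std_normal_density y) + integral {-1..u} std_normal_density =
       (LINT y:{..u}|lborel. std_normal_density y)"
      by eventually_elim (simp add: eq)
  qed auto
qed

lemma gaussian_cdf_0: "(LINT y:{..0}|lborel. std_normal_density y) = 1 / 2"
proof -
  have si: "set_integrable lborel A std_normal_density" if "A \<in> sets borel" for A
    unfolding set_integrable_def using that by (intro integrable_mult_indicator) (auto simp: integrable_normal_density)
  have "(LINT y:{..0}|lborel. std_normal_density y) = (LINT y:{0..}|lborel. std_normal_density y)"
  proof -
    have "(LINT y|lborel. indicator {..0} y *\<^sub>R std_normal_density y) =
      \<bar>-1\<bar> *\<^sub>R (LINT y|lborel. indicator {..0} (0 + (-1) * y) *\<^sub>R std_normal_density (0 + (-1) * y))"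
      by (rule lborel_integral_real_affine) simp
    also have "\<dots> = (LINT y|lborel. indicator {0..} y *\<^sub>R std_normal_density y)"
      by (auto intro!: Bochner_Integration.integral_cong simp: indicator_def normal_density_def)
    finally show ?thesis by (simp add: set_lebesgue_integral_def)
  qed
  moreover have "(LINT y:{0..}|lborel. std_normal_density y) = (LINT y:{0<..}|lborel. std_normal_density y)"
    by (rule set_integral_cong_set)
      (use AE_lborel_singleton[of "0"] in \<open>auto simp: set_borel_measurable_def elim!: eventually_mono\<close>)
  moreover have "(LINT y:{..0} \<union> {0<..}|lborel. std_normal_density y) =
      (LINT y:{..0}|lborel. std_normal_density y) + (LINT y:{0<..}|lborel. std_normal_density y)"
    using si by (intro set_integral_Un) auto
  moreover have "{..0} \<union> {0<..} = (UNIV :: real set)" by auto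
  ultimately show ?thesis by (simp add: set_lebesgue_integral_def)
qed

lemma gaussian_cdf_le_1: "(LINT y:{..x}|lborel. std_normal_density y) \<le> 1"
proof -
  have "(LINT y|lborel. indicator {..x} y *\<^sub>R std_normal_density y) \<le> (LINT y|lborel. std_normal_density y)"
    by (intro integral_mono integrable_mult_indicator) (auto simp: indicator_def)
  then show ?thesis by (simp add: set_lebesgue_integral_def)
qed

lemma f_bound_cdf:
  "f_bound t = 2 * exp (t / 4) * (LINT y:{..sqrt (t / 2)}|lborel. std_normal_density y)"
  unfolding f_bound_def std_normal_density_def by (simp add: normal_density_def)

text \<open>By \<open>Gamma (k / 2 + 1) = k / 2 * Gamma (k / 2)\<close>, the derivative of term
  \<open>k\<close> is \<open>2 * z\<close> times term \<open>k - 2\<close>. Term 1 contributes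
  \<open>1 / Gamma (3 / 2) = 2 / sqrt pi\<close> and term 0 nothing, hence the two extra terms on
  the left.\<close>

lemma deriv_mittag_leffler_sum:
  fixes z :: real
  shows "(\<Sum>k<n+2. real k * z ^ (k - 1) / Gamma (real k / 2 + 1)) =
    2 / sqrt pi + 2 * z * (\<Sum>k<n. z ^ k / Gamma (real k / 2 + 1))"
proof (induction n)
  case 0
  have "Gamma (1 / 2 + 1 :: real) = sqrt pi / 2"
    by (subst Gamma_plus1) (auto simp: Gamma_one_half_real)
  then have "Gamma (3 / 2 :: real) = sqrt pi / 2" by simp
  then have "1 / Gamma (3 / 2 :: real) = 2 / sqrt pi" by (simp only:) simp
  then show ?case by (simp add: numeral_2_eq_2)
next
  case (Suc n)
  have pos: "0 < real n / 2 + 1" by (simp add: add_nonneg_pos)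
  have "Gamma (real (n + 2) / 2 + 1) = Gamma ((real n / 2 + 1) + 1)" by (simp add: field_simps)
  also have "\<dots> = (real n / 2 + 1) * Gamma (real n / 2 + 1)"
    using pos nonpos_Ints_nonpos[of "real n / 2 + 1"] by (intro Gamma_plus1) auto
  finally have G: "Gamma (real (n + 2) / 2 + 1) = (real n / 2 + 1) * Gamma (real n / 2 + 1)" .
  have "real (n + 2) = 2 * (real n / 2 + 1)" by simp
  then have "real (n + 2) * z ^ (n + 2 - 1) / Gamma (real (n + 2) / 2 + 1) =
    ((real n / 2 + 1) * (2 * z * z ^ n)) / ((real n / 2 + 1) * Gamma (real n / 2 + 1))"
    unfolding G by (simp only: mult.assoc mult.left_commute) simp
  also have "\<dots> = 2 * z * (z ^ n / Gamma (real n / 2 + 1))"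
    using pos by (subst mult_divide_mult_cancel_left) auto
  finally have "real (n + 2) * z ^ (n + 2 - 1) / Gamma (real (n + 2) / 2 + 1) = 2 * z * (z ^ n / Gamma (real n / 2 + 1))" .
  then show ?case using Suc by (simp add: distrib_left)
qed

text \<open>The full series is the Mittag-Leffler function of order one half, which equals
  \<open>f_bound (4 * z\<^sup>2)\<close>. For partial sums the derivative identity has two terms
  fewer on the right, and as all terms are nonnegative it becomes a differential inequality. No
  series is differentiated, and summability comes out as a by-product.\<close>

lemma mittag_leffler_sum_le_f_bound:
  fixes z :: real
  assumes z: "0 \<le> z"
  shows "(\<Sum>k<n. z ^ k / Gamma (real k / 2 + 1)) \<le> f_bound (4 * z\<^sup>2)"
proof -
  let ?S = "\<lambda>n z. \<Sum>k<n. z ^ k / Gamma (real k / 2 + 1)"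
  let ?cdf = "\<lambda>x. LINT y:{..x}|lborel. std_normal_density y"
  have G: "0 < Gamma (real k / 2 + 1)" for k by (intro Gamma_real_pos) (simp add: add_nonneg_pos)
  have mono: "?S n x \<le> ?S (n + 2) x" if "0 \<le> x" for n x
    by (rule sum_mono2) (use that G in \<open>auto intro!: divide_nonneg_pos\<close>)
  \<comment> \<open>With the integrating factor \<open>exp (- x\<^sup>2)\<close> the inequality says
    that this difference is nondecreasing: the derivative of \<open>2 * ?cdf (sqrt 2 * x)\<close> is
    \<open>exp (- x\<^sup>2) * (2 / sqrt pi)\<close>, the inhomogeneous part. At 0 the difference is
    \<open>2 * (1 / 2) - 1 = 0\<close>.\<close>
  have "2 * ?cdf (sqrt 2 * 0) - exp (- 0\<^sup>2) * ?S (n + 2) 0 \<le> 2 * ?cdf (sqrt 2 * z) - exp (- z\<^sup>2) * ?S (n + 2) z"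
  proof (rule DERIV_nonneg_imp_nondecreasing[OF z])
    fix x :: real assume x: "0 \<le> x" "x \<le> z"
    have 1: "((\<lambda>x. ?cdf (sqrt 2 * x)) has_real_derivative std_normal_density (sqrt 2 * x) * sqrt 2) (at x)"
      by (rule DERIV_chain2[OF has_real_derivative_gaussian_cdf])
        (use x in \<open>auto intro!: derivative_eq_intros\<close>)
    have 2: "(?S (n + 2) has_real_derivative (2 / sqrt pi + 2 * x * ?S n x)) (at x)"
      unfolding deriv_mittag_leffler_sum[symmetric]
      unfolding One_nat_def by (intro DERIV_sum DERIV_cdivide DERIV_pow)
    have 3: "((\<lambda>x. exp (- x\<^sup>2)) has_real_derivative exp (- x\<^sup>2) * (- (2 * x))) (at x)"
      by (auto intro!: derivative_eq_intros)
    note DERIV_diff[OF DERIV_cmult[OF 1, of 2] DERIV_mult[OF 3 2]]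
    moreover have "2 * (std_normal_density (sqrt 2 * x) * sqrt 2) = exp (- x\<^sup>2) * (2 / sqrt pi)"
      by (simp add: normal_density_def power_mult_distrib real_sqrt_mult)
    moreover have "exp (- x\<^sup>2) * (2 * x * ?S n x) \<le> exp (- x\<^sup>2) * (2 * x * ?S (n + 2) x)"
      using x mono by (intro mult_left_mono) auto
    ultimately show "\<exists>y. ((\<lambda>x. 2 * ?cdf (sqrt 2 * x) - exp (- x\<^sup>2) * ?S (n + 2) x) has_real_derivative y) (at x) \<and> 0 \<le> y"
      by (intro exI conjI) (assumption, simp add: algebra_simps)
  qed
  moreover have "?S (n + 2) 0 = 1"
    by (induction n) (auto simp: numeral_2_eq_2)
  ultimately have "exp (- z\<^sup>2) * ?S (n + 2) z \<le> 2 * ?cdf (sqrt 2 * z)"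
    using gaussian_cdf_0 by simp
  then have "exp (z\<^sup>2) * (exp (- z\<^sup>2) * ?S (n + 2) z) \<le> exp (z\<^sup>2) * (2 * ?cdf (sqrt 2 * z))"
    by (intro mult_left_mono) auto
  then have "?S (n + 2) z \<le> 2 * exp (z\<^sup>2) * ?cdf (sqrt 2 * z)"
  proof -
    have "exp (z\<^sup>2) * (exp (- z\<^sup>2) * s) = s" for s by (simp add: exp_minus)
    then show ?thesis using \<open>exp (z\<^sup>2) * _ \<le> _\<close> by (simp only: mult.assoc mult.left_commute)
  qed
  also have "\<dots> = f_bound (4 * z\<^sup>2)"
    using z by (simp add: f_bound_cdf real_sqrt_mult)
  finally show ?thesis using mono[OF z, of n] by simp
qed

lemma mittag_leffler_summable:
  fixes z :: real
  assumes "0 \<le> z"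
  shows "summable (\<lambda>k. z ^ k / Gamma (real k / 2 + 1))"
proof (rule summableI_nonneg_bounded)
  show "0 \<le> z ^ k / Gamma (real k / 2 + 1)" for k
    using assms by (intro divide_nonneg_pos Gamma_real_pos) (auto simp: add_nonneg_pos)
  show "(\<Sum>k<n. z ^ k / Gamma (real k / 2 + 1)) \<le> f_bound (4 * z\<^sup>2)" for n
    by (rule mittag_leffler_sum_le_f_bound[OF assms])
qed

lemma f_bound_le: "f_bound t \<le> 2 * exp (t / 4)"
  unfolding f_bound_cdf using gaussian_cdf_le_1[of "sqrt (t / 2)"] by simp

section \<open>The limiting energy\<close>

text \<open>The Neumann series of \<open>v = g + \<sigma>\<^sub>1\<^sup>2 * K v\<close>, with
  \<open>K\<close> the Volterra operator and \<open>g\<close> the initial energy. It exceeds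
  \<open>f_sigma\<close> by the factor \<open>exp (2 * \<alpha> * t)\<close>, which removes the
  damping from the kernel.\<close>

definition limit_energy :: "real \<Rightarrow> real \<Rightarrow> real \<Rightarrow> real \<Rightarrow> real \<Rightarrow> ennreal" where
  "limit_energy \<alpha> \<beta> \<sigma>\<^sub>1 \<sigma>\<^sub>0 t =
    (\<Sum>k. ennreal ((\<sigma>\<^sub>1\<^sup>2) ^ k) * (volterra \<beta> ^^ k) (\<lambda>r. ennreal (initial_energy \<alpha> \<sigma>\<^sub>1 \<sigma>\<^sub>0 r)) t)"

context
  fixes \<alpha> \<beta> \<sigma>\<^sub>1 \<sigma>\<^sub>0 t :: real
  assumes \<beta>: "0 < \<beta>" and t: "0 < t"
begin

private abbreviation (input) "a \<equiv> \<lambda>k. (volterra \<beta> ^^ k) (\<lambda>r. ennreal (initial_energy \<alpha> \<sigma>\<^sub>1 \<sigma>\<^sub>0 r)) t"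
private abbreviation (input) "C \<equiv> (\<bar>\<sigma>\<^sub>1\<bar> + exp (\<bar>\<alpha>\<bar> * t) * \<bar>\<sigma>\<^sub>0\<bar>)\<^sup>2"
private abbreviation (input) "s \<equiv> sqrt (t / (4 * \<beta>))"
private abbreviation (input) "G \<equiv> \<lambda>k. Gamma (real k / 2 + 1)"

private lemma G: "0 < G k"
  by (intro Gamma_real_pos) (simp add: add_nonneg_pos)

private lemma s: "0 \<le> s"
  using \<beta> t by simp

private lemma a_le: "a k \<le> ennreal (C * (s ^ k / G k))"
proof -
  have "a k \<le> ennreal C * ennreal (s ^ k / G k)"
    using initial_energy_le by (intro volterra_iter_bound \<beta> t ennreal_leI) auto
  then show ?thesis by (subst ennreal_mult') auto
qed

text \<open>The Mittag-Leffler bound excludes the value infinity, which \<open>enn2real\<close>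
  would send to 0.\<close>

private lemma a_eq: "a k = ennreal (enn2real (a k))"
  using a_le[of k] by (subst ennreal_enn2real) (auto simp: less_top[symmetric] top_unique)

private lemma enn2real_a_le: "enn2real (a k) \<le> C * (s ^ k / G k)"
  using a_le[of k] s G[of k] by (intro enn2real_leI) auto

private lemma series_summable: "summable (\<lambda>k. (\<sigma>\<^sub>1\<^sup>2) ^ k * enn2real (a k))"
proof (rule summable_comparison_test')
  show "summable (\<lambda>k. C * ((\<sigma>\<^sub>1\<^sup>2 * s) ^ k / G k))"
    using s by (intro summable_mult mittag_leffler_summable) simp
  show "norm ((\<sigma>\<^sub>1\<^sup>2) ^ k * enn2real (a k)) \<le> C * ((\<sigma>\<^sub>1\<^sup>2 * s) ^ k / G k)" for k
    using mult_left_mono[OF enn2real_a_le[of k], of "(\<sigma>\<^sub>1\<^sup>2) ^ k"]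
    by (simp add: power_mult_distrib algebra_simps)
qed

lemma limit_energy_eq: "limit_energy \<alpha> \<beta> \<sigma>\<^sub>1 \<sigma>\<^sub>0 t = ennreal (\<Sum>k. (\<sigma>\<^sub>1\<^sup>2) ^ k * enn2real (a k))"
proof -
  have "limit_energy \<alpha> \<beta> \<sigma>\<^sub>1 \<sigma>\<^sub>0 t = (\<Sum>k. ennreal ((\<sigma>\<^sub>1\<^sup>2) ^ k * enn2real (a k)))"
    unfolding limit_energy_def by (intro suminf_cong) (subst a_eq, simp add: ennreal_mult)
  also have "\<dots> = ennreal (\<Sum>k. (\<sigma>\<^sub>1\<^sup>2) ^ k * enn2real (a k))"
    using series_summable by (intro suminf_ennreal2) auto
  finally show ?thesis .
qed

lemma limit_energy_finite: "limit_energy \<alpha> \<beta> \<sigma>\<^sub>1 \<sigma>\<^sub>0 t < \<infinity>"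
  unfolding limit_energy_eq by simp

lemma f_term_summable: "summable (\<lambda>k. f_term \<alpha> \<beta> \<sigma>\<^sub>1 \<sigma>\<^sub>0 k t)"
proof (subst summable_Suc_iff[symmetric], rule summable_comparison_test')
  \<comment> \<open>In \<open>f_term\<close> the power of \<open>\<sigma>\<^sub>1\<^sup>2\<close>
    lags one behind the iterate. The maximum with 1 lets \<open>?c ^ Suc k\<close> dominate it also
    when \<open>\<sigma>\<^sub>1\<close> is small or zero.\<close>
  let ?c = "max 1 (\<sigma>\<^sub>1\<^sup>2)"
  show "summable (\<lambda>k. exp (- 2 * \<alpha> * t) * (C * ((?c * s) ^ Suc k / G (Suc k))))"
    using s mittag_leffler_summable[of "?c * s"]
    by (intro summable_mult) (subst summable_Suc_iff, simp)
  show "norm (f_term \<alpha> \<beta> \<sigma>\<^sub>1 \<sigma>\<^sub>0 (Suc k) t) \<le> exp (- 2 * \<alpha> * t) * (C * ((?c * s) ^ Suc k / G (Suc k)))" for k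
  proof -
    have "(\<sigma>\<^sub>1\<^sup>2) ^ k \<le> ?c ^ k" by (intro power_mono) auto
    also have "\<dots> \<le> ?c ^ Suc k" by (intro power_increasing) auto
    finally have "(\<sigma>\<^sub>1\<^sup>2) ^ k * enn2real (a (Suc k)) \<le> ?c ^ Suc k * (C * (s ^ Suc k / G (Suc k)))"
      using enn2real_a_le[of "Suc k"] by (intro mult_mono) auto
    then have "(\<sigma>\<^sub>1\<^sup>2) ^ k * enn2real (a (Suc k)) \<le> C * ((?c * s) ^ Suc k / G (Suc k))"
      by (simp add: power_mult_distrib algebra_simps)
    moreover have "f_term \<alpha> \<beta> \<sigma>\<^sub>1 \<sigma>\<^sub>0 (Suc k) t = exp (- 2 * \<alpha> * t) * ((\<sigma>\<^sub>1\<^sup>2) ^ k * enn2real (a (Suc k)))"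
      unfolding f_term_volterra[OF \<beta> t] by (simp add: power_mult)
    moreover have "0 \<le> (\<sigma>\<^sub>1\<^sup>2) ^ k * enn2real (a (Suc k))" by simp
    then have "\<bar>exp (- 2 * \<alpha> * t) * ((\<sigma>\<^sub>1\<^sup>2) ^ k * enn2real (a (Suc k)))\<bar> =
        exp (- 2 * \<alpha> * t) * ((\<sigma>\<^sub>1\<^sup>2) ^ k * enn2real (a (Suc k)))"
      by (intro abs_of_nonneg mult_nonneg_nonneg) auto
    ultimately show ?thesis
      by (simp only: real_norm_def) (intro mult_left_mono, assumption, simp)
  qed
qed

text \<open>Multiplication by \<open>\<sigma>\<^sub>1\<^sup>2\<close> supplies the power that
  \<open>f_term\<close> lacks. The term \<open>k = 0\<close> and the two closed terms of
  \<open>f_sigma\<close> together complete the square of the zeroth term of the Neumann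
  series.\<close>

lemma f_sigma_series:
  "f_sigma \<alpha> \<beta> \<sigma>\<^sub>1 \<sigma>\<^sub>0 t = exp (- 2 * \<alpha> * t) * (\<Sum>k. (\<sigma>\<^sub>1\<^sup>2) ^ k * enn2real (a k))"
proof -
  have "\<sigma>\<^sub>1\<^sup>2 * (\<Sum>k. f_term \<alpha> \<beta> \<sigma>\<^sub>1 \<sigma>\<^sub>0 k t) = (\<Sum>k. \<sigma>\<^sub>1\<^sup>2 * f_term \<alpha> \<beta> \<sigma>\<^sub>1 \<sigma>\<^sub>0 k t)"
    using f_term_summable by (rule suminf_mult[symmetric])
  also have "\<dots> = \<sigma>\<^sub>1\<^sup>2 * f_term \<alpha> \<beta> \<sigma>\<^sub>1 \<sigma>\<^sub>0 0 t + (\<Sum>k. \<sigma>\<^sub>1\<^sup>2 * f_term \<alpha> \<beta> \<sigma>\<^sub>1 \<sigma>\<^sub>0 (Suc k) t)"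
    using f_term_summable by (subst suminf_split_head) (auto intro!: summable_mult)
  also have "(\<lambda>k. \<sigma>\<^sub>1\<^sup>2 * f_term \<alpha> \<beta> \<sigma>\<^sub>1 \<sigma>\<^sub>0 (Suc k) t) = (\<lambda>k. exp (- 2 * \<alpha> * t) * ((\<sigma>\<^sub>1\<^sup>2) ^ Suc k * enn2real (a (Suc k))))"
    unfolding f_term_volterra[OF \<beta> t] by (simp add: power_mult fun_eq_iff)
  also have "(\<Sum>k. exp (- 2 * \<alpha> * t) * ((\<sigma>\<^sub>1\<^sup>2) ^ Suc k * enn2real (a (Suc k)))) =
      exp (- 2 * \<alpha> * t) * (\<Sum>k. (\<sigma>\<^sub>1\<^sup>2) ^ Suc k * enn2real (a (Suc k)))"
    using series_summable by (intro suminf_mult) (subst summable_Suc_iff)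
  also have "(\<Sum>k. (\<sigma>\<^sub>1\<^sup>2) ^ Suc k * enn2real (a (Suc k))) =
      (\<Sum>k. (\<sigma>\<^sub>1\<^sup>2) ^ k * enn2real (a k)) - initial_energy \<alpha> \<sigma>\<^sub>1 \<sigma>\<^sub>0 t"
    using suminf_split_head[OF series_summable] by simp
  finally have "f_sigma \<alpha> \<beta> \<sigma>\<^sub>1 \<sigma>\<^sub>0 t = exp (- 2 * \<alpha> * t) * (\<Sum>k. (\<sigma>\<^sub>1\<^sup>2) ^ k * enn2real (a k))
      + (\<sigma>\<^sub>1\<^sup>2 * exp (- 2 * \<alpha> * t) + 2 * \<sigma>\<^sub>1 * \<sigma>\<^sub>0 * exp (- \<alpha> * t) + \<sigma>\<^sub>0\<^sup>2
          - exp (- 2 * \<alpha> * t) * initial_energy \<alpha> \<sigma>\<^sub>1 \<sigma>\<^sub>0 t)"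
    unfolding f_sigma_def by (simp add: f_term_def algebra_simps)
  moreover have "exp (- 2 * \<alpha> * t) * initial_energy \<alpha> \<sigma>\<^sub>1 \<sigma>\<^sub>0 t = \<sigma>\<^sub>1\<^sup>2 * exp (- 2 * \<alpha> * t) + 2 * \<sigma>\<^sub>1 * \<sigma>\<^sub>0 * exp (- \<alpha> * t) + \<sigma>\<^sub>0\<^sup>2"
  proof -
    have "exp (- 2 * \<alpha> * t) = exp (- \<alpha> * t) * exp (- \<alpha> * t)" by (simp add: exp_add[symmetric])
    moreover have "exp (- \<alpha> * t) * exp (\<alpha> * t) = 1" by (simp add: exp_add[symmetric])
    ultimately have "exp (- 2 * \<alpha> * t) * initial_energy \<alpha> \<sigma>\<^sub>1 \<sigma>\<^sub>0 t = (exp (- \<alpha> * t) * \<sigma>\<^sub>1 + (exp (- \<alpha> * t) * exp (\<alpha> * t)) * \<sigma>\<^sub>0)\<^sup>2"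
      unfolding initial_energy_def by (simp only: power2_eq_square algebra_simps)
    also have "\<dots> = (exp (- \<alpha> * t) * \<sigma>\<^sub>1 + \<sigma>\<^sub>0)\<^sup>2"
      unfolding \<open>exp (- \<alpha> * t) * exp (\<alpha> * t) = 1\<close> by simp
    finally show ?thesis
      unfolding \<open>exp (- 2 * \<alpha> * t) = _\<close> by (simp add: power2_eq_square algebra_simps)
  qed
  ultimately show ?thesis by simp
qed

lemma f_sigma_limit_energy:
  "f_sigma \<alpha> \<beta> \<sigma>\<^sub>1 \<sigma>\<^sub>0 t = exp (- 2 * \<alpha> * t) * enn2real (limit_energy \<alpha> \<beta> \<sigma>\<^sub>1 \<sigma>\<^sub>0 t)"
  unfolding f_sigma_series limit_energy_eq
  using suminf_nonneg[OF series_summable] by (simp add: enn2real_ennreal)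

lemma f_sigma_nonneg: "0 \<le> f_sigma \<alpha> \<beta> \<sigma>\<^sub>1 \<sigma>\<^sub>0 t"
  unfolding f_sigma_limit_energy by simp

text \<open>The zeroth term is kept exactly and gives the final square. Only the later terms are
  estimated by the constant \<open>C\<close>, so the zeroth Mittag-Leffler term, equal to 1, is
  taken off \<open>f_bound\<close>. Its argument is \<open>4 * ?z\<^sup>2\<close> with
  \<open>?z = \<sigma>\<^sub>1\<^sup>2 * sqrt (t / (4 * \<beta>))\<close>.\<close>

lemma f_sigma_le:
  "f_sigma \<alpha> \<beta> \<sigma>\<^sub>1 \<sigma>\<^sub>0 t
    \<le> exp (- 2 * \<alpha> * t) * C * (f_bound (\<sigma>\<^sub>1 ^ 4 * t / \<beta>) - 1) + (\<sigma>\<^sub>1 * exp (- \<alpha> * t) + \<sigma>\<^sub>0)\<^sup>2"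
proof -
  let ?z = "\<sigma>\<^sub>1\<^sup>2 * s"
  have z: "0 \<le> ?z" using s by simp
  have z4: "4 * ?z\<^sup>2 = \<sigma>\<^sub>1 ^ 4 * t / \<beta>"
    using \<beta> t by (simp add: power_mult_distrib power_mult[symmetric])
  have "(\<Sum>k. ?z ^ k / G k) \<le> f_bound (4 * ?z\<^sup>2)"
    by (rule suminf_le_const[OF mittag_leffler_summable[OF z]]) (rule mittag_leffler_sum_le_f_bound[OF z])
  then have ml: "(\<Sum>k. ?z ^ Suc k / G (Suc k)) \<le> f_bound (\<sigma>\<^sub>1 ^ 4 * t / \<beta>) - 1"
    using suminf_split_head[OF mittag_leffler_summable[OF z]] z4 by simp
  have sml: "summable (\<lambda>k. ?z ^ Suc k / G (Suc k))"
    using mittag_leffler_summable[OF z] by (subst summable_Suc_iff)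
  have "(\<Sum>k. (\<sigma>\<^sub>1\<^sup>2) ^ Suc k * enn2real (a (Suc k))) \<le> (\<Sum>k. C * (?z ^ Suc k / G (Suc k)))"
  proof (rule suminf_le)
    show "(\<sigma>\<^sub>1\<^sup>2) ^ Suc k * enn2real (a (Suc k)) \<le> C * (?z ^ Suc k / G (Suc k))" for k
      using mult_left_mono[OF enn2real_a_le[of "Suc k"], of "(\<sigma>\<^sub>1\<^sup>2) ^ Suc k"]
      by (simp add: power_mult_distrib algebra_simps)
    show "summable (\<lambda>k. (\<sigma>\<^sub>1\<^sup>2) ^ Suc k * enn2real (a (Suc k)))"
      using series_summable by (subst summable_Suc_iff)
    show "summable (\<lambda>k. C * (?z ^ Suc k / G (Suc k)))" using sml by (rule summable_mult)
  qed
  also have "\<dots> = C * (\<Sum>k. ?z ^ Suc k / G (Suc k))" using sml by (rule suminf_mult)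
  also have "\<dots> \<le> C * (f_bound (\<sigma>\<^sub>1 ^ 4 * t / \<beta>) - 1)" using ml by (intro mult_left_mono) auto
  finally have "(\<Sum>k. (\<sigma>\<^sub>1\<^sup>2) ^ k * enn2real (a k)) \<le> C * (f_bound (\<sigma>\<^sub>1 ^ 4 * t / \<beta>) - 1) + initial_energy \<alpha> \<sigma>\<^sub>1 \<sigma>\<^sub>0 t"
    using suminf_split_head[OF series_summable] by simp
  then have "f_sigma \<alpha> \<beta> \<sigma>\<^sub>1 \<sigma>\<^sub>0 t \<le> exp (- 2 * \<alpha> * t) * (C * (f_bound (\<sigma>\<^sub>1 ^ 4 * t / \<beta>) - 1) + initial_energy \<alpha> \<sigma>\<^sub>1 \<sigma>\<^sub>0 t)"
    unfolding f_sigma_series by (intro mult_left_mono) auto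
  moreover have "exp (- 2 * \<alpha> * t) * initial_energy \<alpha> \<sigma>\<^sub>1 \<sigma>\<^sub>0 t = (\<sigma>\<^sub>1 * exp (- \<alpha> * t) + \<sigma>\<^sub>0)\<^sup>2"
  proof -
    have "exp (- 2 * \<alpha> * t) = (exp (- \<alpha> * t))\<^sup>2" by (simp add: power2_eq_square exp_add[symmetric])
    moreover have "exp (- \<alpha> * t) * exp (\<alpha> * t) = 1" by (simp add: exp_add[symmetric])
    ultimately have "exp (- 2 * \<alpha> * t) * initial_energy \<alpha> \<sigma>\<^sub>1 \<sigma>\<^sub>0 t = (\<sigma>\<^sub>1 * exp (- \<alpha> * t) + (exp (- \<alpha> * t) * exp (\<alpha> * t)) * \<sigma>\<^sub>0)\<^sup>2"
      unfolding initial_energy_def by (simp only: power_mult_distrib[symmetric] distrib_left mult_ac)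
    then show ?thesis unfolding \<open>exp (- \<alpha> * t) * exp (\<alpha> * t) = 1\<close> by simp
  qed
  ultimately show ?thesis by (simp only: distrib_left mult.assoc)
qed

end

lemma limit_energy_measurable [measurable]: "limit_energy \<alpha> \<beta> \<sigma>\<^sub>1 \<sigma>\<^sub>0 \<in> borel_measurable borel"
proof -
  have [measurable]: "(volterra \<beta> ^^ k) (\<lambda>r. ennreal (initial_energy \<alpha> \<sigma>\<^sub>1 \<sigma>\<^sub>0 r)) \<in> borel_measurable borel" for k
    by (rule volterra_iter_measurable) measurable
  have "(\<lambda>t. limit_energy \<alpha> \<beta> \<sigma>\<^sub>1 \<sigma>\<^sub>0 t) \<in> borel_measurable borel"
    unfolding limit_energy_def by measurable
  then show ?thesis .
qed

lemma f_sigma_integrable: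
  assumes \<beta>: "0 < \<beta>" and S: "0 < S"
  shows "set_integrable lborel {0..S} (f_sigma \<alpha> \<beta> \<sigma>\<^sub>1 \<sigma>\<^sub>0)"
proof -
  \<comment> \<open>The series representation and the bound hold for \<open>0 < t\<close> only, so
    the value at 0 enters \<open>B\<close> as a separate summand and is treated apart in
    \<open>?f\<close>.\<close>
  define B where "B = exp (2 * \<bar>\<alpha>\<bar> * S) * (\<bar>\<sigma>\<^sub>1\<bar> + exp (\<bar>\<alpha>\<bar> * S) * \<bar>\<sigma>\<^sub>0\<bar>)\<^sup>2 * (2 * exp (\<sigma>\<^sub>1 ^ 4 * S / \<beta> / 4))
    + (\<bar>\<sigma>\<^sub>1\<bar> * exp (\<bar>\<alpha>\<bar> * S) + \<bar>\<sigma>\<^sub>0\<bar>)\<^sup>2 + \<bar>f_sigma \<alpha> \<beta> \<sigma>\<^sub>1 \<sigma>\<^sub>0 0\<bar>"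
  have B: "\<bar>f_sigma \<alpha> \<beta> \<sigma>\<^sub>1 \<sigma>\<^sub>0 t\<bar> \<le> B" if t: "t \<in> {0..S}" for t
  proof (cases "t = 0")
    case False
    then have t': "0 < t" "t \<le> S" using t by auto
    have al: "- \<alpha> * t \<le> \<bar>\<alpha>\<bar> * S" "- 2 * \<alpha> * t \<le> 2 * \<bar>\<alpha>\<bar> * S" "\<bar>\<alpha>\<bar> * t \<le> \<bar>\<alpha>\<bar> * S"
    proof -
      have a: "\<bar>\<alpha>\<bar> * t \<le> \<bar>\<alpha>\<bar> * S" using t' by (intro mult_left_mono) auto
      have b: "- \<alpha> * t \<le> \<bar>\<alpha>\<bar> * t" using t' by (intro mult_right_mono) auto
      show 1: "- \<alpha> * t \<le> \<bar>\<alpha>\<bar> * S" by (rule order_trans[OF b a])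
      show "\<bar>\<alpha>\<bar> * t \<le> \<bar>\<alpha>\<bar> * S" by (rule a)
      show "- 2 * \<alpha> * t \<le> 2 * \<bar>\<alpha>\<bar> * S" using mult_left_mono[OF 1, of 2] by (simp add: mult.assoc)
    qed
    have "f_bound (\<sigma>\<^sub>1 ^ 4 * t / \<beta>) - 1 \<le> 2 * exp (\<sigma>\<^sub>1 ^ 4 * t / \<beta> / 4)"
      using f_bound_le[of "\<sigma>\<^sub>1 ^ 4 * t / \<beta>"] by simp
    also have "\<dots> \<le> 2 * exp (\<sigma>\<^sub>1 ^ 4 * S / \<beta> / 4)"
      using t' \<beta> by (auto intro!: divide_right_mono mult_left_mono)
    finally have fb: "f_bound (\<sigma>\<^sub>1 ^ 4 * t / \<beta>) - 1 \<le> 2 * exp (\<sigma>\<^sub>1 ^ 4 * S / \<beta> / 4)" .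
    have "exp (- 2 * \<alpha> * t) * (\<bar>\<sigma>\<^sub>1\<bar> + exp (\<bar>\<alpha>\<bar> * t) * \<bar>\<sigma>\<^sub>0\<bar>)\<^sup>2 * (f_bound (\<sigma>\<^sub>1 ^ 4 * t / \<beta>) - 1) \<le>
      exp (- 2 * \<alpha> * t) * (\<bar>\<sigma>\<^sub>1\<bar> + exp (\<bar>\<alpha>\<bar> * t) * \<bar>\<sigma>\<^sub>0\<bar>)\<^sup>2 * (2 * exp (\<sigma>\<^sub>1 ^ 4 * S / \<beta> / 4))"
      by (intro mult_left_mono fb) auto
    also have "\<dots> \<le> exp (2 * \<bar>\<alpha>\<bar> * S) * (\<bar>\<sigma>\<^sub>1\<bar> + exp (\<bar>\<alpha>\<bar> * S) * \<bar>\<sigma>\<^sub>0\<bar>)\<^sup>2 * (2 * exp (\<sigma>\<^sub>1 ^ 4 * S / \<beta> / 4))"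
      using al by (intro mult_right_mono mult_mono power_mono add_left_mono) auto
    finally have 1: "exp (- 2 * \<alpha> * t) * (\<bar>\<sigma>\<^sub>1\<bar> + exp (\<bar>\<alpha>\<bar> * t) * \<bar>\<sigma>\<^sub>0\<bar>)\<^sup>2 * (f_bound (\<sigma>\<^sub>1 ^ 4 * t / \<beta>) - 1) \<le>
      exp (2 * \<bar>\<alpha>\<bar> * S) * (\<bar>\<sigma>\<^sub>1\<bar> + exp (\<bar>\<alpha>\<bar> * S) * \<bar>\<sigma>\<^sub>0\<bar>)\<^sup>2 * (2 * exp (\<sigma>\<^sub>1 ^ 4 * S / \<beta> / 4))" .
    have "\<bar>\<sigma>\<^sub>1 * exp (- \<alpha> * t) + \<sigma>\<^sub>0\<bar> \<le> \<bar>\<sigma>\<^sub>1\<bar> * exp (- \<alpha> * t) + \<bar>\<sigma>\<^sub>0\<bar>"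
      using abs_triangle_ineq[of "\<sigma>\<^sub>1 * exp (- \<alpha> * t)" \<sigma>\<^sub>0] by (simp add: abs_mult)
    also have "\<dots> \<le> \<bar>\<sigma>\<^sub>1\<bar> * exp (\<bar>\<alpha>\<bar> * S) + \<bar>\<sigma>\<^sub>0\<bar>"
      by (intro add_right_mono mult_left_mono) (simp_all only: exp_le_cancel_iff al abs_ge_zero)
    finally have "(\<sigma>\<^sub>1 * exp (- \<alpha> * t) + \<sigma>\<^sub>0)\<^sup>2 \<le> (\<bar>\<sigma>\<^sub>1\<bar> * exp (\<bar>\<alpha>\<bar> * S) + \<bar>\<sigma>\<^sub>0\<bar>)\<^sup>2"
      by (metis abs_ge_zero power2_abs power_mono)
    then show ?thesis
      using f_sigma_le[OF \<beta> t'(1), of \<alpha> \<sigma>\<^sub>1 \<sigma>\<^sub>0] f_sigma_nonneg[OF \<beta> t'(1), of \<alpha> \<sigma>\<^sub>1 \<sigma>\<^sub>0] 1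
      unfolding B_def by linarith
  qed (simp add: B_def)
  let ?f = "\<lambda>t. if t = 0 then f_sigma \<alpha> \<beta> \<sigma>\<^sub>1 \<sigma>\<^sub>0 0 else exp (- 2 * \<alpha> * t) * enn2real (limit_energy \<alpha> \<beta> \<sigma>\<^sub>1 \<sigma>\<^sub>0 t)"
  have eq: "indicator {0..S} t *\<^sub>R f_sigma \<alpha> \<beta> \<sigma>\<^sub>1 \<sigma>\<^sub>0 t = indicator {0..S} t *\<^sub>R ?f t" for t
    using f_sigma_limit_energy[OF \<beta>] by (auto simp: indicator_def)
  show ?thesis
    unfolding set_integrable_def
  proof (rule Bochner_Integration.integrable_bound)
    show "integrable lborel (\<lambda>t. indicator {0..S} t *\<^sub>R B)"
      by (intro integrable_scaleR_left integrable_real_indicator) (auto simp: emeasure_lborel_Icc_eq)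
    show "(\<lambda>t. indicator {0..S} t *\<^sub>R f_sigma \<alpha> \<beta> \<sigma>\<^sub>1 \<sigma>\<^sub>0 t) \<in> borel_measurable lborel"
      unfolding eq by measurable
    show "AE t in lborel. norm (indicator {0..S} t *\<^sub>R f_sigma \<alpha> \<beta> \<sigma>\<^sub>1 \<sigma>\<^sub>0 t) \<le> norm (indicator {0..S} t *\<^sub>R B)"
      using B by (intro AE_I2) (auto simp: indicator_def intro: order_trans[OF _ abs_ge_self])
  qed
qed

section \<open>Green's functions by the method of images\<close>

lemma int_inverse_square_summable: "(\<lambda>k::int. 1 / (1 + (of_int k)\<^sup>2) :: real) summable_on UNIV"
proof -
  let ?g = "\<lambda>k::int. 1 / (1 + (of_int k)\<^sup>2) :: real"
  have "summable (\<lambda>n::nat. 1 / (1 + (of_nat n)\<^sup>2) :: real)"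
  proof (rule summable_comparison_test_ev)
    show "\<forall>\<^sub>F n in sequentially. norm (1 / (1 + (of_nat n)\<^sup>2) :: real) \<le> inverse (of_nat n ^ 2)"
      using eventually_gt_at_top[of 0]
    proof eventually_elim
      fix n :: nat assume "0 < n"
      then have "1 / (1 + (of_nat n)\<^sup>2) \<le> 1 / (of_nat n ^ 2 :: real)" by (intro frac_le) auto
      moreover have "0 \<le> 1 / (1 + (of_nat n)\<^sup>2 :: real)" by (intro divide_nonneg_nonneg add_nonneg_nonneg) auto
      ultimately show "norm (1 / (1 + (of_nat n)\<^sup>2) :: real) \<le> inverse (of_nat n ^ 2)"
        by (simp only: real_norm_def abs_of_nonneg inverse_eq_divide)
    qed
    show "summable (\<lambda>n. inverse (of_nat n ^ 2) :: real)" by (rule inverse_power_summable) simp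
  qed
  then have nat: "(\<lambda>n::nat. 1 / (1 + (of_nat n)\<^sup>2) :: real) summable_on UNIV"
    by (subst summable_on_UNIV_nonneg_real_iff) (auto intro!: add_nonneg_nonneg)
  have "?g summable_on range int" "?g summable_on range (\<lambda>n. - int n)"
    by (subst summable_on_reindex; (use nat in \<open>simp add: o_def inj_on_def\<close>))+
  then have "?g summable_on (range int \<union> (range (\<lambda>n. - int n) - range int))"
    by (intro summable_on_Un_disjoint) (auto intro: summable_on_subset_banach)
  moreover have "range int \<union> (range (\<lambda>n. - int n) - range int) = UNIV"
    by (auto simp: image_iff) (metis int_cases2)
  ultimately show ?thesis by simp
qed

text \<open>The pairing follows the image cells: cell \<open>- 2 * n\<close> yields the displacement
  \<open>x - y + 2 * n * L\<close> and cell \<open>- 2 * n - 1\<close> the displacement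
  \<open>x + y + 2 * n * L\<close> of the Green's function.\<close>

lemma infsum_even_odd:
  fixes F :: "int \<Rightarrow> real"
  assumes F: "F summable_on UNIV"
  shows "(\<Sum>\<^sub>\<infinity>n. F (- 2 * n) + F (- 2 * n - 1)) = (\<Sum>\<^sub>\<infinity>k. F k)"
proof -
  let ?e = "\<lambda>n::int. - 2 * n" and ?o = "\<lambda>n::int. - 2 * n - 1"
  have inj: "inj ?e" "inj ?o" by (auto simp: inj_on_def)
  have s: "F summable_on range ?e" "F summable_on range ?o"
    using F by (auto intro: summable_on_subset_banach)
  then have s': "(\<lambda>n. F (?e n)) summable_on UNIV" "(\<lambda>n. F (?o n)) summable_on UNIV"
    using summable_on_reindex[OF inj(1), of F] summable_on_reindex[OF inj(2), of F] by (auto simp: o_def)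
  have disj: "range ?e \<inter> range ?o = {}"
    by auto presburger
  have un: "range ?e \<union> range ?o = UNIV"
  proof -
    have "k \<in> range ?e \<union> range ?o" for k
      by (cases "even k") (auto simp: image_iff elim!: evenE oddE intro: exI[of _ "- (k div 2)"] exI[of _ "- (k div 2) - 1"])
    then show ?thesis by blast
  qed
  have "(\<Sum>\<^sub>\<infinity>k\<in>range ?e \<union> range ?o. F k) = (\<Sum>\<^sub>\<infinity>k\<in>range ?e. F k) + (\<Sum>\<^sub>\<infinity>k\<in>range ?o. F k)"
    by (rule infsum_Un_disjoint[OF s disj])
  also have "\<dots> = (\<Sum>\<^sub>\<infinity>n. F (?e n)) + (\<Sum>\<^sub>\<infinity>n. F (?o n))"
    by (simp only: infsum_reindex[OF inj(1)] infsum_reindex[OF inj(2)] o_def)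
  also have "\<dots> = (\<Sum>\<^sub>\<infinity>n. F (?e n) + F (?o n))"
    by (rule infsum_add[OF s', symmetric])
  finally show ?thesis using un by simp
qed

text \<open>The three Green's functions are sums over the images of \<open>y\<close> in the cells \<open>[kL, (k + 1)L]\<close>,
  translated in the periodic case and alternately reflected otherwise.\<close>

definition image_point :: "boundary_condition \<Rightarrow> real \<Rightarrow> int \<Rightarrow> real \<Rightarrow> real" where
  "image_point bc L k y = (if bc = Periodic \<or> even k then y + of_int k * L else of_int (k + 1) * L - y)"

definition image_sign :: "boundary_condition \<Rightarrow> int \<Rightarrow> real" where
  "image_sign bc k = (if bc = Dirichlet \<and> odd k then - 1 else 1)"

lemma image_point_0 [simp]: "image_point bc L 0 y = y"
  by (simp add: image_point_def)

lemma image_sign_0 [simp]: "image_sign bc 0 = 1"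
  by (simp add: image_sign_def)

lemma abs_image_sign [simp]: "\<bar>image_sign bc k\<bar> = 1"
  by (simp add: image_sign_def)

text \<open>The cells are enumerated by \<open>int_decode\<close>, which sends \<open>0\<close> to the cell \<open>[0, L]\<close> itself.\<close>

definition image_weight :: "nat \<Rightarrow> real" where
  "image_weight n = 1 / (1 + (of_int (int_decode n))\<^sup>2)"

lemma image_weight_nonneg [simp]: "0 \<le> image_weight n"
  by (simp add: image_weight_def add_nonneg_nonneg)

lemma image_weight_summable: "summable image_weight"
proof -
  have "(\<lambda>n. 1 / (1 + (of_int (int_decode n))\<^sup>2) :: real) summable_on UNIV"
    using int_inverse_square_summable summable_on_reindex_bij_betw[OF bij_int_decode, of "\<lambda>k. 1 / (1 + (of_int k)\<^sup>2) :: real"]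
    by simp
  then have "image_weight summable_on UNIV" unfolding image_weight_def .
  then show ?thesis by (subst (asm) summable_on_UNIV_nonneg_real_iff) auto
qed

text \<open>Quadratic decay in the cell index is enough for summability and comes with an explicit
  constant. With \<open>u = d\<^sup>2 / (2 * s)\<close> one has \<open>1 + k\<^sup>2 \<le> 3 + 2 *
  d\<^sup>2 = 3 + 4 * s * u \<le> (3 + 4 * s) * exp u\<close>. The weight depends on
  \<open>k\<close> only, which makes later bounds uniform in the space variables and in the
  length.\<close>

lemma gauss_decay:
  fixes s d k :: real
  assumes s: "0 < s" and k: "\<bar>k\<bar> \<le> \<bar>d\<bar> + 1"
  shows "heat_kernel s d \<le> (3 + 4 * s) / sqrt (2 * pi * s) * (1 / (1 + k\<^sup>2))"
proof -
  have "k\<^sup>2 \<le> (\<bar>d\<bar> + 1)\<^sup>2" using power_mono[OF k abs_ge_zero, of 2] by simp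
  moreover have "(\<bar>d\<bar> + 1)\<^sup>2 \<le> 2 * d\<^sup>2 + 2"
    using sum_squares_bound[of "\<bar>d\<bar>" 1] by (simp add: power2_sum)
  ultimately have k2: "1 + k\<^sup>2 \<le> 3 + 2 * d\<^sup>2" by simp
  define u where "u = d\<^sup>2 / (2 * s)"
  have u: "0 \<le> u" using s by (simp add: u_def)
  have "3 + 2 * d\<^sup>2 = 3 + 4 * s * u" using s by (simp add: u_def)
  also have "\<dots> \<le> (3 + 4 * s) * (1 + u)" using s u by (simp add: algebra_simps)
  also have "\<dots> \<le> (3 + 4 * s) * exp u" using s exp_ge_add_one_self[of u] by (intro mult_left_mono) auto
  finally have "1 + k\<^sup>2 \<le> (3 + 4 * s) * exp u" using k2 by simp
  moreover have "0 < 1 + k\<^sup>2" by (simp add: add_pos_nonneg)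
  ultimately have "exp (- u) \<le> (3 + 4 * s) * (1 / (1 + k\<^sup>2))"
    by (simp add: exp_minus field_simps)
  then have "exp (- u) / sqrt (2 * pi * s) \<le> (3 + 4 * s) * (1 / (1 + k\<^sup>2)) / sqrt (2 * pi * s)"
    using s by (intro divide_right_mono) auto
  then show ?thesis unfolding heat_kernel_def u_def by (simp add: mult.commute)
qed

text \<open>The image lies in the cell \<open>[k * L, (k + 1) * L]\<close>, and at least
  \<open>\<bar>k\<bar> - 1\<close> whole cells of width at least 1 separate it from
  \<open>[0, L]\<close> when \<open>k\<close> is nonzero.\<close>

lemma image_distance:
  assumes x: "0 \<le> x" "x \<le> L" and y: "0 \<le> y" "y \<le> L" and L: "1 \<le> L"
  shows "\<bar>of_int k\<bar> \<le> \<bar>x - image_point bc L k y\<bar> + 1"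
proof -
  have I: "of_int k * L \<le> image_point bc L k y" "image_point bc L k y \<le> of_int (k + 1) * L"
    using y by (auto simp: image_point_def algebra_simps)
  consider "k = 0" | "1 \<le> k" | "k \<le> - 1" by linarith
  then show ?thesis
  proof cases
    case 2
    then have "of_int k - 1 \<le> (of_int k - 1) * L"
      using mult_left_mono[OF L, of "of_int k - 1"] by simp
    then have "of_int k - 1 \<le> image_point bc L k y - x" using I x by (simp add: algebra_simps)
    then show ?thesis using 2 by linarith
  next
    case 3
    then have "- of_int k - 1 \<le> (- of_int k - 1) * L"
      using mult_left_mono[OF L, of "- of_int k - 1"] by simp
    then have "- of_int k - 1 \<le> x - image_point bc L k y" using I x by (simp add: algebra_simps)
    then show ?thesis using 3 by linarith
  qed simp
qed

lemma heat_kernel_image_le: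
  assumes "0 < s" "0 \<le> x" "x \<le> L" "0 \<le> y" "y \<le> L" "1 \<le> L"
  shows "heat_kernel s (x - image_point bc L (int_decode n) y) \<le> (3 + 4 * s) / sqrt (2 * pi * s) * image_weight n"
  unfolding image_weight_def using gauss_decay[OF assms(1) image_distance[OF assms(2-6)]] .

definition image_term :: "boundary_condition \<Rightarrow> real \<Rightarrow> real \<Rightarrow> real \<Rightarrow> real \<Rightarrow> nat \<Rightarrow> real" where
  "image_term bc L s x y n = heat_kernel s (x - image_point bc L (int_decode n) y)"

definition image_kernel :: "boundary_condition \<Rightarrow> real \<Rightarrow> real \<Rightarrow> real \<Rightarrow> real \<Rightarrow> real" where
  "image_kernel bc L s x y = (\<Sum>n. image_sign bc (int_decode n) * image_term bc L s x y n)"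

lemma image_term_nonneg: "0 \<le> s \<Longrightarrow> 0 \<le> image_term bc L s x y n"
  by (simp add: image_term_def)

lemma image_term_0: "image_term bc L s x y 0 = heat_kernel s (x - y)"
  by (simp add: image_term_def int_decode_def sum_decode_def)

text \<open>Absolute summability allows regrouping: even and odd cells are paired for Neumann and
  Dirichlet, and the index is negated in the periodic case, where \<open>green\<close> shifts
  \<open>x - y\<close> while a cell shifts \<open>y\<close>.\<close>

lemma green_image_kernel:
  assumes t: "0 < \<beta> * t" and x: "0 \<le> x" "x \<le> L" and y: "0 \<le> y" "y \<le> L" and L: "1 \<le> L"
  shows "green bc \<alpha> \<beta> L t x y = exp (- \<alpha> * t) * image_kernel bc L (\<beta> * t) x y"
proof -
  let ?s = "\<beta> * t"
  let ?F = "\<lambda>k. image_sign bc k * heat_kernel ?s (x - image_point bc L k y)"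
  have F: "?F summable_on UNIV"
  proof (rule abs_summable_summable)
    have "(\<lambda>k. (3 + 4 * ?s) / sqrt (2 * pi * ?s) * (1 / (1 + (of_int k)\<^sup>2))) summable_on (UNIV :: int set)"
      by (intro summable_on_cmult_right int_inverse_square_summable)
    then show "(\<lambda>k. norm (?F k)) summable_on UNIV"
    proof (rule summable_on_comparison_test)
      show "norm (?F k) \<le> (3 + 4 * ?s) / sqrt (2 * pi * ?s) * (1 / (1 + (of_int k)\<^sup>2))" for k
        using gauss_decay[OF t image_distance[OF x y L]] t by (simp add: abs_mult)
    qed simp
  qed
  have "image_kernel bc L ?s x y = (\<Sum>n. ?F (int_decode n))"
    unfolding image_kernel_def image_term_def ..
  also have "\<dots> = (\<Sum>\<^sub>\<infinity>n. ?F (int_decode n))"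
  proof -
    have "(\<lambda>n. ?F (int_decode n)) summable_on UNIV"
      using F summable_on_reindex_bij_betw[OF bij_int_decode, of ?F] by simp
    then show ?thesis by (intro sums_unique[symmetric] has_sum_imp_sums has_sum_infsum)
  qed
  also have "\<dots> = (\<Sum>\<^sub>\<infinity>k. ?F k)"
    by (rule infsum_reindex_bij_betw[OF bij_int_decode])
  finally have K: "image_kernel bc L ?s x y = (\<Sum>\<^sub>\<infinity>k. ?F k)" .
  show ?thesis
  proof (cases "bc = Periodic")
    case True
    have "(\<Sum>\<^sub>\<infinity>n. heat_kernel ?s (x - y + of_int n * L)) = (\<Sum>\<^sub>\<infinity>n. ?F (- n))"
      by (rule infsum_cong) (simp add: True image_sign_def image_point_def algebra_simps)
    also have "\<dots> = (\<Sum>\<^sub>\<infinity>k. ?F k)"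
      by (rule infsum_reindex_bij_betw) (auto intro!: bij_betwI[where g = uminus])
    finally show ?thesis unfolding K green_def by (simp add: True)
  next
    case False
    have "(\<Sum>\<^sub>\<infinity>k. ?F k) = (\<Sum>\<^sub>\<infinity>n. ?F (- 2 * n) + ?F (- 2 * n - 1))"
      by (rule infsum_even_odd[OF F, symmetric])
    also have "\<dots> = (\<Sum>\<^sub>\<infinity>n. heat_kernel ?s (x - y + 2 * of_int n * L) +
        (if bc = Dirichlet then - 1 else 1) * heat_kernel ?s (x + y + 2 * of_int n * L))"
      using False by (intro infsum_cong) (simp add: image_sign_def image_point_def algebra_simps)
    finally show ?thesis using False unfolding K green_def by (cases bc) auto
  qed
qed

section \<open>Heat kernel integrals and the mass leaving the interval\<close>

lemma heat_kernel_normal_density: "0 < s \<Longrightarrow> heat_kernel s z = normal_density 0 (sqrt s) z"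
  by (simp add: heat_kernel_def normal_density_def)

lemma heat_kernel_minus [simp]: "heat_kernel s (- z) = heat_kernel s z"
  by (simp add: heat_kernel_def)

lemma heat_kernel_swap: "heat_kernel s (x - y) = heat_kernel s (y - x)"
  using heat_kernel_minus[of s "x - y"] by (simp del: heat_kernel_minus)

lemma nn_integral_translate:
  fixes f :: "real \<Rightarrow> ennreal" and c :: real
  assumes [measurable]: "f \<in> borel_measurable borel"
  shows "(\<integral>\<^sup>+y. f (c + y) \<partial>lborel) = (\<integral>\<^sup>+y. f y \<partial>lborel)"
    "(\<integral>\<^sup>+y. f (c - y) \<partial>lborel) = (\<integral>\<^sup>+y. f y \<partial>lborel)"
  using nn_integral_real_affine[OF assms, of 1 c] nn_integral_real_affine[OF assms, of "-1" c] by simp_all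

lemma nn_integral_heat_kernel:
  assumes "0 < s"
  shows "(\<integral>\<^sup>+z. ennreal (heat_kernel s z) \<partial>lborel) = 1"
  using assms by (simp add: heat_kernel_normal_density nn_integral_eq_integral)

lemma nn_integral_heat_kernel_abs:
  assumes s: "0 < s"
  shows "(\<integral>\<^sup>+z. ennreal (heat_kernel s z) * ennreal \<bar>z\<bar> \<partial>lborel) \<le> ennreal (sqrt s)"
proof -
  have s': "0 < sqrt s" using s by simp
  have "(\<integral>\<^sup>+z. ennreal (heat_kernel s z) * ennreal \<bar>z\<bar> \<partial>lborel) =
    (\<integral>\<^sup>+z. ennreal (normal_density 0 (sqrt s) z * \<bar>z - 0\<bar> ^ (2 * 0 + 1)) \<partial>lborel)"
    using s by (intro nn_integral_cong) (simp add: heat_kernel_normal_density ennreal_mult'[symmetric])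
  also have "\<dots> = ennreal (2 ^ 0 * sqrt s ^ (2 * 0 + 1) * fact 0 * sqrt (2 / pi))"
    using normal_moment_abs_odd[OF s', of 0 0]
    by (intro nn_integral_eq_integral[THEN trans] arg_cong[where f=ennreal])
      (auto simp: has_bochner_integral_iff)
  also have "sqrt (2 / pi) \<le> 1" using pi_gt3 by simp
  then have "2 ^ 0 * sqrt s ^ (2 * 0 + 1) * fact 0 * sqrt (2 / pi) \<le> sqrt s"
    using s mult_left_mono[of "sqrt (2 / pi)" 1 "sqrt s"] by simp
  finally show ?thesis by (auto intro: order_trans ennreal_leI)
qed

text \<open>The square of the Gaussian kernel at time \<open>s\<close> is
  \<open>heat_kernel (2 * s) 0\<close> times the Gaussian kernel at time \<open>s / 2\<close>, which
  has mass 1.\<close>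

lemma nn_integral_heat_kernel_square:
  assumes s: "0 < s"
  shows "(\<integral>\<^sup>+z. ennreal ((heat_kernel s z)\<^sup>2) \<partial>lborel) = ennreal (heat_kernel (2 * s) 0)"
proof -
  have "(heat_kernel s z)\<^sup>2 = heat_kernel (2 * s) 0 * heat_kernel (s / 2) z" for z
  proof -
    have "(heat_kernel s z)\<^sup>2 = exp (- z\<^sup>2 / s) / (2 * pi * s)"
      using s by (simp add: heat_kernel_def power_divide power2_eq_square exp_add[symmetric] field_simps)
    moreover have "sqrt (2 * pi * (2 * s)) * sqrt (2 * pi * (s / 2)) = 2 * pi * s"
      using s by (simp add: real_sqrt_mult[symmetric] real_sqrt_unique power2_eq_square)
    ultimately show ?thesis using s by (simp add: heat_kernel_def)
  qed
  then have "(\<integral>\<^sup>+z. ennreal ((heat_kernel s z)\<^sup>2) \<partial>lborel) =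
    (\<integral>\<^sup>+z. ennreal (heat_kernel (2 * s) 0) * ennreal (heat_kernel (s / 2) z) \<partial>lborel)"
    using s by (intro nn_integral_cong) (simp add: ennreal_mult')
  also have "\<dots> = ennreal (heat_kernel (2 * s) 0)"
    using s by (subst nn_integral_cmult) (simp_all add: nn_integral_heat_kernel)
  finally show ?thesis .
qed

definition outflow :: "real \<Rightarrow> real \<Rightarrow> real \<Rightarrow> ennreal" where
  "outflow s L x = (\<integral>\<^sup>+y. ennreal (heat_kernel s (x - y)) * indicator (- {0..L}) y \<partial>lborel)"

lemma outflow_measurable [measurable]: "outflow s L \<in> borel_measurable borel"
  unfolding outflow_def by measurable

lemma outflow_split:
  assumes "0 < s"
  shows "(\<integral>\<^sup>+y. ennreal (heat_kernel s (x - y)) * indicator {0..L} y \<partial>lborel) + outflow s L x = 1"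
proof -
  have "(\<integral>\<^sup>+y. ennreal (heat_kernel s (x - y)) * indicator {0..L} y \<partial>lborel) + outflow s L x =
    (\<integral>\<^sup>+y. ennreal (heat_kernel s (x - y)) \<partial>lborel)"
    unfolding outflow_def
    by (subst nn_integral_add[symmetric]) (auto intro!: nn_integral_cong simp: indicator_def)
  also have "\<dots> = 1"
    using nn_integral_translate(2)[of "\<lambda>z. ennreal (heat_kernel s z)" x] nn_integral_heat_kernel[OF assms] by simp
  finally show ?thesis .
qed

lemma outflow_le_1: "0 < s \<Longrightarrow> outflow s L x \<le> 1"
  using outflow_split[of s x L] by (metis add.commute le_iff_add)

text \<open>For a fixed displacement \<open>z\<close>, the points of \<open>[0, L]\<close> that it
  carries outside form a boundary layer of length at most \<open>\<bar>z\<bar>\<close>, at 0 or at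
  \<open>L\<close> according to the sign of \<open>z\<close>. Averaging over \<open>z\<close> leaves
  the first absolute moment of the Gaussian.\<close>

lemma outflow_integral_le:
  assumes s: "0 < s"
  shows "(\<integral>\<^sup>+x. outflow s L x * indicator {0..L} x \<partial>lborel) \<le> ennreal (sqrt s)"
proof -
  have "outflow s L x = (\<integral>\<^sup>+z. ennreal (heat_kernel s z) * indicator (- {0..L}) (x - z) \<partial>lborel)" for x
    unfolding outflow_def
    using nn_integral_translate(2)[of "\<lambda>z. ennreal (heat_kernel s z) * indicator (- {0..L}) (x - z)" x] by simp
  then have "(\<integral>\<^sup>+x. outflow s L x * indicator {0..L} x \<partial>lborel) =
    (\<integral>\<^sup>+x. \<integral>\<^sup>+z. ennreal (heat_kernel s z) * (indicator (- {0..L}) (x - z) * indicator {0..L} x) \<partial>lborel \<partial>lborel)"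
    by (simp add: nn_integral_multc[symmetric] mult.assoc)
  also have "\<dots> = (\<integral>\<^sup>+z. \<integral>\<^sup>+x. ennreal (heat_kernel s z) * (indicator (- {0..L}) (x - z) * indicator {0..L} x) \<partial>lborel \<partial>lborel)"
    by (rule lborel_pair.Fubini') (simp add: borel_prod[symmetric])
  also have "\<dots> \<le> (\<integral>\<^sup>+z. ennreal (heat_kernel s z) * ennreal \<bar>z\<bar> \<partial>lborel)"
  proof (rule nn_integral_mono)
    fix z :: real
    have "(\<integral>\<^sup>+x. indicator (- {0..L}) (x - z) * indicator {0..L} x \<partial>lborel) \<le>
      (\<integral>\<^sup>+x. indicator (if 0 \<le> z then {0..z} else {L + z..L}) x \<partial>lborel)"
      by (intro nn_integral_mono) (auto simp: indicator_def)
    also have "\<dots> = ennreal \<bar>z\<bar>" by (auto simp: emeasure_lborel_Icc_eq)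
    finally show "(\<integral>\<^sup>+x. ennreal (heat_kernel s z) * (indicator (- {0..L}) (x - z) * indicator {0..L} x) \<partial>lborel) \<le>
      ennreal (heat_kernel s z) * ennreal \<bar>z\<bar>"
      by (subst nn_integral_cmult) (auto intro: mult_left_mono)
  qed
  also have "\<dots> \<le> ennreal (sqrt s)" by (rule nn_integral_heat_kernel_abs[OF s])
  finally show ?thesis .
qed

section \<open>The image kernel as heat kernel plus remainder\<close>

lemma image_term_measurable [measurable]:
  assumes [measurable]: "f \<in> borel_measurable N" "g \<in> borel_measurable N" "h \<in> borel_measurable N"
  shows "(\<lambda>p. image_term bc L (f p) (g p) (h p) n) \<in> borel_measurable N"
  unfolding image_term_def image_point_def by measurable

lemma image_kernel_measurable [measurable]:
  assumes [measurable]: "f \<in> borel_measurable N" "g \<in> borel_measurable N" "h \<in> borel_measurable N"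
  shows "(\<lambda>p. image_kernel bc L (f p) (g p) (h p)) \<in> borel_measurable N"
  unfolding image_kernel_def by measurable

text \<open>The signs are dropped so that one nonnegative remainder serves all three boundary
  conditions; \<open>Suc n\<close> omits the cell \<open>[0, L]\<close> itself.\<close>

definition image_rest :: "boundary_condition \<Rightarrow> real \<Rightarrow> real \<Rightarrow> real \<Rightarrow> real \<Rightarrow> real" where
  "image_rest bc L s x y = (\<Sum>n. image_term bc L s x y (Suc n))"

lemma image_rest_measurable [measurable]:
  assumes [measurable]: "f \<in> borel_measurable N" "g \<in> borel_measurable N" "h \<in> borel_measurable N"
  shows "(\<lambda>p. image_rest bc L (f p) (g p) (h p)) \<in> borel_measurable N"
  unfolding image_rest_def by measurable

text \<open>Bounds the heat kernel and the image kernel uniformly in the space variables and in the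
  length, with the right singularity \<open>1 / sqrt s\<close> at time zero.\<close>

definition image_bound :: "real \<Rightarrow> real" where
  "image_bound s = (3 + 4 * s) / sqrt (2 * pi * s) * suminf image_weight"

context
  fixes bc :: boundary_condition and L s x y :: real
  assumes s: "0 < s" and x: "0 \<le> x" "x \<le> L" and y: "0 \<le> y" "y \<le> L" and L: "1 \<le> L"
begin

private lemma le: "image_term bc L s x y n \<le> (3 + 4 * s) / sqrt (2 * pi * s) * image_weight n"
  unfolding image_term_def by (rule heat_kernel_image_le[OF s x y L])

private lemma nonneg: "0 \<le> image_term bc L s x y n"
  using s by (simp add: image_term_nonneg)

private lemma summable: "summable (image_term bc L s x y)"
proof (rule summable_comparison_test')
  show "summable (\<lambda>n. (3 + 4 * s) / sqrt (2 * pi * s) * image_weight n)"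
    by (rule summable_mult[OF image_weight_summable])
  show "norm (image_term bc L s x y n) \<le> (3 + 4 * s) / sqrt (2 * pi * s) * image_weight n" for n
    using le nonneg by (simp only: real_norm_def abs_of_nonneg)
qed

lemma image_rest_nonneg: "0 \<le> image_rest bc L s x y"
  unfolding image_rest_def using summable nonneg by (intro suminf_nonneg) (auto simp: summable_Suc_iff)

lemma heat_kernel_plus_image_rest_le: "heat_kernel s (x - y) + image_rest bc L s x y \<le> image_bound s"
proof -
  have "heat_kernel s (x - y) + image_rest bc L s x y = suminf (image_term bc L s x y)"
    unfolding image_rest_def using suminf_split_head[OF summable] by (simp add: image_term_0)
  also have "\<dots> \<le> (\<Sum>n. (3 + 4 * s) / sqrt (2 * pi * s) * image_weight n)"
    by (intro suminf_le le summable summable_mult image_weight_summable)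
  also have "\<dots> = image_bound s" unfolding image_bound_def by (rule suminf_mult[OF image_weight_summable])
  finally show ?thesis .
qed

lemma image_kernel_diff_le: "\<bar>image_kernel bc L s x y - heat_kernel s (x - y)\<bar> \<le> image_rest bc L s x y"
proof -
  let ?f = "\<lambda>n. image_sign bc (int_decode n) * image_term bc L s x y n"
  have n: "norm (?f n) = image_term bc L s x y n" for n using nonneg[of n] by (simp add: abs_mult)
  have sf: "summable ?f" by (rule summable_norm_cancel) (unfold n, rule summable)
  have "int_decode 0 = 0" by (simp add: int_decode_def sum_decode_def)
  then have "image_kernel bc L s x y - heat_kernel s (x - y) = (\<Sum>n. ?f (Suc n))"
    unfolding image_kernel_def using suminf_split_head[OF sf] by (simp add: image_term_0)
  also have "norm \<dots> \<le> (\<Sum>n. norm (?f (Suc n)))"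
    using summable by (intro summable_norm) (simp only: n summable_Suc_iff)
  also have "\<dots> = image_rest bc L s x y" unfolding n image_rest_def ..
  finally show ?thesis by simp
qed

lemma abs_image_kernel_le: "\<bar>image_kernel bc L s x y\<bar> \<le> image_bound s"
  using image_kernel_diff_le heat_kernel_plus_image_rest_le s heat_kernel_nonneg[of s "x - y"] by linarith

text \<open>Factorised as sum times difference: the sum is bounded pointwise by
  \<open>2 * image_bound s\<close>, and the difference is kept as the remainder, to be integrated
  later.\<close>

lemma image_kernel_square_diff:
  "\<bar>(image_kernel bc L s x y)\<^sup>2 - (heat_kernel s (x - y))\<^sup>2\<bar> \<le> 2 * image_bound s * image_rest bc L s x y"
proof -
  let ?H = "image_kernel bc L s x y" and ?q = "heat_kernel s (x - y)"
  have "\<bar>?H\<^sup>2 - ?q\<^sup>2\<bar> = \<bar>?H + ?q\<bar> * \<bar>?H - ?q\<bar>"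
    by (simp add: power2_eq_square algebra_simps abs_mult[symmetric])
  also have "\<dots> \<le> (2 * image_bound s) * image_rest bc L s x y"
    using abs_image_kernel_le image_kernel_diff_le heat_kernel_plus_image_rest_le image_rest_nonneg
      heat_kernel_nonneg[of s "x - y"] s
    by (intro mult_mono) linarith+
  finally show ?thesis .
qed

lemma ennreal_image_rest: "ennreal (image_rest bc L s x y) = (\<Sum>n. ennreal (image_term bc L s x y (Suc n)))"
  unfolding image_rest_def using summable nonneg by (intro suminf_ennreal2[symmetric]) (auto simp: summable_Suc_iff)

end

lemma image_bound_nonneg: "0 \<le> s \<Longrightarrow> 0 \<le> image_bound s"
  unfolding image_bound_def by (intro mult_nonneg_nonneg divide_nonneg_nonneg suminf_nonneg image_weight_summable) auto

text \<open>Each image map carries \<open>(0, L)\<close> isometrically onto its cell. The cells with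
  nonzero index are disjoint and lie outside \<open>[0, L]\<close>, so their integrals add up to at
  most the heat mass outside.\<close>

lemma image_rest_integral_le:
  assumes s: "0 < s" and x: "0 \<le> x" "x \<le> L" and L: "1 \<le> L"
  shows "(\<integral>\<^sup>+y. ennreal (image_rest bc L s x y) * indicator {0..L} y \<partial>lborel) \<le> outflow s L x"
proof -
  let ?k = "\<lambda>n. int_decode (Suc n)"
  \<comment> \<open>Open cells, so that neighbours are disjoint; the end points that are lost form
    null sets.\<close>
  define J where "J n = {of_int (?k n) * L<..<of_int (?k n + 1) * L}" for n
  have k0: "?k n \<noteq> 0" for n
    using inj_int_decode[of UNIV] by (auto dest: injD[of _ "Suc n" 0] simp: int_decode_def sum_decode_def)
  have ordJ: "\<not> (z \<in> J n \<and> z \<in> J m)" if "?k n < ?k m" for n m z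
  proof
    assume "z \<in> J n \<and> z \<in> J m"
    then have "of_int (?k m) * L < of_int (?k n + 1) * L" by (auto simp: J_def)
    then have "of_int (?k m) < (of_int (?k n + 1) :: real)" using L by simp
    then show False using that by linarith
  qed
  have disj: "disjoint_family J"
  proof (unfold disjoint_family_on_def, safe)
    fix n m z assume "n \<noteq> m" "z \<in> J n" "z \<in> J m"
    moreover have "?k n \<noteq> ?k m" using \<open>n \<noteq> m\<close> inj_int_decode[of UNIV] by (auto dest: injD)
    ultimately show "z \<in> {}" using ordJ by (metis linorder_neqE)
  qed
  have J: "J n \<subseteq> - {0..L}" for n
  proof
    fix z assume z: "z \<in> J n"
    consider "1 \<le> ?k n" | "?k n + 1 \<le> 0" using k0[of n] by linarith
    then show "z \<in> - {0..L}"
    proof cases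
      case 1
      then have "1 * L \<le> of_int (?k n) * L" using L by (intro mult_right_mono) auto
      then show ?thesis using z by (auto simp: J_def)
    next
      case 2
      then have "of_int (?k n + 1) * L \<le> 0 * L" using L by (intro mult_right_mono) linarith+
      then show ?thesis using z by (auto simp: J_def)
    qed
  qed
  have int: "(\<integral>\<^sup>+y. ennreal (image_term bc L s x y (Suc n)) * indicator {0<..<L} y \<partial>lborel) =
    (\<integral>\<^sup>+z. ennreal (heat_kernel s (x - z)) * indicator (J n) z \<partial>lborel)" for n
  proof (cases "bc = Periodic \<or> even (?k n)")
    case True
    have "(\<integral>\<^sup>+y. ennreal (image_term bc L s x y (Suc n)) * indicator {0<..<L} y \<partial>lborel) =
      (\<integral>\<^sup>+y. ennreal (heat_kernel s (x - (of_int (?k n) * L + y))) * indicator (J n) (of_int (?k n) * L + y) \<partial>lborel)"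
      using True by (intro nn_integral_cong arg_cong2[where f="(*)"])
        (auto simp: image_term_def image_point_def J_def indicator_def algebra_simps)
    then show ?thesis
      using nn_integral_translate(1)[of "\<lambda>z. ennreal (heat_kernel s (x - z)) * indicator (J n) z" "of_int (?k n) * L"]
      by (simp add: J_def)
  next
    case False
    have "(\<integral>\<^sup>+y. ennreal (image_term bc L s x y (Suc n)) * indicator {0<..<L} y \<partial>lborel) =
      (\<integral>\<^sup>+y. ennreal (heat_kernel s (x - (of_int (?k n + 1) * L - y))) * indicator (J n) (of_int (?k n + 1) * L - y) \<partial>lborel)"
      using False by (intro nn_integral_cong arg_cong2[where f="(*)"])
        (auto simp: image_term_def image_point_def J_def indicator_def algebra_simps)
    then show ?thesis
      using nn_integral_translate(2)[of "\<lambda>z. ennreal (heat_kernel s (x - z)) * indicator (J n) z" "of_int (?k n + 1) * L"]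
      by (simp add: J_def)
  qed
  have "(\<integral>\<^sup>+y. ennreal (image_rest bc L s x y) * indicator {0..L} y \<partial>lborel) =
    (\<integral>\<^sup>+y. (\<Sum>n. ennreal (image_term bc L s x y (Suc n)) * indicator {0<..<L} y) \<partial>lborel)"
  proof (rule nn_integral_cong_AE, use AE_lborel_singleton[of 0] AE_lborel_singleton[of L] in eventually_elim)
    fix y :: real assume "y \<noteq> 0" "y \<noteq> L"
    then show "ennreal (image_rest bc L s x y) * indicator {0..L} y =
      (\<Sum>n. ennreal (image_term bc L s x y (Suc n)) * indicator {0<..<L} y)"
      using ennreal_image_rest[OF s x _ _ L, of y bc] by (auto simp: indicator_def)
  qed
  also have "\<dots> = (\<Sum>n. \<integral>\<^sup>+y. ennreal (image_term bc L s x y (Suc n)) * indicator {0<..<L} y \<partial>lborel)"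
    by (rule nn_integral_suminf) measurable
  also have "\<dots> = (\<Sum>n. \<integral>\<^sup>+z. ennreal (heat_kernel s (x - z)) * indicator (J n) z \<partial>lborel)"
    unfolding int ..
  also have "\<dots> = (\<integral>\<^sup>+z. (\<Sum>n. ennreal (heat_kernel s (x - z)) * indicator (J n) z) \<partial>lborel)"
    by (rule nn_integral_suminf[symmetric]) (simp add: J_def)
  also have "\<dots> \<le> outflow s L x"
    unfolding outflow_def
  proof (rule nn_integral_mono)
    fix z
    show "(\<Sum>n. ennreal (heat_kernel s (x - z)) * indicator (J n) z) \<le> ennreal (heat_kernel s (x - z)) * indicator (- {0..L}) z"
    proof (cases "\<exists>n. z \<in> J n")
      case True
      then obtain n where n: "z \<in> J n" ..
      have "(\<Sum>n. ennreal (heat_kernel s (x - z)) * indicator (J n) z) = ennreal (heat_kernel s (x - z))"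
        by (rule suminf_cmult_indicator[OF disj n])
      moreover have "z \<in> - {0..L}" using n J by blast
      ultimately show ?thesis by (simp only: indicator_simps mult_1_right order_refl)
    qed simp
  qed
  finally show ?thesis .
qed

section \<open>Volterra inequalities\<close>

lemma volterra_series_Suc:
  fixes c :: ennreal
  assumes [measurable]: "g \<in> borel_measurable borel"
  shows "(\<Sum>k<Suc n. c ^ k * (volterra \<beta> ^^ k) g t) = g t + c * volterra \<beta> (\<lambda>s. \<Sum>k<n. c ^ k * (volterra \<beta> ^^ k) g s) t"
proof -
  have "volterra \<beta> (\<lambda>s. \<Sum>k<n. c ^ k * (volterra \<beta> ^^ k) g s) t = (\<Sum>k<n. c ^ k * (volterra \<beta> ^^ Suc k) g t)"
    by (subst volterra_sum) (auto intro!: sum.cong simp: volterra_cmult)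
  then show ?thesis
    by (subst sum.lessThan_Suc_shift) (simp add: sum_distrib_left mult.assoc)
qed

text \<open>A family is allowed because the supremum of \<open>v\<close> over \<open>I\<close> need not be measurable.\<close>

lemma volterra_upper:
  fixes v :: "'i \<Rightarrow> real \<Rightarrow> ennreal" and B c :: real
  assumes \<beta>: "0 < \<beta>" and c: "0 \<le> c" and g[measurable]: "g \<in> borel_measurable borel"
    and step: "\<And>\<phi> i t. \<phi> \<in> borel_measurable borel \<Longrightarrow> (\<And>j s. j \<in> I \<Longrightarrow> 0 < s \<Longrightarrow> s \<le> T \<Longrightarrow> v j s \<le> \<phi> s) \<Longrightarrow>
      i \<in> I \<Longrightarrow> 0 < t \<Longrightarrow> t \<le> T \<Longrightarrow> v i t \<le> g t + ennreal c * volterra \<beta> \<phi> t"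
    and B: "\<And>i t. i \<in> I \<Longrightarrow> 0 < t \<Longrightarrow> t \<le> T \<Longrightarrow> v i t \<le> ennreal B"
    and i: "i \<in> I" and t: "0 < t" "t \<le> T"
  shows "v i t \<le> (\<Sum>k. ennreal c ^ k * (volterra \<beta> ^^ k) g t)"
proof -
  \<comment> \<open>The comparison function given to \<open>step\<close> is the bound from the
    previous round, so the a priori bound \<open>B\<close> survives only in the remainder.\<close>
  have iter: "v i t \<le> (\<Sum>k<n. ennreal c ^ k * (volterra \<beta> ^^ k) g t) + ennreal c ^ n * (volterra \<beta> ^^ n) (\<lambda>_. ennreal B) t"
    if "i \<in> I" "0 < t" "t \<le> T" for n i t
    using that
  proof (induction n arbitrary: i t)
    case 0
    then show ?case using B by simp
  next
    case (Suc n)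
    let ?\<phi> = "\<lambda>t. (\<Sum>k<n. ennreal c ^ k * (volterra \<beta> ^^ k) g t) + ennreal c ^ n * (volterra \<beta> ^^ n) (\<lambda>_. ennreal B) t"
    have "v i t \<le> g t + ennreal c * volterra \<beta> ?\<phi> t"
      by (rule step) (use Suc in auto)
    also have "volterra \<beta> ?\<phi> t = volterra \<beta> (\<lambda>t. \<Sum>k<n. ennreal c ^ k * (volterra \<beta> ^^ k) g t) t
        + ennreal c ^ n * (volterra \<beta> ^^ Suc n) (\<lambda>_. ennreal B) t"
      by (subst volterra_add) (auto simp: volterra_cmult)
    also have "g t + ennreal c * \<dots> = (\<Sum>k<Suc n. ennreal c ^ k * (volterra \<beta> ^^ k) g t)
        + ennreal c ^ Suc n * (volterra \<beta> ^^ Suc n) (\<lambda>_. ennreal B) t"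
      unfolding volterra_series_Suc[OF g] by (simp add: distrib_left mult.assoc add.assoc)
    finally show ?case .
  qed
  let ?z = "c * sqrt (t / (4 * \<beta>))"
  have z: "0 \<le> ?z" using c \<beta> t by simp
  \<comment> \<open>The remainder is dominated by a multiple of the general term of a convergent
    Mittag-Leffler series and vanishes in the limit, so \<open>B\<close> leaves no trace in the
    conclusion.\<close>
  have rem: "ennreal c ^ n * (volterra \<beta> ^^ n) (\<lambda>_. ennreal B) t \<le> ennreal (\<bar>B\<bar> * (?z ^ n / Gamma (real n / 2 + 1)))" for n
  proof -
    have G: "0 < Gamma (real n / 2 + 1)" by (intro Gamma_real_pos) (simp add: add_nonneg_pos)
    have "ennreal c ^ n * (volterra \<beta> ^^ n) (\<lambda>_. ennreal B) t \<le>
        ennreal c ^ n * (ennreal \<bar>B\<bar> * ennreal (sqrt (t / (4 * \<beta>)) ^ n / Gamma (real n / 2 + 1)))"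
      by (intro mult_left_mono volterra_iter_bound \<beta> t) (auto intro: ennreal_leI)
    also have "\<dots> = ennreal (c ^ n * (\<bar>B\<bar> * (sqrt (t / (4 * \<beta>)) ^ n / Gamma (real n / 2 + 1))))"
      by (simp only: ennreal_mult'[OF zero_le_power[OF c]] ennreal_mult'[OF abs_ge_zero] ennreal_power[OF c])
    finally show ?thesis by (simp add: power_mult_distrib algebra_simps)
  qed
  show ?thesis
  proof (rule LIMSEQ_le_const)
    have "(\<lambda>n. \<bar>B\<bar> * (?z ^ n / Gamma (real n / 2 + 1))) \<longlonglongrightarrow> \<bar>B\<bar> * 0"
      by (intro tendsto_mult tendsto_const summable_LIMSEQ_zero mittag_leffler_summable z)
    then have "(\<lambda>n. ennreal (\<bar>B\<bar> * (?z ^ n / Gamma (real n / 2 + 1)))) \<longlonglongrightarrow> ennreal 0"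
      by (intro tendsto_ennrealI) simp
    then show "(\<lambda>n. (\<Sum>k<n. ennreal c ^ k * (volterra \<beta> ^^ k) g t) + ennreal (\<bar>B\<bar> * (?z ^ n / Gamma (real n / 2 + 1))))
        \<longlonglongrightarrow> (\<Sum>k. ennreal c ^ k * (volterra \<beta> ^^ k) g t)"
      using tendsto_add[OF summable_LIMSEQ[OF summableI, of "\<lambda>k. ennreal c ^ k * (volterra \<beta> ^^ k) g t"]] by fastforce
    show "\<exists>N. \<forall>n\<ge>N. v i t \<le> (\<Sum>k<n. ennreal c ^ k * (volterra \<beta> ^^ k) g t) + ennreal (\<bar>B\<bar> * (?z ^ n / Gamma (real n / 2 + 1)))"
      using order_trans[OF iter[OF i t] add_left_mono[OF rem]] by blast
  qed
qed

text \<open>The error \<open>d\<close> is added on the larger side because subtraction in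
  \<open>ennreal\<close> truncates. The induction compares partial sums and starts from the empty
  sum; each round passes the accumulated error through the same operator, which produces the series
  in \<open>d\<close>.\<close>

lemma volterra_lower:
  fixes c :: ennreal
  assumes g[measurable]: "g \<in> borel_measurable borel" and d[measurable]: "d \<in> borel_measurable borel"
    and v[measurable]: "v \<in> borel_measurable borel"
    and step: "\<And>t. 0 < t \<Longrightarrow> t \<le> T \<Longrightarrow> g t + c * volterra \<beta> v t \<le> v t + d t"
    and t: "0 < t" "t \<le> T"
  shows "(\<Sum>k. c ^ k * (volterra \<beta> ^^ k) g t) \<le> v t + (\<Sum>k. c ^ k * (volterra \<beta> ^^ k) d t)"
proof -
  have iter: "(\<Sum>k<n. c ^ k * (volterra \<beta> ^^ k) g t) \<le> v t + (\<Sum>k<n. c ^ k * (volterra \<beta> ^^ k) d t)"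
    if "0 < t" "t \<le> T" for n t
    using that
  proof (induction n arbitrary: t)
    case (Suc n)
    have "(\<Sum>k<Suc n. c ^ k * (volterra \<beta> ^^ k) g t) =
        g t + c * volterra \<beta> (\<lambda>s. \<Sum>k<n. c ^ k * (volterra \<beta> ^^ k) g s) t"
      by (rule volterra_series_Suc) fact
    also have "\<dots> \<le> g t + c * volterra \<beta> (\<lambda>s. v s + (\<Sum>k<n. c ^ k * (volterra \<beta> ^^ k) d s)) t"
      using Suc by (intro add_left_mono mult_left_mono volterra_mono) auto
    also have "\<dots> = (g t + c * volterra \<beta> v t) + c * volterra \<beta> (\<lambda>s. \<Sum>k<n. c ^ k * (volterra \<beta> ^^ k) d s) t"
      by (subst volterra_add) (auto simp: distrib_left add.assoc)
    also have "\<dots> \<le> (v t + d t) + c * volterra \<beta> (\<lambda>s. \<Sum>k<n. c ^ k * (volterra \<beta> ^^ k) d s) t"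
      using Suc.prems by (intro add_right_mono step)
    also have "\<dots> = v t + (\<Sum>k<Suc n. c ^ k * (volterra \<beta> ^^ k) d t)"
      unfolding volterra_series_Suc[OF d] by (simp add: add.assoc)
    finally show ?case .
  qed simp
  have "(\<Sum>k<n. c ^ k * (volterra \<beta> ^^ k) g t) \<le> v t + (\<Sum>k. c ^ k * (volterra \<beta> ^^ k) d t)" for n
    using iter[OF t, of n] by (rule order_trans) (intro add_left_mono sum_le_suminf summableI, auto)
  then show ?thesis by (subst suminf_eq_SUP) (rule SUP_least)
qed

text \<open>For a constant source the Neumann series is \<open>a\<close> times the Mittag-Leffler
  series at \<open>?z = c * sqrt (t / (4 * \<beta>))\<close>, and
  \<open>f_bound (4 * ?z\<^sup>2)\<close> is at most \<open>2 * exp (?z\<^sup>2)\<close>.\<close>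

lemma volterra_series_const:
  assumes \<beta>: "0 < \<beta>" and c: "0 \<le> c" and a: "0 \<le> a" and t: "0 < t"
  shows "(\<Sum>k. ennreal c ^ k * (volterra \<beta> ^^ k) (\<lambda>_. ennreal a) t) \<le> ennreal (a * (2 * exp (c\<^sup>2 * t / (4 * \<beta>))))"
proof -
  let ?z = "c * sqrt (t / (4 * \<beta>))"
  have z: "0 \<le> ?z" using c \<beta> t by simp
  have G: "0 < Gamma (real k / 2 + 1)" for k by (intro Gamma_real_pos) (simp add: add_nonneg_pos)
  have term_eq: "ennreal c ^ k * (volterra \<beta> ^^ k) (\<lambda>_. ennreal a) t = ennreal (a * (?z ^ k / Gamma (real k / 2 + 1)))" for k
  proof -
    have "(volterra \<beta> ^^ k) (\<lambda>_. ennreal a) t = ennreal a * ennreal (sqrt (t / (4 * \<beta>)) ^ k / Gamma (real k / 2 + 1))"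
      using volterra_iter_cmult[where \<phi> = "\<lambda>_. 1" and c = "ennreal a" and \<beta> = \<beta> and k = k and t = t] volterra_iter_one[OF \<beta> t] by simp
    then have "ennreal c ^ k * (volterra \<beta> ^^ k) (\<lambda>_. ennreal a) t =
        ennreal (c ^ k * (a * (sqrt (t / (4 * \<beta>)) ^ k / Gamma (real k / 2 + 1))))"
      by (simp only: ennreal_mult'[OF zero_le_power[OF c]] ennreal_mult'[OF a] ennreal_power[OF c])
    then show ?thesis by (simp add: power_mult_distrib algebra_simps)
  qed
  have "(\<Sum>k<n. ennreal c ^ k * (volterra \<beta> ^^ k) (\<lambda>_. ennreal a) t) \<le> ennreal (a * (2 * exp (c\<^sup>2 * t / (4 * \<beta>))))" for n
  proof -
    have "(\<Sum>k<n. ennreal c ^ k * (volterra \<beta> ^^ k) (\<lambda>_. ennreal a) t) = ennreal (\<Sum>k<n. a * (?z ^ k / Gamma (real k / 2 + 1)))"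
      unfolding term_eq using a z G by (intro sum_ennreal) (auto intro!: mult_nonneg_nonneg divide_nonneg_pos)
    also have "(\<Sum>k<n. a * (?z ^ k / Gamma (real k / 2 + 1))) \<le> a * f_bound (4 * ?z\<^sup>2)"
      unfolding sum_distrib_left[symmetric] using mittag_leffler_sum_le_f_bound[OF z] a by (intro mult_left_mono)
    also have "\<dots> \<le> a * (2 * exp (4 * ?z\<^sup>2 / 4))" using f_bound_le a by (intro mult_left_mono)
    also have "4 * ?z\<^sup>2 / 4 = c\<^sup>2 * t / (4 * \<beta>)" using \<beta> t by (simp add: power_mult_distrib)
    finally show ?thesis by (auto intro: ennreal_leI)
  qed
  then show ?thesis by (subst suminf_eq_SUP) (rule SUP_least)
qed

section \<open>Second moments of the mild solution\<close>

text \<open>The weight turns the damping \<open>exp (- 2 * \<alpha> * (t - s))\<close> of the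
  squared Green's function into the weight at time \<open>s\<close>, so the equation for the
  energies has the undamped image kernel.\<close>

definition energy ::
  "'w measure \<Rightarrow> real \<Rightarrow> (real \<Rightarrow> real) \<Rightarrow> (real \<Rightarrow> real \<Rightarrow> 'w \<Rightarrow> real) \<Rightarrow> real \<Rightarrow> real \<Rightarrow> ennreal" where
  "energy M \<alpha> \<sigma> u t x = ennreal (exp (2 * \<alpha> * t)) * (\<integral>\<^sup>+\<omega>. ennreal ((\<sigma> (u t x \<omega>))\<^sup>2) \<partial>M)"

definition image_mean :: "boundary_condition \<Rightarrow> real \<Rightarrow> real \<Rightarrow> real \<Rightarrow> real" where
  "image_mean bc L s x = (LINT y:{0..L}|lborel. image_kernel bc L s x y)"

lemma image_mean_measurable [measurable]: "image_mean bc L s \<in> borel_measurable borel"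
  unfolding image_mean_def set_lebesgue_integral_def by measurable

lemma green_mean:
  assumes "0 < \<beta> * t" "0 \<le> x" "x \<le> L" "1 \<le> L"
  shows "(LINT y:{0..L}|lborel. green bc \<alpha> \<beta> L t x y) = exp (- \<alpha> * t) * image_mean bc L (\<beta> * t) x"
proof -
  have "(LINT y:{0..L}|lborel. green bc \<alpha> \<beta> L t x y) =
      (LINT y:{0..L}|lborel. exp (- \<alpha> * t) * image_kernel bc L (\<beta> * t) x y)"
    using green_image_kernel[OF assms(1-3) _ _ assms(4)]
    unfolding set_lebesgue_integral_def
    by (intro Bochner_Integration.integral_cong) (auto simp: indicator_def)
  then show ?thesis by (simp add: image_mean_def)
qed

lemma nn_integral_rectangle:
  fixes f :: "real \<Rightarrow> real \<Rightarrow> ennreal"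
  assumes "(\<lambda>p. f (fst p) (snd p) * indicator (A \<times> B) p) \<in> borel_measurable (lborel \<Otimes>\<^sub>M lborel)"
    and [measurable]: "A \<in> sets borel" "B \<in> sets borel"
  shows "(\<integral>\<^sup>+p. f (fst p) (snd p) \<partial>(restrict_space lborel (A \<times> B))) =
    (\<integral>\<^sup>+s. (\<integral>\<^sup>+y. f s y * indicator B y \<partial>lborel) * indicator A s \<partial>lborel)"
proof -
  have "(\<integral>\<^sup>+p. f (fst p) (snd p) \<partial>(restrict_space lborel (A \<times> B))) =
    (\<integral>\<^sup>+p. f (fst p) (snd p) * indicator (A \<times> B) p \<partial>(lborel \<Otimes>\<^sub>M lborel))"
    by (subst nn_integral_restrict_space) (auto simp: lborel_prod borel_Times)
  also have "\<dots> = (\<integral>\<^sup>+s. \<integral>\<^sup>+y. f s y * indicator (A \<times> B) (s, y) \<partial>lborel \<partial>lborel)"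
    using lborel.nn_integral_fst[OF assms(1)] by simp
  also have "\<dots> = (\<integral>\<^sup>+s. (\<integral>\<^sup>+y. f s y * indicator B y \<partial>lborel) * indicator A s \<partial>lborel)"
    by (intro nn_integral_cong) (auto simp: indicator_def)
  finally show ?thesis .
qed

context white_noise
begin

context
  fixes bc :: boundary_condition and \<alpha> \<beta> \<sigma>\<^sub>0 \<sigma>\<^sub>1 T L :: real and \<sigma> :: "real \<Rightarrow> real"
    and u :: "real \<Rightarrow> real \<Rightarrow> 'w \<Rightarrow> real"
  assumes \<beta>: "0 < \<beta>" and \<sigma>: "\<And>v. \<sigma> v = \<sigma>\<^sub>1 * v + \<sigma>\<^sub>0" and L: "1 \<le> L"
    and mild: "mild_solution M W bc \<alpha> \<beta> \<sigma> T L u"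
begin

lemma sigma_measurable [measurable]: "\<sigma> \<in> borel_measurable borel"
proof -
  have "\<sigma> = (\<lambda>v. \<sigma>\<^sub>1 * v + \<sigma>\<^sub>0)" by (rule ext) (rule \<sigma>)
  then show ?thesis by simp
qed

lemma solution_measurable: "t \<in> {0..T} \<Longrightarrow> x \<in> {0..L} \<Longrightarrow> u t x \<in> borel_measurable M"
  using mild filtration_measurable unfolding mild_solution_def by blast

lemma energy_measurable:
  "(\<lambda>p. energy M \<alpha> \<sigma> u (fst p) (snd p) * indicator ({0..T} \<times> {0..L}) p) \<in> borel_measurable (lborel \<Otimes>\<^sub>M lborel)"
proof -
  let ?D = "restrict_space lborel ({0..T} \<times> {0..L}) :: (real \<times> real) measure"
  interpret D: sigma_finite_measure ?D
    by (rule sigma_finite_measure_restrict_space) (auto simp: borel_Times lborel.sigma_finite_measure_axioms)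
  have m: "(\<lambda>(\<omega>, s, y). u s y \<omega>) \<in> borel_measurable (M \<Otimes>\<^sub>M ?D)"
    using mild unfolding mild_solution_def by blast
  \<comment> \<open>The integral over \<open>\<omega>\<close> is to be the inner one, so the factors
    of the product space are exchanged.\<close>
  have "(\<lambda>q. (snd q, fst q)) \<in> measurable (?D \<Otimes>\<^sub>M M) (M \<Otimes>\<^sub>M ?D)" by measurable
  from measurable_compose[OF this m]
  have [measurable]: "(\<lambda>q. u (fst (fst q)) (snd (fst q)) (snd q)) \<in> borel_measurable (?D \<Otimes>\<^sub>M M)"
    by (simp add: case_prod_unfold)
  have "(\<lambda>p. \<integral>\<^sup>+\<omega>. ennreal ((\<sigma> (u (fst p) (snd p) \<omega>))\<^sup>2) \<partial>M) \<in> borel_measurable ?D"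
    by (rule borel_measurable_nn_integral) (simp add: case_prod_unfold)
  moreover have [measurable]: "fst \<in> borel_measurable ?D"
    by (rule measurable_restrict_space1) (simp add: borel_prod[symmetric])
  ultimately have "(\<lambda>p. energy M \<alpha> \<sigma> u (fst p) (snd p)) \<in> borel_measurable ?D"
    unfolding energy_def by measurable
  then show ?thesis
    by (subst (asm) borel_measurable_restrict_space_iff_ennreal) (auto simp: lborel_prod borel_Times)
qed

text \<open>The constant may depend on \<open>L\<close> through the mild solution. It only starts
  the iteration of \<open>volterra_upper\<close>, whose conclusion is free of it.\<close>

lemma energy_bounded: "\<exists>B. \<forall>t\<in>{0..T}. \<forall>x\<in>{0..L}. energy M \<alpha> \<sigma> u t x \<le> ennreal B"
proof -
  obtain C where C: "\<forall>t\<in>{0..T}. \<forall>x\<in>{0..L}. (\<integral>\<^sup>+\<omega>. ennreal ((u t x \<omega>)\<^sup>2) \<partial>M) \<le> ennreal C"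
    using mild unfolding mild_solution_def by blast
  have "energy M \<alpha> \<sigma> u t x \<le> ennreal (exp (2 * \<bar>\<alpha>\<bar> * T) * (2 * \<sigma>\<^sub>1\<^sup>2 * \<bar>C\<bar> + 2 * \<sigma>\<^sub>0\<^sup>2))"
    if t: "t \<in> {0..T}" and x: "x \<in> {0..L}" for t x
  proof -
    note [measurable] = solution_measurable[OF t x]
    have "(\<integral>\<^sup>+\<omega>. ennreal ((\<sigma> (u t x \<omega>))\<^sup>2) \<partial>M) \<le>
      (\<integral>\<^sup>+\<omega>. ennreal (2 * \<sigma>\<^sub>1\<^sup>2) * ennreal ((u t x \<omega>)\<^sup>2) + ennreal (2 * \<sigma>\<^sub>0\<^sup>2) \<partial>M)"
    proof (rule nn_integral_mono)
      fix \<omega>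
      have "(\<sigma> (u t x \<omega>))\<^sup>2 \<le> 2 * \<sigma>\<^sub>1\<^sup>2 * (u t x \<omega>)\<^sup>2 + 2 * \<sigma>\<^sub>0\<^sup>2"
        using sum_squares_bound[of "\<sigma>\<^sub>1 * u t x \<omega>" \<sigma>\<^sub>0] by (simp add: \<sigma> power2_sum power_mult_distrib)
      then show "ennreal ((\<sigma> (u t x \<omega>))\<^sup>2) \<le> ennreal (2 * \<sigma>\<^sub>1\<^sup>2) * ennreal ((u t x \<omega>)\<^sup>2) + ennreal (2 * \<sigma>\<^sub>0\<^sup>2)"
        by (simp add: ennreal_mult[symmetric] ennreal_plus[symmetric] ennreal_leI del: ennreal_plus)
    qed
    also have "\<dots> = ennreal (2 * \<sigma>\<^sub>1\<^sup>2) * (\<integral>\<^sup>+\<omega>. ennreal ((u t x \<omega>)\<^sup>2) \<partial>M) + ennreal (2 * \<sigma>\<^sub>0\<^sup>2)"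
      by (simp add: nn_integral_add nn_integral_cmult emeasure_space_1)
    also have "\<dots> \<le> ennreal (2 * \<sigma>\<^sub>1\<^sup>2) * ennreal \<bar>C\<bar> + ennreal (2 * \<sigma>\<^sub>0\<^sup>2)"
    proof -
      have "(\<integral>\<^sup>+\<omega>. ennreal ((u t x \<omega>)\<^sup>2) \<partial>M) \<le> ennreal C" using C t x by blast
      also have "\<dots> \<le> ennreal \<bar>C\<bar>" by (intro ennreal_leI) simp
      finally show ?thesis by (intro add_right_mono mult_left_mono) auto
    qed
    also have "\<dots> = ennreal (2 * \<sigma>\<^sub>1\<^sup>2 * \<bar>C\<bar> + 2 * \<sigma>\<^sub>0\<^sup>2)"
      by (subst ennreal_plus, simp, simp, subst ennreal_mult', simp, rule refl)
    finally have 1: "(\<integral>\<^sup>+\<omega>. ennreal ((\<sigma> (u t x \<omega>))\<^sup>2) \<partial>M) \<le> ennreal (2 * \<sigma>\<^sub>1\<^sup>2 * \<bar>C\<bar> + 2 * \<sigma>\<^sub>0\<^sup>2)" .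
    have "\<alpha> * t \<le> \<bar>\<alpha>\<bar> * T" using t by (intro mult_mono) auto
    then have 2: "ennreal (exp (2 * \<alpha> * t)) \<le> ennreal (exp (2 * \<bar>\<alpha>\<bar> * T))"
      by (intro ennreal_leI) (simp add: mult.assoc)
    show ?thesis unfolding energy_def by (subst ennreal_mult', simp, rule mult_mono[OF 2 1]) auto
  qed
  then show ?thesis by blast
qed

text \<open>As \<open>\<sigma>\<close> is affine, \<open>\<sigma> (u t x \<omega>)\<close> is a
  constant plus \<open>\<sigma>\<^sub>1\<close> times a centred integral. The cross term vanishes,
  and the isometry expresses the variance by the same second moments, so the system closes.\<close>

lemma energy_equation:
  assumes t: "0 < t" "t \<le> T" and x: "x \<in> {0..L}"
  shows "energy M \<alpha> \<sigma> u t x = ennreal ((\<sigma>\<^sub>1 * image_mean bc L (\<beta> * t) x + exp (\<alpha> * t) * \<sigma>\<^sub>0)\<^sup>2) +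
    ennreal (\<sigma>\<^sub>1\<^sup>2) * (\<integral>\<^sup>+s. (\<integral>\<^sup>+y. ennreal ((image_kernel bc L (\<beta> * (t - s)) x y)\<^sup>2) * energy M \<alpha> \<sigma> u s y
      * indicator {0..L} y \<partial>lborel) * indicator {0<..<t} s \<partial>lborel)"
    (is "_ = _ + _ * ?J")
proof -
  let ?G = "\<lambda>s y. green bc \<alpha> \<beta> L (t - s) x y"
  let ?g = "exp (- \<alpha> * t) * image_mean bc L (\<beta> * t) x"
  let ?D = "restrict_space lborel ({0..t} \<times> {0..L}) :: (real \<times> real) measure"
  have t': "t \<in> {0..T}" "t \<in> {0<..T}" using t by auto
  obtain I where I: "has_walsh_integral M W t L (\<lambda>s y \<omega>. ?G s y * \<sigma> (u s y \<omega>)) I"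
    and u: "AE \<omega> in M. u t x \<omega> = (LINT y:{0..L}|lborel. green bc \<alpha> \<beta> L t x y) + I \<omega>"
    using mild t' x unfolding mild_solution_def by blast
  have "0 < \<beta> * t" using \<beta> t by simp
  then have u: "AE \<omega> in M. u t x \<omega> = ?g + I \<omega>"
    using u green_mean[of \<beta> t x L] x L by simp
  note W = walsh_isometry[OF I]
  note [measurable] = solution_measurable[OF t'(1) x]
  have [measurable]: "I \<in> borel_measurable M" using W(1) by simp
  have "(\<integral>\<^sup>+\<omega>. ennreal ((\<sigma> (u t x \<omega>))\<^sup>2) \<partial>M) = (\<integral>\<^sup>+\<omega>. ennreal ((\<sigma>\<^sub>1 * (?g + I \<omega>) + \<sigma>\<^sub>0)\<^sup>2) \<partial>M)"
    using u by (intro nn_integral_cong_AE) (auto simp: \<sigma>)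
  also have "\<dots> = ennreal (expectation (\<lambda>\<omega>. (\<sigma>\<^sub>1 * (?g + I \<omega>) + \<sigma>\<^sub>0)\<^sup>2))"
  proof (rule nn_integral_eq_integral)
    have "(\<lambda>\<omega>. (\<sigma>\<^sub>1 * (?g + I \<omega>) + \<sigma>\<^sub>0)\<^sup>2) =
        (\<lambda>\<omega>. (\<sigma>\<^sub>1 * ?g + \<sigma>\<^sub>0)\<^sup>2 + 2 * \<sigma>\<^sub>1 * (\<sigma>\<^sub>1 * ?g + \<sigma>\<^sub>0) * I \<omega> + \<sigma>\<^sub>1\<^sup>2 * (I \<omega>)\<^sup>2)"
      by (rule ext) (simp add: power2_eq_square algebra_simps)
    then show "integrable M (\<lambda>\<omega>. (\<sigma>\<^sub>1 * (?g + I \<omega>) + \<sigma>\<^sub>0)\<^sup>2)"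
      using W(1,3) by simp
  qed simp
  also have "expectation (\<lambda>\<omega>. (\<sigma>\<^sub>1 * (?g + I \<omega>) + \<sigma>\<^sub>0)\<^sup>2) = (\<sigma>\<^sub>1 * ?g + \<sigma>\<^sub>0)\<^sup>2 + \<sigma>\<^sub>1\<^sup>2 * expectation (\<lambda>\<omega>. (I \<omega>)\<^sup>2)"
  proof -
    have "(\<lambda>\<omega>. (\<sigma>\<^sub>1 * (?g + I \<omega>) + \<sigma>\<^sub>0)\<^sup>2) =
        (\<lambda>\<omega>. (\<sigma>\<^sub>1 * ?g + \<sigma>\<^sub>0)\<^sup>2 + 2 * \<sigma>\<^sub>1 * (\<sigma>\<^sub>1 * ?g + \<sigma>\<^sub>0) * I \<omega> + \<sigma>\<^sub>1\<^sup>2 * (I \<omega>)\<^sup>2)"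
      by (rule ext) (simp add: power2_eq_square algebra_simps)
    then show ?thesis using W(1,2,3) by (simp add: prob_space)
  qed
  also have "ennreal ((\<sigma>\<^sub>1 * ?g + \<sigma>\<^sub>0)\<^sup>2 + \<sigma>\<^sub>1\<^sup>2 * expectation (\<lambda>\<omega>. (I \<omega>)\<^sup>2)) =
      ennreal ((\<sigma>\<^sub>1 * ?g + \<sigma>\<^sub>0)\<^sup>2) + ennreal (\<sigma>\<^sub>1\<^sup>2) * (\<integral>\<^sup>+\<omega>. ennreal ((I \<omega>)\<^sup>2) \<partial>M)"
    using W(3) by (simp add: nn_integral_eq_integral ennreal_mult)
  finally have main: "(\<integral>\<^sup>+\<omega>. ennreal ((\<sigma> (u t x \<omega>))\<^sup>2) \<partial>M) =
      ennreal ((\<sigma>\<^sub>1 * ?g + \<sigma>\<^sub>0)\<^sup>2) + ennreal (\<sigma>\<^sub>1\<^sup>2) * (\<integral>\<^sup>+\<omega>. ennreal ((I \<omega>)\<^sup>2) \<partial>M)" .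
  have \<Phi>: "(\<lambda>(\<omega>, s, y). ?G s y * \<sigma> (u s y \<omega>)) \<in> borel_measurable (M \<Otimes>\<^sub>M ?D)"
    using I unfolding has_walsh_integral_def Let_def by blast
  interpret D: sigma_finite_measure ?D
    by (rule sigma_finite_measure_restrict_space) (auto simp: borel_Times lborel.sigma_finite_measure_axioms)
  interpret MD: pair_sigma_finite M ?D ..
  let ?V = "energy M \<alpha> \<sigma> u"
  let ?H = "\<lambda>s y. image_kernel bc L (\<beta> * (t - s)) x y"
  have "(\<integral>\<^sup>+\<omega>. ennreal ((I \<omega>)\<^sup>2) \<partial>M) =
      (\<integral>\<^sup>+p. \<integral>\<^sup>+\<omega>. ennreal ((?G (fst p) (snd p) * \<sigma> (u (fst p) (snd p) \<omega>))\<^sup>2) \<partial>M \<partial>?D)"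
    unfolding W(4) using \<Phi> by (subst MD.nn_integral_snd[symmetric]) (simp_all add: case_prod_unfold)
  also have "\<dots> = (\<integral>\<^sup>+p. (\<lambda>s y. ennreal (exp (- 2 * \<alpha> * t)) * (ennreal ((?H s y)\<^sup>2) * ?V s y)) (fst p) (snd p) \<partial>?D)"
  proof (rule nn_integral_cong_AE)
    \<comment> \<open>For \<open>s = t\<close> the Green's function is taken at time 0, outside the
      range of \<open>green_image_kernel\<close>; these points form a null set.\<close>
    have 1: "AE p in ?D. fst p \<noteq> t"
    proof -
      have "AE p in lborel \<Otimes>\<^sub>M (lborel :: real measure). fst p \<noteq> (t :: real)"
      proof (rule lborel_pair.AE_pair_measure)
        show "{p \<in> space (lborel \<Otimes>\<^sub>M lborel). fst p \<noteq> t} \<in> sets (lborel \<Otimes>\<^sub>M (lborel :: real measure))"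
          by measurable
        show "AE x in lborel. AE y in (lborel :: real measure). fst (x, y) \<noteq> t"
          using AE_lborel_singleton[of t] by eventually_elim simp
      qed
      then have "AE p in (lborel :: (real \<times> real) measure). fst p \<noteq> t" unfolding lborel_prod .
      then show ?thesis by (subst AE_restrict_space_iff) (auto simp: borel_Times elim: eventually_mono)
    qed
    have "AE p in ?D. p \<in> {0..t} \<times> {0..L}"
      using AE_space[of ?D] by (simp add: space_restrict_space)
    with 1 show "AE p in ?D. (\<integral>\<^sup>+\<omega>. ennreal ((?G (fst p) (snd p) * \<sigma> (u (fst p) (snd p) \<omega>))\<^sup>2) \<partial>M) =
       ennreal (exp (- 2 * \<alpha> * t)) * (ennreal ((?H (fst p) (snd p))\<^sup>2) * ?V (fst p) (snd p))"
    proof eventually_elim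
      fix p :: "real \<times> real" assume p: "p \<in> {0..t} \<times> {0..L}" "fst p \<noteq> t"
      let ?s = "fst p" and ?y = "snd p"
      have s: "?s \<in> {0..T}" "?s < t" and y: "?y \<in> {0..L}" using p t by auto
      note [measurable] = solution_measurable[OF s(1) y]
      have "0 < \<beta> * (t - ?s)" using s \<beta> by simp
      then have G: "?G ?s ?y = exp (- \<alpha> * (t - ?s)) * ?H ?s ?y"
        using x y L by (intro green_image_kernel) auto
      \<comment> \<open>Of the damping \<open>exp (- 2 * \<alpha> * (t - s))\<close>, the factor in
        \<open>t\<close> leaves the integral and cancels the weight of the energy at
        \<open>t\<close>; the factor in \<open>s\<close> is the weight of the energy at
        \<open>s\<close>.\<close>
      have "(?G ?s ?y * v)\<^sup>2 = (exp (- 2 * \<alpha> * t) * ((?H ?s ?y)\<^sup>2 * exp (2 * \<alpha> * ?s))) * v\<^sup>2" for v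
      proof -
        have "(exp (- \<alpha> * (t - ?s)))\<^sup>2 = exp (- 2 * \<alpha> * t) * exp (2 * \<alpha> * ?s)"
          by (simp add: power2_eq_square exp_add[symmetric] algebra_simps)
        then show ?thesis unfolding G power_mult_distrib by simp
      qed
      then have "(\<integral>\<^sup>+\<omega>. ennreal ((?G ?s ?y * \<sigma> (u ?s ?y \<omega>))\<^sup>2) \<partial>M) =
        (\<integral>\<^sup>+\<omega>. ennreal (exp (- 2 * \<alpha> * t) * ((?H ?s ?y)\<^sup>2 * exp (2 * \<alpha> * ?s))) * ennreal ((\<sigma> (u ?s ?y \<omega>))\<^sup>2) \<partial>M)"
        by (intro nn_integral_cong) (simp add: ennreal_mult)
      also have "\<dots> = ennreal (exp (- 2 * \<alpha> * t) * ((?H ?s ?y)\<^sup>2 * exp (2 * \<alpha> * ?s))) * (\<integral>\<^sup>+\<omega>. ennreal ((\<sigma> (u ?s ?y \<omega>))\<^sup>2) \<partial>M)"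
        by (rule nn_integral_cmult) measurable
      finally show "(\<integral>\<^sup>+\<omega>. ennreal ((?G ?s ?y * \<sigma> (u ?s ?y \<omega>))\<^sup>2) \<partial>M) =
        ennreal (exp (- 2 * \<alpha> * t)) * (ennreal ((?H ?s ?y)\<^sup>2) * ?V ?s ?y)"
        by (simp add: energy_def ennreal_mult mult.assoc)
    qed
  qed
  also have "\<dots> = (\<integral>\<^sup>+s. (\<integral>\<^sup>+y. (ennreal (exp (- 2 * \<alpha> * t)) * (ennreal ((?H s y)\<^sup>2) * ?V s y)) * indicator {0..L} y \<partial>lborel)
      * indicator {0..t} s \<partial>lborel)"
  proof (rule nn_integral_rectangle)
    have eq: "ennreal (exp (- 2 * \<alpha> * t)) * (ennreal ((?H (fst p) (snd p))\<^sup>2) * ?V (fst p) (snd p)) * indicator ({0..t} \<times> {0..L}) p =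
      ennreal (exp (- 2 * \<alpha> * t)) * ennreal ((?H (fst p) (snd p))\<^sup>2) * (?V (fst p) (snd p) * indicator ({0..T} \<times> {0..L}) p) *
        (indicator {0..t} (fst p))" for p
      using t by (cases p) (auto simp: indicator_def mult.assoc)
    note [measurable] = energy_measurable
    show "(\<lambda>p. ennreal (exp (- 2 * \<alpha> * t)) * (ennreal ((?H (fst p) (snd p))\<^sup>2) * ?V (fst p) (snd p)) * indicator ({0..t} \<times> {0..L}) p)
        \<in> borel_measurable (lborel \<Otimes>\<^sub>M lborel)"
      unfolding eq by measurable
  qed auto
  also have "\<dots> = (\<integral>\<^sup>+s. ennreal (exp (- 2 * \<alpha> * t)) * ((\<integral>\<^sup>+y. ennreal ((?H s y)\<^sup>2) * ?V s y * indicator {0..L} y \<partial>lborel)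
      * indicator {0<..<t} s) \<partial>lborel)"
  proof (rule nn_integral_cong_AE, use AE_lborel_singleton[of 0] AE_lborel_singleton[of t] in eventually_elim)
    fix s :: real assume s: "s \<noteq> 0" "s \<noteq> t"
    show "(\<integral>\<^sup>+y. (ennreal (exp (- 2 * \<alpha> * t)) * (ennreal ((?H s y)\<^sup>2) * ?V s y)) * indicator {0..L} y \<partial>lborel) * indicator {0..t} s
      = ennreal (exp (- 2 * \<alpha> * t)) * ((\<integral>\<^sup>+y. ennreal ((?H s y)\<^sup>2) * ?V s y * indicator {0..L} y \<partial>lborel) * indicator {0<..<t} s)"
    proof (cases "s \<in> {0<..<t}")
      case True
      then have "s \<in> {0..T}" using t by auto
      have "(\<lambda>y. ?V s y * indicator ({0..T} \<times> {0..L}) (s, y)) \<in> borel_measurable lborel"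
        using measurable_compose[OF measurable_Pair1'[of s lborel lborel] energy_measurable] by simp
      then have [measurable]: "(\<lambda>y. ?V s y * indicator {0..L} y) \<in> borel_measurable lborel"
        using \<open>s \<in> {0..T}\<close> by (simp add: indicator_def)
      have "(\<integral>\<^sup>+y. (ennreal (exp (- 2 * \<alpha> * t)) * (ennreal ((?H s y)\<^sup>2) * ?V s y)) * indicator {0..L} y \<partial>lborel) =
        (\<integral>\<^sup>+y. ennreal (exp (- 2 * \<alpha> * t)) * (ennreal ((?H s y)\<^sup>2) * (?V s y * indicator {0..L} y)) \<partial>lborel)"
        by (simp add: mult.assoc)
      also have "\<dots> = ennreal (exp (- 2 * \<alpha> * t)) * (\<integral>\<^sup>+y. ennreal ((?H s y)\<^sup>2) * (?V s y * indicator {0..L} y) \<partial>lborel)"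
        by (rule nn_integral_cmult) measurable
      finally show ?thesis using True by (simp add: mult.assoc)
    next
      case False
      then have "s \<notin> {0..t}" using s by auto
      then show ?thesis using False by simp
    qed
  qed
  also have "\<dots> = ennreal (exp (- 2 * \<alpha> * t)) * ?J"
  proof (rule nn_integral_cmult)
    have eq: "(\<integral>\<^sup>+y. ennreal ((?H s y)\<^sup>2) * ?V s y * indicator {0..L} y \<partial>lborel) * indicator {0<..<t} s =
      (\<integral>\<^sup>+y. ennreal ((?H s y)\<^sup>2) * (?V s y * indicator ({0..T} \<times> {0..L}) (s, y)) \<partial>lborel) * indicator {0<..<t} s" for s
      using t by (cases "s \<in> {0<..<t}") (auto intro!: nn_integral_cong simp: indicator_def)
    have [measurable]: "(\<lambda>(s, y). ?V s y * indicator ({0..T} \<times> {0..L}) (s, y)) \<in> borel_measurable (lborel \<Otimes>\<^sub>M lborel)"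
      using energy_measurable by (simp add: case_prod_unfold)
    show "(\<lambda>s. (\<integral>\<^sup>+y. ennreal ((?H s y)\<^sup>2) * ?V s y * indicator {0..L} y \<partial>lborel) * indicator {0<..<t} s) \<in> borel_measurable lborel"
      unfolding eq by measurable
  qed
  finally have J: "(\<integral>\<^sup>+\<omega>. ennreal ((I \<omega>)\<^sup>2) \<partial>M) = ennreal (exp (- 2 * \<alpha> * t)) * ?J" .
  have e1: "ennreal (exp (2 * \<alpha> * t)) * ennreal (exp (- 2 * \<alpha> * t)) = 1"
    by (simp add: ennreal_mult[symmetric] exp_add[symmetric])
  have e2: "exp (2 * \<alpha> * t) * (\<sigma>\<^sub>1 * ?g + \<sigma>\<^sub>0)\<^sup>2 = (\<sigma>\<^sub>1 * image_mean bc L (\<beta> * t) x + exp (\<alpha> * t) * \<sigma>\<^sub>0)\<^sup>2"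
  proof -
    have "exp (2 * \<alpha> * t) = (exp (\<alpha> * t))\<^sup>2" by (simp add: power2_eq_square exp_add[symmetric])
    then have "exp (2 * \<alpha> * t) * (\<sigma>\<^sub>1 * ?g + \<sigma>\<^sub>0)\<^sup>2 = (\<sigma>\<^sub>1 * (exp (\<alpha> * t) * exp (- \<alpha> * t)) * image_mean bc L (\<beta> * t) x + exp (\<alpha> * t) * \<sigma>\<^sub>0)\<^sup>2"
      by (simp only: power_mult_distrib[symmetric] distrib_left mult_ac)
    also have "exp (\<alpha> * t) * exp (- \<alpha> * t) = 1" by (simp add: exp_add[symmetric])
    finally show ?thesis by simp
  qed
  have "energy M \<alpha> \<sigma> u t x = ennreal (exp (2 * \<alpha> * t)) * ennreal ((\<sigma>\<^sub>1 * ?g + \<sigma>\<^sub>0)\<^sup>2) +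
      (ennreal (exp (2 * \<alpha> * t)) * ennreal (exp (- 2 * \<alpha> * t))) * (ennreal (\<sigma>\<^sub>1\<^sup>2) * ?J)"
    unfolding energy_def main J by (simp only: distrib_left mult_ac)
  then show ?thesis unfolding e1 by (simp only: ennreal_mult'[symmetric] exp_ge_zero e2 mult_1_left)
qed

end

end

section \<open>Estimates for the image kernel\<close>

lemma suminf_image_weight_ge_1: "1 \<le> suminf image_weight"
proof -
  have "image_weight 0 = 1" by (simp add: image_weight_def int_decode_def sum_decode_def)
  then show ?thesis using sum_le_suminf[OF image_weight_summable, of "{0}"] by simp
qed

text \<open>Valid for every displacement, which covers points outside \<open>[0, L]\<close>. The
  weights sum to at least 1 because of the cell with index 0.\<close>

lemma heat_kernel_le_image_bound:
  assumes "0 < s"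
  shows "heat_kernel s z \<le> image_bound s"
proof -
  have "heat_kernel s z \<le> 1 / sqrt (2 * pi * s)"
    unfolding heat_kernel_def using assms by (intro divide_right_mono) auto
  also have "\<dots> \<le> (3 + 4 * s) / sqrt (2 * pi * s) * 1" using assms by (simp add: divide_right_mono)
  also have "\<dots> \<le> image_bound s"
    unfolding image_bound_def using assms suminf_image_weight_ge_1 by (intro mult_left_mono) auto
  finally show ?thesis .
qed

text \<open>Comparison with the kernel of the Volterra operator, so that a crude estimate of the
  energies can be iterated. The factor \<open>sqrt 2\<close> is the ratio of the peaks of the
  Gaussian kernels at times \<open>s\<close> and \<open>2 * s\<close>.\<close>

lemma image_bound_le_heat_kernel:
  assumes "0 < s" "s \<le> S"
  shows "image_bound s \<le> (3 + 4 * S) * suminf image_weight * sqrt 2 * heat_kernel (2 * s) 0"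
proof -
  have eq: "1 / sqrt (2 * pi * s) = sqrt 2 * heat_kernel (2 * s) 0"
    using assms by (simp add: heat_kernel_def real_sqrt_mult field_simps)
  have "image_bound s = (3 + 4 * s) * suminf image_weight * (1 / sqrt (2 * pi * s))"
    by (simp add: image_bound_def)
  also have "\<dots> \<le> (3 + 4 * S) * suminf image_weight * (1 / sqrt (2 * pi * s))"
    using assms suminf_image_weight_ge_1 by (intro mult_right_mono) auto
  finally show ?thesis unfolding eq by (simp add: mult.assoc)
qed

text \<open>The cancellation behind the whole estimate: \<open>image_bound s\<close> comes from the
  size of the kernels, \<open>sqrt s\<close> from the boundary layer, and the product stays bounded
  down to \<open>s = 0\<close>.\<close>

lemma image_bound_sqrt_le:
  assumes "0 < s" "s \<le> S"
  shows "image_bound s * sqrt s \<le> (3 + 4 * S) * suminf image_weight"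
proof -
  have "1 \<le> sqrt (2 * pi)" using pi_gt3 by simp
  then have "1 / sqrt (2 * pi) \<le> 1" by simp
  then have "(3 + 4 * s) * suminf image_weight * (1 / sqrt (2 * pi)) \<le> (3 + 4 * S) * suminf image_weight * 1"
    using assms suminf_image_weight_ge_1 by (intro mult_mono) auto
  then show ?thesis using assms unfolding image_bound_def by (simp add: real_sqrt_mult)
qed

context
  fixes bc :: boundary_condition and L s :: real
  assumes s: "0 < s" and L: "1 \<le> L"
begin

text \<open>The heat mass kept inside \<open>[0, L]\<close> and the images, which weigh at most the
  mass sent outside, add up to the total mass 1.\<close>

lemma nn_integral_abs_image_kernel_le_1:
  assumes x: "x \<in> {0..L}"
  shows "(\<integral>\<^sup>+y. ennreal \<bar>image_kernel bc L s x y\<bar> * indicator {0..L} y \<partial>lborel) \<le> 1"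
proof -
  have "(\<integral>\<^sup>+y. ennreal \<bar>image_kernel bc L s x y\<bar> * indicator {0..L} y \<partial>lborel) \<le>
    (\<integral>\<^sup>+y. ennreal (heat_kernel s (x - y)) * indicator {0..L} y + ennreal (image_rest bc L s x y) * indicator {0..L} y \<partial>lborel)"
  proof (rule nn_integral_mono)
    fix y
    show "ennreal \<bar>image_kernel bc L s x y\<bar> * indicator {0..L} y \<le>
      ennreal (heat_kernel s (x - y)) * indicator {0..L} y + ennreal (image_rest bc L s x y) * indicator {0..L} y"
    proof (cases "y \<in> {0..L}")
      case True
      have "\<bar>image_kernel bc L s x y\<bar> \<le> heat_kernel s (x - y) + image_rest bc L s x y"
      proof -
        have "\<bar>image_kernel bc L s x y - heat_kernel s (x - y)\<bar> \<le> image_rest bc L s x y"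
          using image_kernel_diff_le[OF s _ _ _ _ L, of x y bc] x True by auto
        moreover have "0 \<le> heat_kernel s (x - y)" using s by simp
        ultimately show ?thesis by linarith
      qed
      then have "ennreal \<bar>image_kernel bc L s x y\<bar> \<le> ennreal (heat_kernel s (x - y) + image_rest bc L s x y)"
        by (rule ennreal_leI)
      also have "\<dots> = ennreal (heat_kernel s (x - y)) + ennreal (image_rest bc L s x y)"
        using image_rest_nonneg[OF s _ _ _ _ L, of x y bc] x True s by (intro ennreal_plus) auto
      finally show ?thesis using True by simp
    qed simp
  qed
  also have "\<dots> = (\<integral>\<^sup>+y. ennreal (heat_kernel s (x - y)) * indicator {0..L} y \<partial>lborel)
      + (\<integral>\<^sup>+y. ennreal (image_rest bc L s x y) * indicator {0..L} y \<partial>lborel)"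
    by (rule nn_integral_add) measurable
  also have "\<dots> \<le> (\<integral>\<^sup>+y. ennreal (heat_kernel s (x - y)) * indicator {0..L} y \<partial>lborel) + outflow s L x"
    using image_rest_integral_le[OF s _ _ L] x by (intro add_left_mono) auto
  also have "\<dots> = 1" by (rule outflow_split[OF s])
  finally show ?thesis .
qed

text \<open>Supremum bound times L1 bound.\<close>

lemma nn_integral_image_kernel_square_le:
  assumes x: "x \<in> {0..L}"
  shows "(\<integral>\<^sup>+y. ennreal ((image_kernel bc L s x y)\<^sup>2) * indicator {0..L} y \<partial>lborel) \<le> ennreal (image_bound s)"
proof -
  have "(\<integral>\<^sup>+y. ennreal ((image_kernel bc L s x y)\<^sup>2) * indicator {0..L} y \<partial>lborel) \<le>
    (\<integral>\<^sup>+y. ennreal (image_bound s) * (ennreal \<bar>image_kernel bc L s x y\<bar> * indicator {0..L} y) \<partial>lborel)"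
  proof (rule nn_integral_mono)
    fix y
    show "ennreal ((image_kernel bc L s x y)\<^sup>2) * indicator {0..L} y \<le>
      ennreal (image_bound s) * (ennreal \<bar>image_kernel bc L s x y\<bar> * indicator {0..L} y)"
    proof (cases "y \<in> {0..L}")
      case True
      have "\<bar>image_kernel bc L s x y\<bar> \<le> image_bound s"
        using abs_image_kernel_le[OF s _ _ _ _ L, of x y bc] x True by auto
      then have "\<bar>image_kernel bc L s x y\<bar> * \<bar>image_kernel bc L s x y\<bar> \<le> image_bound s * \<bar>image_kernel bc L s x y\<bar>"
        by (rule mult_right_mono) simp
      then have "(image_kernel bc L s x y)\<^sup>2 \<le> image_bound s * \<bar>image_kernel bc L s x y\<bar>"
        by (simp add: power2_eq_square)
      then show ?thesis using True s by (simp add: ennreal_mult''[symmetric] ennreal_leI)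
    qed simp
  qed
  also have "\<dots> = ennreal (image_bound s) * (\<integral>\<^sup>+y. ennreal \<bar>image_kernel bc L s x y\<bar> * indicator {0..L} y \<partial>lborel)"
    by (rule nn_integral_cmult) measurable
  also have "\<dots> \<le> ennreal (image_bound s) * 1"
    by (intro mult_left_mono nn_integral_abs_image_kernel_le_1 x) auto
  finally show ?thesis by simp
qed

lemma image_kernel_integrable:
  assumes x: "x \<in> {0..L}"
  shows "set_integrable lborel {0..L} (image_kernel bc L s x)"
  unfolding set_integrable_def
proof (rule integrableI_bounded)
  have "(\<integral>\<^sup>+y. ennreal (norm (indicator {0..L} y *\<^sub>R image_kernel bc L s x y)) \<partial>lborel) =
    (\<integral>\<^sup>+y. ennreal \<bar>image_kernel bc L s x y\<bar> * indicator {0..L} y \<partial>lborel)"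
    by (intro nn_integral_cong) (simp add: indicator_def)
  also have "\<dots> < \<infinity>" using nn_integral_abs_image_kernel_le_1[OF x] by (rule le_less_trans) simp
  finally show "(\<integral>\<^sup>+y. ennreal (norm (indicator {0..L} y *\<^sub>R image_kernel bc L s x y)) \<partial>lborel) < \<infinity>" .
qed measurable

lemma abs_image_mean_le_1:
  assumes x: "x \<in> {0..L}"
  shows "\<bar>image_mean bc L s x\<bar> \<le> 1"
proof -
  have "ennreal (norm (image_mean bc L s x)) \<le> (\<integral>\<^sup>+y. ennreal (norm (indicator {0..L} y *\<^sub>R image_kernel bc L s x y)) \<partial>lborel)"
    unfolding image_mean_def set_lebesgue_integral_def
    using image_kernel_integrable[OF x] unfolding set_integrable_def by (rule integral_norm_bound_ennreal)
  also have "\<dots> = (\<integral>\<^sup>+y. ennreal \<bar>image_kernel bc L s x y\<bar> * indicator {0..L} y \<partial>lborel)"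
    by (intro nn_integral_cong) (simp add: indicator_def)
  also have "\<dots> \<le> 1" by (rule nn_integral_abs_image_kernel_le_1[OF x])
  finally show ?thesis by simp
qed

text \<open>The factor 2 has two sources, each at most the outflow: the mass that the heat kernel
  itself loses, and the integral of the image remainder.\<close>

lemma image_mean_diff_le:
  assumes x: "x \<in> {0..L}"
  shows "ennreal \<bar>image_mean bc L s x - 1\<bar> \<le> 2 * outflow s L x"
proof -
  let ?q = "\<lambda>y. heat_kernel s (x - y)"
  define o' where "o' = enn2real (outflow s L x)"
  have o': "outflow s L x = ennreal o'" "0 \<le> o'"
    using le_less_trans[OF outflow_le_1[OF s, of L x] ennreal_one_less_top] by (simp_all add: o'_def)
  have q: "set_integrable lborel {0..L} ?q"
    unfolding set_integrable_def
  proof (rule integrableI_bounded)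
    have "(\<integral>\<^sup>+y. ennreal (norm (indicator {0..L} y *\<^sub>R ?q y)) \<partial>lborel) = (\<integral>\<^sup>+y. ennreal (?q y) * indicator {0..L} y \<partial>lborel)"
      using s by (intro nn_integral_cong) (simp add: indicator_def)
    also have "\<dots> \<le> 1" using outflow_split[OF s, of x L] by (metis le_iff_add)
    finally show "(\<integral>\<^sup>+y. ennreal (norm (indicator {0..L} y *\<^sub>R ?q y)) \<partial>lborel) < \<infinity>" by (rule le_less_trans) simp
  qed measurable
  have q_eq: "(LINT y:{0..L}|lborel. ?q y) = 1 - o'"
  proof -
    have "ennreal (LINT y:{0..L}|lborel. ?q y) = (\<integral>\<^sup>+y. ennreal (indicator {0..L} y *\<^sub>R ?q y) \<partial>lborel)"
      using q s unfolding set_lebesgue_integral_def set_integrable_def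
      by (intro nn_integral_eq_integral[symmetric]) auto
    also have "\<dots> = (\<integral>\<^sup>+y. ennreal (?q y) * indicator {0..L} y \<partial>lborel)"
      by (intro nn_integral_cong) (simp add: indicator_def)
    finally have "ennreal (LINT y:{0..L}|lborel. ?q y) + ennreal o' = 1"
      using outflow_split[OF s, of x L] o' by simp
    moreover have "0 \<le> (LINT y:{0..L}|lborel. ?q y)"
      unfolding set_lebesgue_integral_def using s by (intro Bochner_Integration.integral_nonneg) auto
    ultimately have "ennreal ((LINT y:{0..L}|lborel. ?q y) + o') = ennreal 1" using o' by simp
    then show ?thesis using o' \<open>0 \<le> (LINT y:{0..L}|lborel. ?q y)\<close> by (subst (asm) ennreal_inj) auto
  qed
  have H: "set_integrable lborel {0..L} (\<lambda>y. image_kernel bc L s x y - ?q y)"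
    using image_kernel_integrable[OF x] q by (rule set_integral_diff(1))
  have d: "image_mean bc L s x - 1 = (LINT y:{0..L}|lborel. image_kernel bc L s x y - ?q y) - o'"
    unfolding image_mean_def using set_integral_diff(2)[OF image_kernel_integrable[OF x] q] q_eq by simp
  have "ennreal (norm (LINT y:{0..L}|lborel. image_kernel bc L s x y - ?q y)) \<le>
      (\<integral>\<^sup>+y. ennreal (norm (indicator {0..L} y *\<^sub>R (image_kernel bc L s x y - ?q y))) \<partial>lborel)"
    unfolding set_lebesgue_integral_def using H unfolding set_integrable_def by (rule integral_norm_bound_ennreal)
  also have "\<dots> \<le> (\<integral>\<^sup>+y. ennreal (image_rest bc L s x y) * indicator {0..L} y \<partial>lborel)"
    using image_kernel_diff_le[OF s _ _ _ _ L] x by (intro nn_integral_mono) (auto simp: indicator_def intro!: ennreal_leI)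
  also have "\<dots> \<le> ennreal o'" using image_rest_integral_le[OF s _ _ L, of x bc] x o' by auto
  finally have "\<bar>LINT y:{0..L}|lborel. image_kernel bc L s x y - ?q y\<bar> \<le> o'" using o' by simp
  moreover have "\<bar>a - o'\<bar> \<le> 2 * o'" if "\<bar>a\<bar> \<le> o'" for a using that by linarith
  ultimately have "\<bar>image_mean bc L s x - 1\<bar> \<le> 2 * o'" unfolding d by blast
  then show ?thesis unfolding o'(1) using o' ennreal_leI[of _ "2 * o'"] by (simp add: ennreal_mult)
qed

text \<open>The remainder is controlled when \<open>y\<close> is integrated first, whereas the
  spatial average of the energy equation integrates \<open>x\<close> first; Tonelli exchanges the
  order.\<close>

lemma image_rest_integral_swap:
  "(\<integral>\<^sup>+y. (\<integral>\<^sup>+x. ennreal (image_rest bc L s x y) * indicator {0..L} x \<partial>lborel) * indicator {0..L} y \<partial>lborel) \<le> ennreal (sqrt s)"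
proof -
  have "(\<integral>\<^sup>+y. (\<integral>\<^sup>+x. ennreal (image_rest bc L s x y) * indicator {0..L} x \<partial>lborel) * indicator {0..L} y \<partial>lborel) =
    (\<integral>\<^sup>+y. \<integral>\<^sup>+x. ennreal (image_rest bc L s x y) * indicator {0..L} x * indicator {0..L} y \<partial>lborel \<partial>lborel)"
    by (simp add: nn_integral_multc)
  also have "\<dots> = (\<integral>\<^sup>+x. \<integral>\<^sup>+y. ennreal (image_rest bc L s x y) * indicator {0..L} x * indicator {0..L} y \<partial>lborel \<partial>lborel)"
    by (rule lborel_pair.Fubini') measurable
  also have "\<dots> = (\<integral>\<^sup>+x. (\<integral>\<^sup>+y. ennreal (image_rest bc L s x y) * indicator {0..L} y \<partial>lborel) * indicator {0..L} x \<partial>lborel)"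
    by (intro nn_integral_cong, subst nn_integral_multc[symmetric]) (auto simp: mult_ac)
  also have "\<dots> \<le> (\<integral>\<^sup>+x. outflow s L x * indicator {0..L} x \<partial>lborel)"
    using image_rest_integral_le[OF s _ _ L] by (intro nn_integral_mono) (auto simp: indicator_def)
  also have "\<dots> \<le> ennreal (sqrt s)" by (rule outflow_integral_le[OF s])
  finally show ?thesis .
qed

text \<open>The squared kernel is replaced by the squared heat kernel plus the remainder, and the
  domain of the heat kernel is then enlarged to the whole line, where its integral is
  explicit.\<close>

lemma image_square_upper:
  assumes y: "y \<in> {0..L}"
  shows "(\<integral>\<^sup>+x. ennreal ((image_kernel bc L s x y)\<^sup>2) * indicator {0..L} x \<partial>lborel) \<le>
    ennreal (heat_kernel (2 * s) 0) + ennreal (2 * image_bound s) * (\<integral>\<^sup>+x. ennreal (image_rest bc L s x y) * indicator {0..L} x \<partial>lborel)"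
proof -
  have "(\<integral>\<^sup>+x. ennreal ((image_kernel bc L s x y)\<^sup>2) * indicator {0..L} x \<partial>lborel) \<le>
    (\<integral>\<^sup>+x. ennreal ((heat_kernel s (y - x))\<^sup>2) + ennreal (2 * image_bound s) * (ennreal (image_rest bc L s x y) * indicator {0..L} x) \<partial>lborel)"
  proof (rule nn_integral_mono)
    fix x
    show "ennreal ((image_kernel bc L s x y)\<^sup>2) * indicator {0..L} x \<le>
      ennreal ((heat_kernel s (y - x))\<^sup>2) + ennreal (2 * image_bound s) * (ennreal (image_rest bc L s x y) * indicator {0..L} x)"
    proof (cases "x \<in> {0..L}")
      case True
      then have "(image_kernel bc L s x y)\<^sup>2 \<le> (heat_kernel s (y - x))\<^sup>2 + 2 * image_bound s * image_rest bc L s x y"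
        using image_kernel_square_diff[OF s _ _ _ _ L, of x y bc] y by (simp add: heat_kernel_swap[of s y x] abs_le_iff)
      then have "ennreal ((image_kernel bc L s x y)\<^sup>2) \<le> ennreal ((heat_kernel s (y - x))\<^sup>2 + 2 * image_bound s * image_rest bc L s x y)"
        by (rule ennreal_leI)
      also have "\<dots> = ennreal ((heat_kernel s (y - x))\<^sup>2) + ennreal (2 * image_bound s) * ennreal (image_rest bc L s x y)"
        using image_rest_nonneg[OF s _ _ _ _ L, of x y bc] image_bound_nonneg[of s] s True y
        by (subst ennreal_plus) (auto simp: ennreal_mult'[symmetric])
      finally show ?thesis using True by simp
    qed simp
  qed
  also have "\<dots> = (\<integral>\<^sup>+x. ennreal ((heat_kernel s (y - x))\<^sup>2) \<partial>lborel) +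
      ennreal (2 * image_bound s) * (\<integral>\<^sup>+x. ennreal (image_rest bc L s x y) * indicator {0..L} x \<partial>lborel)"
    by (subst nn_integral_add) (auto simp: nn_integral_cmult)
  also have "(\<integral>\<^sup>+x. ennreal ((heat_kernel s (y - x))\<^sup>2) \<partial>lborel) = ennreal (heat_kernel (2 * s) 0)"
    using nn_integral_translate(2)[of "\<lambda>z. ennreal ((heat_kernel s z)\<^sup>2)" y] nn_integral_heat_kernel_square[OF s] by simp
  finally show ?thesis .
qed

text \<open>Here the explicit integral over the whole line must be cut back to
  \<open>[0, L]\<close>. Outside, the squared heat kernel is at most \<open>image_bound s\<close>
  times the heat kernel, which gives the additional outflow term.\<close>

lemma image_square_lower:
  assumes y: "y \<in> {0..L}"
  shows "ennreal (heat_kernel (2 * s) 0) \<le> (\<integral>\<^sup>+x. ennreal ((image_kernel bc L s x y)\<^sup>2) * indicator {0..L} x \<partial>lborel) +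
    ennreal (2 * image_bound s) * (\<integral>\<^sup>+x. ennreal (image_rest bc L s x y) * indicator {0..L} x \<partial>lborel) +
    ennreal (image_bound s) * outflow s L y"
proof -
  have "ennreal (heat_kernel (2 * s) 0) = (\<integral>\<^sup>+x. ennreal ((heat_kernel s (y - x))\<^sup>2) \<partial>lborel)"
    using nn_integral_translate(2)[of "\<lambda>z. ennreal ((heat_kernel s z)\<^sup>2)" y] nn_integral_heat_kernel_square[OF s] by simp
  also have "\<dots> \<le> (\<integral>\<^sup>+x. (ennreal ((image_kernel bc L s x y)\<^sup>2) * indicator {0..L} x
      + ennreal (2 * image_bound s) * (ennreal (image_rest bc L s x y) * indicator {0..L} x))
      + ennreal (image_bound s) * (ennreal (heat_kernel s (y - x)) * indicator (- {0..L}) x) \<partial>lborel)"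
  proof (rule nn_integral_mono)
    fix x
    show "ennreal ((heat_kernel s (y - x))\<^sup>2) \<le> (ennreal ((image_kernel bc L s x y)\<^sup>2) * indicator {0..L} x
      + ennreal (2 * image_bound s) * (ennreal (image_rest bc L s x y) * indicator {0..L} x))
      + ennreal (image_bound s) * (ennreal (heat_kernel s (y - x)) * indicator (- {0..L}) x)"
    proof (cases "x \<in> {0..L}")
      case True
      then have "(heat_kernel s (y - x))\<^sup>2 \<le> (image_kernel bc L s x y)\<^sup>2 + 2 * image_bound s * image_rest bc L s x y"
        using image_kernel_square_diff[OF s _ _ _ _ L, of x y bc] y by (simp add: heat_kernel_swap[of s y x] abs_le_iff)
      then have "ennreal ((heat_kernel s (y - x))\<^sup>2) \<le> ennreal ((image_kernel bc L s x y)\<^sup>2 + 2 * image_bound s * image_rest bc L s x y)"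
        by (rule ennreal_leI)
      also have "\<dots> = ennreal ((image_kernel bc L s x y)\<^sup>2) + ennreal (2 * image_bound s) * ennreal (image_rest bc L s x y)"
        using image_rest_nonneg[OF s _ _ _ _ L, of x y bc] image_bound_nonneg[of s] s True y
        by (subst ennreal_plus) (auto simp: ennreal_mult'[symmetric])
      finally show ?thesis using True by simp
    next
      case False
      have "(heat_kernel s (y - x))\<^sup>2 \<le> image_bound s * heat_kernel s (y - x)"
        using heat_kernel_le_image_bound[OF s, of "y - x"] s by (simp add: power2_eq_square mult_right_mono)
      then show ?thesis using False s by (simp add: ennreal_mult''[symmetric] ennreal_leI)
    qed
  qed
  also have "\<dots> = (\<integral>\<^sup>+x. ennreal ((image_kernel bc L s x y)\<^sup>2) * indicator {0..L} x \<partial>lborel) +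
    ennreal (2 * image_bound s) * (\<integral>\<^sup>+x. ennreal (image_rest bc L s x y) * indicator {0..L} x \<partial>lborel) +
    ennreal (image_bound s) * outflow s L y"
    unfolding outflow_def by (subst nn_integral_add, measurable, subst nn_integral_add) (auto simp: nn_integral_cmult)
  finally show ?thesis .
qed

end

section \<open>Spatial averages\<close>

lemma nn_integral_Ioo_le:
  fixes f :: "real \<Rightarrow> ennreal" and C :: real
  assumes "\<And>s. s \<in> {0<..<t} \<Longrightarrow> f s \<le> ennreal C" "0 \<le> t" "t \<le> T" "0 \<le> C"
  shows "(\<integral>\<^sup>+s. f s * indicator {0<..<t} s \<partial>lborel) \<le> ennreal (T * C)"
proof -
  have "(\<integral>\<^sup>+s. f s * indicator {0<..<t} s \<partial>lborel) \<le> (\<integral>\<^sup>+s. ennreal C * indicator {0<..<t} s \<partial>lborel)"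
    using assms(1) by (intro nn_integral_mono) (auto simp: indicator_def)
  also have "\<dots> = ennreal C * ennreal t" using assms by (subst nn_integral_cmult_indicator) auto
  also have "\<dots> \<le> ennreal (T * C)" using assms
    by (simp add: ennreal_mult'[symmetric] mult.commute mult_left_mono ennreal_leI)
  finally show ?thesis .
qed

text \<open>Second moments of a mild solution, abstracted to the closed equation that they satisfy.\<close>

locale energy_balance =
  fixes bc :: boundary_condition and \<alpha> \<beta> \<sigma>\<^sub>0 \<sigma>\<^sub>1 T L :: real and V :: "real \<Rightarrow> real \<Rightarrow> ennreal"
  assumes \<beta>: "0 < \<beta>" and T: "0 < T" and L: "1 \<le> L"
    and V_measurable: "(\<lambda>p. V (fst p) (snd p) * indicator ({0..T} \<times> {0..L}) p) \<in> borel_measurable (lborel \<Otimes>\<^sub>M lborel)"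
    and V_bounded: "\<exists>B. \<forall>t\<in>{0..T}. \<forall>x\<in>{0..L}. V t x \<le> ennreal B"
    and V_equation: "0 < t \<Longrightarrow> t \<le> T \<Longrightarrow> x \<in> {0..L} \<Longrightarrow>
      V t x = ennreal ((\<sigma>\<^sub>1 * image_mean bc L (\<beta> * t) x + exp (\<alpha> * t) * \<sigma>\<^sub>0)\<^sup>2) +
        ennreal (\<sigma>\<^sub>1\<^sup>2) * (\<integral>\<^sup>+s. (\<integral>\<^sup>+y. ennreal ((image_kernel bc L (\<beta> * (t - s)) x y)\<^sup>2) * V s y
          * indicator {0..L} y \<partial>lborel) * indicator {0<..<t} s \<partial>lborel)"
begin

text \<open>None of the following constants depends on \<open>L\<close>.\<close>

definition "kernel_bound = (3 + 4 * (\<beta> * T)) * suminf image_weight"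

definition "initial_bound = (\<bar>\<sigma>\<^sub>1\<bar> + exp (\<bar>\<alpha>\<bar> * T) * \<bar>\<sigma>\<^sub>0\<bar>)\<^sup>2"

definition "energy_bound = initial_bound * (2 * exp ((\<sigma>\<^sub>1\<^sup>2 * (kernel_bound * sqrt 2))\<^sup>2 * T / (4 * \<beta>)))"

lemma kernel_bound_pos: "0 < kernel_bound"
  unfolding kernel_bound_def using \<beta> T suminf_image_weight_ge_1 by (intro mult_pos_pos add_pos_pos) auto

lemma energy_bound_nonneg: "0 \<le> energy_bound"
  by (simp add: energy_bound_def initial_bound_def)

lemma exp_alpha_le: "0 < t \<Longrightarrow> t \<le> T \<Longrightarrow> exp (\<alpha> * t) \<le> exp (\<bar>\<alpha>\<bar> * T)"
  by (simp add: mult_mono)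

lemma V_section_measurable:
  assumes "s \<in> {0..T}"
  shows "(\<lambda>y. V s y * indicator {0..L} y) \<in> borel_measurable lborel"
proof -
  have "(\<lambda>y. V s y * indicator ({0..T} \<times> {0..L}) (s, y)) \<in> borel_measurable lborel"
    using measurable_compose[OF measurable_Pair1'[of s lborel lborel] V_measurable] by simp
  then show ?thesis using assms by (simp add: indicator_def)
qed

lemma initial_le:
  assumes t: "0 < t" "t \<le> T" and x: "x \<in> {0..L}"
  shows "(\<sigma>\<^sub>1 * image_mean bc L (\<beta> * t) x + exp (\<alpha> * t) * \<sigma>\<^sub>0)\<^sup>2 \<le> initial_bound"
proof -
  have s: "0 < \<beta> * t" using \<beta> t by simp
  have "\<bar>\<sigma>\<^sub>1 * image_mean bc L (\<beta> * t) x\<bar> \<le> \<bar>\<sigma>\<^sub>1\<bar> * 1"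
    unfolding abs_mult by (intro mult_left_mono abs_image_mean_le_1[OF s L x]) auto
  moreover have "\<bar>exp (\<alpha> * t) * \<sigma>\<^sub>0\<bar> \<le> exp (\<bar>\<alpha>\<bar> * T) * \<bar>\<sigma>\<^sub>0\<bar>"
    unfolding abs_mult abs_exp_cancel by (intro mult_right_mono exp_alpha_le t) auto
  ultimately have "\<bar>\<sigma>\<^sub>1 * image_mean bc L (\<beta> * t) x + exp (\<alpha> * t) * \<sigma>\<^sub>0\<bar> \<le> \<bar>\<sigma>\<^sub>1\<bar> + exp (\<bar>\<alpha>\<bar> * T) * \<bar>\<sigma>\<^sub>0\<bar>"
    using abs_triangle_ineq[of "\<sigma>\<^sub>1 * image_mean bc L (\<beta> * t) x" "exp (\<alpha> * t) * \<sigma>\<^sub>0"] by linarith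
  then show ?thesis unfolding initial_bound_def by (metis abs_ge_zero power2_abs power_mono)
qed

text \<open>\<open>volterra_upper\<close> is applied to the family of energies indexed by
  \<open>x \<in> {0..L}\<close>, with the integral of the squared kernel dominated by a multiple of
  the Volterra kernel. The bound \<open>B\<close>, possibly dependent on \<open>L\<close>,
  disappears, and \<open>energy_bound\<close> is the Neumann series of a constant source at the
  final time \<open>T\<close>.\<close>

lemma V_uniform:
  assumes t: "0 < t" "t \<le> T" and x: "x \<in> {0..L}"
  shows "V t x \<le> ennreal energy_bound"
proof -
  let ?c = "\<sigma>\<^sub>1\<^sup>2 * (kernel_bound * sqrt 2)"
  obtain B where B: "\<forall>t\<in>{0..T}. \<forall>x\<in>{0..L}. V t x \<le> ennreal B" using V_bounded by blast
  have c: "0 \<le> ?c" using kernel_bound_pos by simp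
  have "V t x \<le> (\<Sum>k. ennreal ?c ^ k * (volterra \<beta> ^^ k) (\<lambda>_. ennreal initial_bound) t)"
  proof (rule volterra_upper[where v = "\<lambda>x t. V t x" and I = "{0..L}" and B = B, OF \<beta> c _ _ _ x t])
    show "V t x \<le> ennreal initial_bound + ennreal ?c * volterra \<beta> \<phi> t"
      if \<phi>[measurable]: "\<phi> \<in> borel_measurable borel"
        and le: "\<And>y s. y \<in> {0..L} \<Longrightarrow> 0 < s \<Longrightarrow> s \<le> T \<Longrightarrow> V s y \<le> \<phi> s"
        and x: "x \<in> {0..L}" and t: "0 < t" "t \<le> T" for \<phi> x t
    proof -
      have "(\<integral>\<^sup>+s. (\<integral>\<^sup>+y. ennreal ((image_kernel bc L (\<beta> * (t - s)) x y)\<^sup>2) * V s y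
          * indicator {0..L} y \<partial>lborel) * indicator {0<..<t} s \<partial>lborel) \<le>
        (\<integral>\<^sup>+s. ennreal (kernel_bound * sqrt 2) * (ennreal (heat_kernel (2 * \<beta> * (t - s)) 0) * \<phi> s * indicator {0<..<t} s) \<partial>lborel)"
      proof (rule nn_integral_mono)
        fix s
        show "(\<integral>\<^sup>+y. ennreal ((image_kernel bc L (\<beta> * (t - s)) x y)\<^sup>2) * V s y * indicator {0..L} y \<partial>lborel) * indicator {0<..<t} s
          \<le> ennreal (kernel_bound * sqrt 2) * (ennreal (heat_kernel (2 * \<beta> * (t - s)) 0) * \<phi> s * indicator {0<..<t} s)"
        proof (cases "s \<in> {0<..<t}")
          case True
          have r: "0 < \<beta> * (t - s)" "\<beta> * (t - s) \<le> \<beta> * T" using True \<beta> t by auto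
          have "(\<integral>\<^sup>+y. ennreal ((image_kernel bc L (\<beta> * (t - s)) x y)\<^sup>2) * V s y * indicator {0..L} y \<partial>lborel) \<le>
            (\<integral>\<^sup>+y. \<phi> s * (ennreal ((image_kernel bc L (\<beta> * (t - s)) x y)\<^sup>2) * indicator {0..L} y) \<partial>lborel)"
            using le[of _ s] True t by (intro nn_integral_mono) (auto simp: indicator_def mult.commute[of "\<phi> s"] intro!: mult_left_mono)
          also have "\<dots> = \<phi> s * (\<integral>\<^sup>+y. ennreal ((image_kernel bc L (\<beta> * (t - s)) x y)\<^sup>2) * indicator {0..L} y \<partial>lborel)"
            by (rule nn_integral_cmult) measurable
          also have "\<dots> \<le> \<phi> s * ennreal (image_bound (\<beta> * (t - s)))"
            by (intro mult_left_mono nn_integral_image_kernel_square_le[OF r(1) L x]) simp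
          also have "\<dots> \<le> \<phi> s * ennreal (kernel_bound * sqrt 2 * heat_kernel (2 * (\<beta> * (t - s))) 0)"
            unfolding kernel_bound_def by (intro mult_left_mono ennreal_leI image_bound_le_heat_kernel[OF r]) simp
          also have "\<dots> = ennreal (kernel_bound * sqrt 2) * (ennreal (heat_kernel (2 * \<beta> * (t - s)) 0) * \<phi> s)"
            using kernel_bound_pos by (simp add: ennreal_mult' mult_ac)
          finally show ?thesis using True by simp
        qed simp
      qed
      also have "\<dots> = ennreal (kernel_bound * sqrt 2) * volterra \<beta> \<phi> t"
        unfolding volterra_def by (rule nn_integral_cmult) measurable
      finally have J: "(\<integral>\<^sup>+s. (\<integral>\<^sup>+y. ennreal ((image_kernel bc L (\<beta> * (t - s)) x y)\<^sup>2) * V s y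
          * indicator {0..L} y \<partial>lborel) * indicator {0<..<t} s \<partial>lborel) \<le> ennreal (kernel_bound * sqrt 2) * volterra \<beta> \<phi> t" .
      have "V t x \<le> ennreal initial_bound + ennreal (\<sigma>\<^sub>1\<^sup>2) * (ennreal (kernel_bound * sqrt 2) * volterra \<beta> \<phi> t)"
        unfolding V_equation[OF t x] by (intro add_mono mult_left_mono J ennreal_leI initial_le t x) auto
      then show ?thesis by (simp add: ennreal_mult' mult.assoc)
    qed
  qed (use B in auto)
  also have "\<dots> \<le> ennreal (initial_bound * (2 * exp (?c\<^sup>2 * t / (4 * \<beta>))))"
    by (rule volterra_series_const[OF \<beta> c _ t(1)]) (simp add: initial_bound_def)
  also have "\<dots> \<le> ennreal energy_bound"
    unfolding energy_bound_def using t \<beta> by (intro ennreal_leI mult_left_mono) (auto simp: initial_bound_def divide_right_mono mult_left_mono)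
  finally show ?thesis .
qed

text \<open>The indicator of the rectangle is kept inside because \<open>V\<close> is measurable
  only there; with it the function is measurable on the whole time axis.\<close>

definition mass :: "real \<Rightarrow> ennreal" where
  "mass s = (\<integral>\<^sup>+y. V s y * indicator ({0..T} \<times> {0..L}) (s, y) \<partial>lborel)"

lemma mass_measurable [measurable]: "mass \<in> borel_measurable borel"
proof -
  have [measurable]: "(\<lambda>(s, y). V s y * indicator ({0..T} \<times> {0..L}) (s, y)) \<in> borel_measurable (lborel \<Otimes>\<^sub>M lborel)"
    using V_measurable by (simp add: case_prod_unfold)
  have "mass \<in> borel_measurable lborel" unfolding mass_def by measurable
  then show ?thesis by simp
qed

lemma mass_eq: "s \<in> {0..T} \<Longrightarrow> mass s = (\<integral>\<^sup>+y. V s y * indicator {0..L} y \<partial>lborel)"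
  unfolding mass_def by (intro nn_integral_cong) (simp add: indicator_def)

text \<open>The contribution of time \<open>s\<close> to the spatial integral at time
  \<open>t\<close>, with the order of the space integrals exchanged so that the kernel is integrated
  over \<open>x\<close> first.\<close>

definition interaction :: "real \<Rightarrow> real \<Rightarrow> ennreal" where
  "interaction t s = (\<integral>\<^sup>+y. (\<integral>\<^sup>+x. ennreal ((image_kernel bc L (\<beta> * (t - s)) x y)\<^sup>2) * indicator {0..L} x \<partial>lborel)
      * (V s y * indicator {0..L} y) \<partial>lborel)"

text \<open>The energies in the error terms are bounded uniformly, and
  \<open>image_bound_sqrt_le\<close> makes the errors independent of the lag. Of the factor 3, two
  units come from the image remainder and one from the outflow in the lower estimate.\<close>

lemma interaction_bounds:
  assumes s: "0 < s" "s < t" and t: "t \<le> T"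
  shows "interaction t s \<le> ennreal (heat_kernel (2 * \<beta> * (t - s)) 0) * mass s + ennreal (3 * energy_bound * kernel_bound)"
    "ennreal (heat_kernel (2 * \<beta> * (t - s)) 0) * mass s \<le> interaction t s + ennreal (3 * energy_bound * kernel_bound)"
proof -
  let ?r = "\<beta> * (t - s)"
  have r: "0 < ?r" "?r \<le> \<beta> * T" using s t \<beta> by auto
  have sT: "s \<in> {0..T}" "s \<le> T" using s t by auto
  have [measurable]: "(\<lambda>y. V s y * indicator {0..L} y) \<in> borel_measurable lborel"
    by (rule V_section_measurable[OF sT(1)])
  let ?S = "\<lambda>y. \<integral>\<^sup>+x. ennreal ((image_kernel bc L ?r x y)\<^sup>2) * indicator {0..L} x \<partial>lborel"
  let ?R = "\<lambda>y. \<integral>\<^sup>+x. ennreal (image_rest bc L ?r x y) * indicator {0..L} x \<partial>lborel"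
  let ?h = "ennreal (heat_kernel (2 * ?r) 0)"
  let ?v = "\<lambda>y. V s y * indicator {0..L} y"
  have v: "?v y \<le> ennreal energy_bound * indicator {0..L} y" for y
    using V_uniform[OF s(1) sT(2)] by (simp add: indicator_def)
  have b: "0 \<le> image_bound ?r" using r by (intro image_bound_nonneg) auto
  have br: "image_bound ?r * sqrt ?r \<le> kernel_bound" unfolding kernel_bound_def by (rule image_bound_sqrt_le[OF r])
  have Rv: "(\<integral>\<^sup>+y. ennreal (2 * image_bound ?r) * ?R y * ?v y \<partial>lborel) \<le> ennreal (2 * energy_bound * kernel_bound)"
  proof -
    have "(\<integral>\<^sup>+y. ennreal (2 * image_bound ?r) * ?R y * ?v y \<partial>lborel) \<le>
      (\<integral>\<^sup>+y. ennreal (2 * image_bound ?r) * ennreal energy_bound * (?R y * indicator {0..L} y) \<partial>lborel)"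
    proof (rule nn_integral_mono)
      fix y
      have "ennreal (2 * image_bound ?r) * ?R y * ?v y \<le> ennreal (2 * image_bound ?r) * ?R y * (ennreal energy_bound * indicator {0..L} y)"
        by (intro mult_left_mono v) simp
      then show "ennreal (2 * image_bound ?r) * ?R y * ?v y \<le> ennreal (2 * image_bound ?r) * ennreal energy_bound * (?R y * indicator {0..L} y)"
        by (simp only: mult_ac)
    qed
    also have "\<dots> = ennreal (2 * image_bound ?r) * ennreal energy_bound * (\<integral>\<^sup>+y. ?R y * indicator {0..L} y \<partial>lborel)"
      by (rule nn_integral_cmult) measurable
    also have "\<dots> \<le> ennreal (2 * image_bound ?r) * ennreal energy_bound * ennreal (sqrt ?r)"
      by (intro mult_left_mono image_rest_integral_swap[OF r(1) L]) simp
    also have "\<dots> = ennreal (2 * image_bound ?r * energy_bound * sqrt ?r)"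
      using b energy_bound_nonneg r by (simp add: ennreal_mult'[symmetric] ennreal_mult''[symmetric])
    also have "2 * image_bound ?r * energy_bound * sqrt ?r = 2 * energy_bound * (image_bound ?r * sqrt ?r)" by simp
    also have "ennreal \<dots> \<le> ennreal (2 * energy_bound * kernel_bound)"
      using br energy_bound_nonneg by (intro ennreal_leI mult_left_mono) auto
    finally show ?thesis .
  qed
  have Ov: "(\<integral>\<^sup>+y. ennreal (image_bound ?r) * outflow ?r L y * ?v y \<partial>lborel) \<le> ennreal (energy_bound * kernel_bound)"
  proof -
    have "(\<integral>\<^sup>+y. ennreal (image_bound ?r) * outflow ?r L y * ?v y \<partial>lborel) \<le>
      (\<integral>\<^sup>+y. ennreal (image_bound ?r) * ennreal energy_bound * (outflow ?r L y * indicator {0..L} y) \<partial>lborel)"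
    proof (rule nn_integral_mono)
      fix y
      have "ennreal (image_bound ?r) * outflow ?r L y * ?v y \<le> ennreal (image_bound ?r) * outflow ?r L y * (ennreal energy_bound * indicator {0..L} y)"
        by (intro mult_left_mono v) simp
      then show "ennreal (image_bound ?r) * outflow ?r L y * ?v y \<le> ennreal (image_bound ?r) * ennreal energy_bound * (outflow ?r L y * indicator {0..L} y)"
        by (simp only: mult_ac)
    qed
    also have "\<dots> = ennreal (image_bound ?r) * ennreal energy_bound * (\<integral>\<^sup>+y. outflow ?r L y * indicator {0..L} y \<partial>lborel)"
      by (rule nn_integral_cmult) (simp add: outflow_def)
    also have "\<dots> \<le> ennreal (image_bound ?r) * ennreal energy_bound * ennreal (sqrt ?r)"
      by (intro mult_left_mono outflow_integral_le[OF r(1)]) simp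
    also have "\<dots> = ennreal (energy_bound * (image_bound ?r * sqrt ?r))"
      using b energy_bound_nonneg r by (simp add: ennreal_mult'[symmetric] ennreal_mult''[symmetric] mult_ac)
    also have "\<dots> \<le> ennreal (energy_bound * kernel_bound)"
      using br energy_bound_nonneg by (intro ennreal_leI mult_left_mono) auto
    finally show ?thesis .
  qed
  have mass: "(\<integral>\<^sup>+y. ?h * ?v y \<partial>lborel) = ?h * mass s"
    unfolding mass_eq[OF sT(1)] by (rule nn_integral_cmult) measurable
  have h: "2 * ?r = 2 * \<beta> * (t - s)" by simp
  have "interaction t s \<le> (\<integral>\<^sup>+y. ?h * ?v y + ennreal (2 * image_bound ?r) * ?R y * ?v y \<partial>lborel)"
    unfolding interaction_def
  proof (rule nn_integral_mono)
    fix y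
    show "?S y * ?v y \<le> ?h * ?v y + ennreal (2 * image_bound ?r) * ?R y * ?v y"
      using mult_right_mono[OF image_square_upper[OF r(1) L, of y bc], of "?v y"]
      by (cases "y \<in> {0..L}") (simp_all add: distrib_right)
  qed
  also have "\<dots> = (\<integral>\<^sup>+y. ?h * ?v y \<partial>lborel) + (\<integral>\<^sup>+y. ennreal (2 * image_bound ?r) * ?R y * ?v y \<partial>lborel)"
    by (rule nn_integral_add) measurable
  \<comment> \<open>The upper estimate needs only the factor 2; it is enlarged to 3 so that both
    directions share one error constant.\<close>
  also have "\<dots> \<le> ?h * mass s + ennreal (3 * energy_bound * kernel_bound)"
    unfolding mass
  proof (rule add_left_mono, rule order_trans[OF Rv], rule ennreal_leI)
    show "2 * energy_bound * kernel_bound \<le> 3 * energy_bound * kernel_bound" using energy_bound_nonneg kernel_bound_pos by (intro mult_right_mono) auto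
  qed
  finally show "interaction t s \<le> ennreal (heat_kernel (2 * \<beta> * (t - s)) 0) * mass s + ennreal (3 * energy_bound * kernel_bound)"
    unfolding h .
  have "?h * mass s \<le> (\<integral>\<^sup>+y. (?S y * ?v y + ennreal (2 * image_bound ?r) * ?R y * ?v y)
      + ennreal (image_bound ?r) * outflow ?r L y * ?v y \<partial>lborel)"
    unfolding mass[symmetric]
  proof (rule nn_integral_mono)
    fix y
    show "?h * ?v y \<le> (?S y * ?v y + ennreal (2 * image_bound ?r) * ?R y * ?v y) + ennreal (image_bound ?r) * outflow ?r L y * ?v y"
      using mult_right_mono[OF image_square_lower[OF r(1) L, of y bc], of "?v y"]
      by (cases "y \<in> {0..L}") (simp_all add: distrib_right)
  qed
  also have "\<dots> = (\<integral>\<^sup>+y. ?S y * ?v y \<partial>lborel) + (\<integral>\<^sup>+y. ennreal (2 * image_bound ?r) * ?R y * ?v y \<partial>lborel)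
      + (\<integral>\<^sup>+y. ennreal (image_bound ?r) * outflow ?r L y * ?v y \<partial>lborel)"
    by (subst nn_integral_add, measurable, subst nn_integral_add) auto
  also have "\<dots> \<le> interaction t s + ennreal (2 * energy_bound * kernel_bound) + ennreal (energy_bound * kernel_bound)"
    unfolding interaction_def by (intro add_mono Rv Ov order_refl)
  also have "\<dots> = interaction t s + ennreal (3 * energy_bound * kernel_bound)"
    using energy_bound_nonneg kernel_bound_pos by (simp add: add.assoc ennreal_plus[symmetric] mult_nonneg_nonneg del: ennreal_plus)
  finally show "ennreal (heat_kernel (2 * \<beta> * (t - s)) 0) * mass s \<le> interaction t s + ennreal (3 * energy_bound * kernel_bound)"
    unfolding h .
qed

end

section \<open>The spatial integral as an approximate solution of the scalar equation\<close>

context energy_balance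
begin

definition "amplitude = \<bar>\<sigma>\<^sub>1\<bar> + exp (\<bar>\<alpha>\<bar> * T) * \<bar>\<sigma>\<^sub>0\<bar>"

text \<open>The first summand is the boundary error of the initial term, the second the interaction
  error integrated over a time span of at most \<open>T\<close>.\<close>

definition "mass_error = 4 * amplitude * \<bar>\<sigma>\<^sub>1\<bar> * sqrt (\<beta> * T) + \<sigma>\<^sub>1\<^sup>2 * (T * (3 * energy_bound * kernel_bound))"

lemma amplitude_nonneg: "0 \<le> amplitude"
  by (simp add: amplitude_def)

lemma mass_error_nonneg: "0 \<le> mass_error"
  unfolding mass_error_def using \<beta> T energy_bound_nonneg kernel_bound_pos amplitude_nonneg by auto

text \<open>Tonelli moves the integral over \<open>x\<close> inside those over \<open>s\<close> and
  \<open>y\<close>. The energies are first multiplied by the indicator of the rectangle, which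
  changes no value in range and makes the integrand jointly measurable.\<close>

lemma mass_equation:
  assumes t: "0 < t" "t \<le> T"
  shows "mass t = (\<integral>\<^sup>+x. ennreal ((\<sigma>\<^sub>1 * image_mean bc L (\<beta> * t) x + exp (\<alpha> * t) * \<sigma>\<^sub>0)\<^sup>2) * indicator {0..L} x \<partial>lborel) +
    ennreal (\<sigma>\<^sub>1\<^sup>2) * (\<integral>\<^sup>+s. interaction t s * indicator {0<..<t} s \<partial>lborel)"
proof -
  let ?H = "\<lambda>s x y. ennreal ((image_kernel bc L (\<beta> * (t - s)) x y)\<^sup>2)"
  let ?V = "\<lambda>s y. V s y * indicator ({0..T} \<times> {0..L}) (s, y)"
  let ?f = "\<lambda>x s y. ?H s x y * ?V s y * indicator {0<..<t} s * indicator {0..L} x"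
  have [measurable]: "(\<lambda>(s, y). ?V s y) \<in> borel_measurable (lborel \<Otimes>\<^sub>M lborel)"
    using V_measurable by (simp add: case_prod_unfold)
  have [measurable]: "?V s \<in> borel_measurable lborel" for s by measurable
  have J: "(\<integral>\<^sup>+s. (\<integral>\<^sup>+y. ?H s x y * V s y * indicator {0..L} y \<partial>lborel) * indicator {0<..<t} s \<partial>lborel) * indicator {0..L} x
    = (\<integral>\<^sup>+s. \<integral>\<^sup>+y. ?f x s y \<partial>lborel \<partial>lborel)" for x
  proof -
    have "(\<integral>\<^sup>+s. \<integral>\<^sup>+y. ?f x s y \<partial>lborel \<partial>lborel) =
      (\<integral>\<^sup>+s. (\<integral>\<^sup>+y. ?H s x y * ?V s y \<partial>lborel) * indicator {0<..<t} s * indicator {0..L} x \<partial>lborel)"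
      by (intro nn_integral_cong) (simp add: nn_integral_multc)
    also have "\<dots> = (\<integral>\<^sup>+s. (\<integral>\<^sup>+y. ?H s x y * ?V s y \<partial>lborel) * indicator {0<..<t} s \<partial>lborel) * indicator {0..L} x"
      by (rule nn_integral_multc) measurable
    also have "(\<integral>\<^sup>+s. (\<integral>\<^sup>+y. ?H s x y * ?V s y \<partial>lborel) * indicator {0<..<t} s \<partial>lborel) =
      (\<integral>\<^sup>+s. (\<integral>\<^sup>+y. ?H s x y * V s y * indicator {0..L} y \<partial>lborel) * indicator {0<..<t} s \<partial>lborel)"
    proof (intro nn_integral_cong)
      fix s
      show "(\<integral>\<^sup>+y. ?H s x y * ?V s y \<partial>lborel) * indicator {0<..<t} s =
        (\<integral>\<^sup>+y. ?H s x y * V s y * indicator {0..L} y \<partial>lborel) * indicator {0<..<t} s"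
        using t by (cases "s \<in> {0<..<t}") (auto intro!: nn_integral_cong simp: indicator_def)
    qed
    finally show ?thesis by simp
  qed
  have "(\<integral>\<^sup>+x. \<integral>\<^sup>+s. \<integral>\<^sup>+y. ?f x s y \<partial>lborel \<partial>lborel \<partial>lborel) = (\<integral>\<^sup>+s. \<integral>\<^sup>+x. \<integral>\<^sup>+y. ?f x s y \<partial>lborel \<partial>lborel \<partial>lborel)"
    by (rule lborel_pair.Fubini') measurable
  also have "\<dots> = (\<integral>\<^sup>+s. \<integral>\<^sup>+y. \<integral>\<^sup>+x. ?f x s y \<partial>lborel \<partial>lborel \<partial>lborel)"
    by (intro nn_integral_cong lborel_pair.Fubini') measurable
  also have "\<dots> = (\<integral>\<^sup>+s. interaction t s * indicator {0<..<t} s \<partial>lborel)"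
  proof (rule nn_integral_cong)
    fix s
    show "(\<integral>\<^sup>+y. \<integral>\<^sup>+x. ?f x s y \<partial>lborel \<partial>lborel) = interaction t s * indicator {0<..<t} s"
    proof (cases "s \<in> {0<..<t}")
      case True
      then have "interaction t s = (\<integral>\<^sup>+y. (\<integral>\<^sup>+x. ?H s x y * indicator {0..L} x \<partial>lborel) * ?V s y \<partial>lborel)"
        unfolding interaction_def using t by (intro nn_integral_cong) (auto simp: indicator_def)
      also have "\<dots> = (\<integral>\<^sup>+y. \<integral>\<^sup>+x. ?f x s y \<partial>lborel \<partial>lborel)"
      proof (rule nn_integral_cong)
        fix y
        have "(\<integral>\<^sup>+x. ?H s x y * indicator {0..L} x \<partial>lborel) * ?V s y = (\<integral>\<^sup>+x. ?H s x y * indicator {0..L} x * ?V s y \<partial>lborel)"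
          by (rule nn_integral_multc[symmetric]) measurable
        also have "\<dots> = (\<integral>\<^sup>+x. ?f x s y \<partial>lborel)"
          using True by (intro nn_integral_cong) (simp add: mult_ac)
        finally show "(\<integral>\<^sup>+x. ?H s x y * indicator {0..L} x \<partial>lborel) * ?V s y = (\<integral>\<^sup>+x. ?f x s y \<partial>lborel)" .
      qed
      finally show ?thesis using True by simp
    qed simp
  qed
  finally have F: "(\<integral>\<^sup>+x. \<integral>\<^sup>+s. \<integral>\<^sup>+y. ?f x s y \<partial>lborel \<partial>lborel \<partial>lborel) = (\<integral>\<^sup>+s. interaction t s * indicator {0<..<t} s \<partial>lborel)" .
  have "mass t = (\<integral>\<^sup>+x. V t x * indicator {0..L} x \<partial>lborel)"
    using t by (intro mass_eq) auto
  also have "\<dots> = (\<integral>\<^sup>+x. ennreal ((\<sigma>\<^sub>1 * image_mean bc L (\<beta> * t) x + exp (\<alpha> * t) * \<sigma>\<^sub>0)\<^sup>2) * indicator {0..L} x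
      + ennreal (\<sigma>\<^sub>1\<^sup>2) * (\<integral>\<^sup>+s. \<integral>\<^sup>+y. ?f x s y \<partial>lborel \<partial>lborel) \<partial>lborel)"
    unfolding J[symmetric]
  proof (rule nn_integral_cong)
    fix x
    show "V t x * indicator {0..L} x = ennreal ((\<sigma>\<^sub>1 * image_mean bc L (\<beta> * t) x + exp (\<alpha> * t) * \<sigma>\<^sub>0)\<^sup>2) * indicator {0..L} x
      + ennreal (\<sigma>\<^sub>1\<^sup>2) * ((\<integral>\<^sup>+s. (\<integral>\<^sup>+y. ?H s x y * V s y * indicator {0..L} y \<partial>lborel) * indicator {0<..<t} s \<partial>lborel) * indicator {0..L} x)"
      using V_equation[OF t, of x] by (cases "x \<in> {0..L}") auto
  qed
  also have "\<dots> = (\<integral>\<^sup>+x. ennreal ((\<sigma>\<^sub>1 * image_mean bc L (\<beta> * t) x + exp (\<alpha> * t) * \<sigma>\<^sub>0)\<^sup>2) * indicator {0..L} x \<partial>lborel)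
      + ennreal (\<sigma>\<^sub>1\<^sup>2) * (\<integral>\<^sup>+x. \<integral>\<^sup>+s. \<integral>\<^sup>+y. ?f x s y \<partial>lborel \<partial>lborel \<partial>lborel)"
    by (subst nn_integral_add, measurable, subst nn_integral_cmult, measurable)
  finally show ?thesis unfolding F .
qed

text \<open>A difference of squares: the sum of the two bases is at most
  \<open>2 * amplitude\<close>, and their difference is \<open>\<sigma>\<^sub>1\<close> times the
  deviation of \<open>image_mean\<close> from 1, at most twice the outflow. This gives the factor 4,
  and the outflow integrates to at most \<open>sqrt (\<beta> * T)\<close>.\<close>

lemma initial_mass_bounds:
  assumes t: "0 < t" "t \<le> T"
  defines "P \<equiv> \<integral>\<^sup>+x. ennreal ((\<sigma>\<^sub>1 * image_mean bc L (\<beta> * t) x + exp (\<alpha> * t) * \<sigma>\<^sub>0)\<^sup>2) * indicator {0..L} x \<partial>lborel"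
  shows "P \<le> ennreal L * ennreal (initial_energy \<alpha> \<sigma>\<^sub>1 \<sigma>\<^sub>0 t) + ennreal (4 * amplitude * \<bar>\<sigma>\<^sub>1\<bar> * sqrt (\<beta> * T))"
    "ennreal L * ennreal (initial_energy \<alpha> \<sigma>\<^sub>1 \<sigma>\<^sub>0 t) \<le> P + ennreal (4 * amplitude * \<bar>\<sigma>\<^sub>1\<bar> * sqrt (\<beta> * T))"
proof -
  let ?s = "\<beta> * t"
  let ?a = "\<lambda>x. (\<sigma>\<^sub>1 * image_mean bc L ?s x + exp (\<alpha> * t) * \<sigma>\<^sub>0)\<^sup>2"
  let ?b = "initial_energy \<alpha> \<sigma>\<^sub>1 \<sigma>\<^sub>0 t"
  let ?k = "4 * amplitude * \<bar>\<sigma>\<^sub>1\<bar>"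
  have s: "0 < ?s" using \<beta> t by simp
  have diff: "ennreal \<bar>?a x - ?b\<bar> \<le> ennreal ?k * outflow ?s L x" if x: "x \<in> {0..L}" for x
  proof -
    let ?m = "image_mean bc L ?s x"
    have m: "\<bar>?m\<bar> \<le> 1" by (rule abs_image_mean_le_1[OF s L x])
    have e: "\<bar>exp (\<alpha> * t) * \<sigma>\<^sub>0\<bar> \<le> exp (\<bar>\<alpha>\<bar> * T) * \<bar>\<sigma>\<^sub>0\<bar>"
      unfolding abs_mult abs_exp_cancel by (intro mult_right_mono exp_alpha_le t) auto
    have sm: "\<bar>\<sigma>\<^sub>1 * (?m + 1)\<bar> \<le> \<bar>\<sigma>\<^sub>1\<bar> * 2"
      unfolding abs_mult using m by (intro mult_left_mono) auto
    have "\<bar>\<sigma>\<^sub>1 * (?m + 1) + 2 * (exp (\<alpha> * t) * \<sigma>\<^sub>0)\<bar> \<le> 2 * amplitude"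
    proof -
      have "\<bar>a + 2 * b\<bar> \<le> 2 * (p + q)" if "\<bar>a\<bar> \<le> p * 2" "\<bar>b\<bar> \<le> q" for a b p q :: real
        using abs_triangle_ineq[of a "2 * b"] that by (simp add: abs_mult)
      from this[OF sm e] show ?thesis unfolding amplitude_def .
    qed
    then have "\<bar>\<sigma>\<^sub>1 * (?m + 1) + 2 * (exp (\<alpha> * t) * \<sigma>\<^sub>0)\<bar> * (\<bar>\<sigma>\<^sub>1\<bar> * \<bar>?m - 1\<bar>) \<le> 2 * amplitude * (\<bar>\<sigma>\<^sub>1\<bar> * \<bar>?m - 1\<bar>)"
      by (intro mult_right_mono) auto
    moreover have "?a x - ?b = (\<sigma>\<^sub>1 * (?m + 1) + 2 * (exp (\<alpha> * t) * \<sigma>\<^sub>0)) * (\<sigma>\<^sub>1 * (?m - 1))"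
      unfolding initial_energy_def by (simp add: power2_eq_square algebra_simps)
    ultimately have "\<bar>?a x - ?b\<bar> \<le> 2 * amplitude * \<bar>\<sigma>\<^sub>1\<bar> * \<bar>?m - 1\<bar>"
      by (simp add: abs_mult mult.assoc)
    then have "ennreal \<bar>?a x - ?b\<bar> \<le> ennreal (2 * amplitude * \<bar>\<sigma>\<^sub>1\<bar> * \<bar>?m - 1\<bar>)" by (rule ennreal_leI)
    also have "\<dots> = ennreal (2 * amplitude * \<bar>\<sigma>\<^sub>1\<bar>) * ennreal \<bar>?m - 1\<bar>"
      using amplitude_nonneg by (intro ennreal_mult) auto
    also have "\<dots> \<le> ennreal (2 * amplitude * \<bar>\<sigma>\<^sub>1\<bar>) * (ennreal 2 * outflow ?s L x)"
      using image_mean_diff_le[OF s L x, of bc] by (intro mult_left_mono) auto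
    also have "\<dots> = ennreal (2 * amplitude * \<bar>\<sigma>\<^sub>1\<bar> * 2) * outflow ?s L x"
      unfolding mult.assoc[symmetric] using amplitude_nonneg by (subst ennreal_mult) auto
    finally show ?thesis by (simp add: mult_ac)
  qed
  have k: "0 \<le> ?k" using amplitude_nonneg by simp
  have O: "(\<integral>\<^sup>+x. ennreal ?k * (outflow ?s L x * indicator {0..L} x) \<partial>lborel) \<le> ennreal (?k * sqrt (\<beta> * T))"
  proof -
    have "(\<integral>\<^sup>+x. ennreal ?k * (outflow ?s L x * indicator {0..L} x) \<partial>lborel) =
      ennreal ?k * (\<integral>\<^sup>+x. outflow ?s L x * indicator {0..L} x \<partial>lborel)"
      by (rule nn_integral_cmult) measurable
    also have "\<dots> \<le> ennreal ?k * ennreal (sqrt ?s)" by (intro mult_left_mono outflow_integral_le[OF s]) simp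
    also have "\<dots> \<le> ennreal ?k * ennreal (sqrt (\<beta> * T))"
      using t \<beta> by (intro mult_left_mono ennreal_leI) auto
    also have "\<dots> = ennreal (?k * sqrt (\<beta> * T))" by (rule ennreal_mult'[OF k, symmetric])
    finally show ?thesis .
  qed
  have Lb: "ennreal L * ennreal ?b = (\<integral>\<^sup>+x. ennreal ?b * indicator {0..L} x \<partial>lborel)"
    using L by (subst nn_integral_cmult_indicator) (auto simp: mult.commute)
  have "P \<le> (\<integral>\<^sup>+x. ennreal ?b * indicator {0..L} x + ennreal ?k * (outflow ?s L x * indicator {0..L} x) \<partial>lborel)"
    unfolding P_def
  proof (rule nn_integral_mono)
    fix x
    show "ennreal (?a x) * indicator {0..L} x \<le> ennreal ?b * indicator {0..L} x + ennreal ?k * (outflow ?s L x * indicator {0..L} x)"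
    proof (cases "x \<in> {0..L}")
      case True
      have "ennreal (?a x) \<le> ennreal (?b + \<bar>?a x - ?b\<bar>)" by (intro ennreal_leI) simp
      also have "\<dots> = ennreal ?b + ennreal \<bar>?a x - ?b\<bar>" by (rule ennreal_plus) auto
      also have "\<dots> \<le> ennreal ?b + ennreal ?k * outflow ?s L x" by (intro add_left_mono diff True)
      finally show ?thesis using True by simp
    qed simp
  qed
  also have "\<dots> = (\<integral>\<^sup>+x. ennreal ?b * indicator {0..L} x \<partial>lborel) + (\<integral>\<^sup>+x. ennreal ?k * (outflow ?s L x * indicator {0..L} x) \<partial>lborel)"
    by (rule nn_integral_add) measurable
  finally show "P \<le> ennreal L * ennreal ?b + ennreal (?k * sqrt (\<beta> * T))"
    unfolding Lb using O by (auto intro: order_trans add_left_mono)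
  have "ennreal L * ennreal ?b \<le> (\<integral>\<^sup>+x. ennreal (?a x) * indicator {0..L} x + ennreal ?k * (outflow ?s L x * indicator {0..L} x) \<partial>lborel)"
    unfolding Lb
  proof (rule nn_integral_mono)
    fix x
    show "ennreal ?b * indicator {0..L} x \<le> ennreal (?a x) * indicator {0..L} x + ennreal ?k * (outflow ?s L x * indicator {0..L} x)"
    proof (cases "x \<in> {0..L}")
      case True
      have "ennreal ?b \<le> ennreal (?a x + \<bar>?a x - ?b\<bar>)" by (intro ennreal_leI) simp
      also have "\<dots> = ennreal (?a x) + ennreal \<bar>?a x - ?b\<bar>" by (rule ennreal_plus) auto
      also have "\<dots> \<le> ennreal (?a x) + ennreal ?k * outflow ?s L x" by (intro add_left_mono diff True)
      finally show ?thesis using True by simp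
    qed simp
  qed
  also have "\<dots> = P + (\<integral>\<^sup>+x. ennreal ?k * (outflow ?s L x * indicator {0..L} x) \<partial>lborel)"
    unfolding P_def by (rule nn_integral_add) measurable
  finally show "ennreal L * ennreal ?b \<le> P + ennreal (?k * sqrt (\<beta> * T))"
    using O by (auto intro: order_trans add_left_mono)
qed

lemma interaction_measurable:
  "(\<lambda>s. interaction t s * indicator {0<..<t} s) \<in> borel_measurable lborel" if "t \<le> T"
proof -
  let ?V = "\<lambda>s y. V s y * indicator ({0..T} \<times> {0..L}) (s, y)"
  have [measurable]: "(\<lambda>(s, y). ?V s y) \<in> borel_measurable (lborel \<Otimes>\<^sub>M lborel)"
    using V_measurable by (simp add: case_prod_unfold)
  have "interaction t s * indicator {0<..<t} s = (\<integral>\<^sup>+y. (\<integral>\<^sup>+x. ennreal ((image_kernel bc L (\<beta> * (t - s)) x y)\<^sup>2)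
      * indicator {0..L} x \<partial>lborel) * ?V s y \<partial>lborel) * indicator {0<..<t} s" for s
    unfolding interaction_def using that
    by (cases "s \<in> {0<..<t}") (auto intro!: nn_integral_cong simp: indicator_def)
  then show ?thesis by simp
qed

text \<open>The interaction error does not depend on \<open>s\<close>, so integrating over
  \<open>0 < s < t\<close> costs at most a factor \<open>T\<close>; the initial error is added to
  it.\<close>

lemma mass_volterra:
  assumes t: "0 < t" "t \<le> T"
  shows "mass t \<le> (ennreal L * ennreal (initial_energy \<alpha> \<sigma>\<^sub>1 \<sigma>\<^sub>0 t) + ennreal mass_error) + ennreal (\<sigma>\<^sub>1\<^sup>2) * volterra \<beta> mass t"
    "ennreal L * ennreal (initial_energy \<alpha> \<sigma>\<^sub>1 \<sigma>\<^sub>0 t) + ennreal (\<sigma>\<^sub>1\<^sup>2) * volterra \<beta> mass t \<le> mass t + ennreal mass_error"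
proof -
  let ?i = "\<lambda>s. indicator {0<..<t} s :: ennreal"
  let ?h = "\<lambda>s. ennreal (heat_kernel (2 * \<beta> * (t - s)) 0) * mass s"
  let ?e = "3 * energy_bound * kernel_bound"
  let ?J = "\<integral>\<^sup>+s. interaction t s * ?i s \<partial>lborel"
  note [measurable] = interaction_measurable[OF t(2)]
  have e: "(\<integral>\<^sup>+s. ennreal ?e * ?i s \<partial>lborel) \<le> ennreal (T * ?e)"
    using t energy_bound_nonneg kernel_bound_pos by (intro nn_integral_Ioo_le) auto
  have vol: "volterra \<beta> mass t = (\<integral>\<^sup>+s. ?h s * ?i s \<partial>lborel)" unfolding volterra_def ..
  have "?J \<le> (\<integral>\<^sup>+s. ?h s * ?i s + ennreal ?e * ?i s \<partial>lborel)"
    using interaction_bounds(1)[of _ t] t by (intro nn_integral_mono) (auto simp: indicator_def)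
  also have "\<dots> = volterra \<beta> mass t + (\<integral>\<^sup>+s. ennreal ?e * ?i s \<partial>lborel)"
    unfolding vol by (rule nn_integral_add) measurable
  also have "\<dots> \<le> volterra \<beta> mass t + ennreal (T * ?e)" by (intro add_left_mono e)
  finally have J1: "?J \<le> volterra \<beta> mass t + ennreal (T * ?e)" .
  have "volterra \<beta> mass t \<le> (\<integral>\<^sup>+s. interaction t s * ?i s + ennreal ?e * ?i s \<partial>lborel)"
    unfolding vol using interaction_bounds(2)[of _ t] t by (intro nn_integral_mono) (auto simp: indicator_def)
  also have "\<dots> = ?J + (\<integral>\<^sup>+s. ennreal ?e * ?i s \<partial>lborel)"
    by (rule nn_integral_add) measurable
  also have "\<dots> \<le> ?J + ennreal (T * ?e)" by (intro add_left_mono e)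
  finally have J2: "volterra \<beta> mass t \<le> ?J + ennreal (T * ?e)" .
  let ?k = "4 * amplitude * \<bar>\<sigma>\<^sub>1\<bar> * sqrt (\<beta> * T)"
  have mass_error: "ennreal mass_error = ennreal ?k + ennreal (\<sigma>\<^sub>1\<^sup>2) * ennreal (T * ?e)"
    unfolding mass_error_def using \<beta> T energy_bound_nonneg kernel_bound_pos amplitude_nonneg
    by (subst ennreal_plus) (auto intro!: ennreal_mult)
  note P = initial_mass_bounds[OF t]
  let ?P = "\<integral>\<^sup>+x. ennreal ((\<sigma>\<^sub>1 * image_mean bc L (\<beta> * t) x + exp (\<alpha> * t) * \<sigma>\<^sub>0)\<^sup>2) * indicator {0..L} x \<partial>lborel"
  let ?b = "ennreal L * ennreal (initial_energy \<alpha> \<sigma>\<^sub>1 \<sigma>\<^sub>0 t)"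
  have "mass t \<le> (?b + ennreal ?k) + ennreal (\<sigma>\<^sub>1\<^sup>2) * (volterra \<beta> mass t + ennreal (T * ?e))"
    unfolding mass_equation[OF t] by (intro add_mono P(1) mult_left_mono J1) simp
  then show "mass t \<le> (?b + ennreal mass_error) + ennreal (\<sigma>\<^sub>1\<^sup>2) * volterra \<beta> mass t"
    unfolding mass_error by (simp only: distrib_left add_ac)
  have "?b + ennreal (\<sigma>\<^sub>1\<^sup>2) * volterra \<beta> mass t \<le> (?P + ennreal ?k) + ennreal (\<sigma>\<^sub>1\<^sup>2) * (?J + ennreal (T * ?e))"
    by (intro add_mono P(2) mult_left_mono J2) simp
  then show "?b + ennreal (\<sigma>\<^sub>1\<^sup>2) * volterra \<beta> mass t \<le> mass t + ennreal mass_error"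
    unfolding mass_error mass_equation[OF t] by (simp only: distrib_left add_ac)
qed

text \<open>The bound of \<open>volterra_series_const\<close> for the constant source
  \<open>mass_error\<close>, taken at the final time \<open>T\<close>.\<close>

definition "limit_error = mass_error * (2 * exp ((\<sigma>\<^sub>1\<^sup>2)\<^sup>2 * T / (4 * \<beta>)))"

text \<open>The Neumann series is linear in its source. The main source is proportional to
  \<open>L\<close> and produces \<open>L * limit_energy\<close>, while the error source is constant
  in \<open>L\<close> and produces at most \<open>limit_error\<close>; division by \<open>L\<close>
  gives the rate.\<close>

lemma mass_limit:
  assumes t: "0 < t" "t \<le> T"
  shows "mass t < \<infinity>" "\<bar>enn2real (mass t) / L - enn2real (limit_energy \<alpha> \<beta> \<sigma>\<^sub>1 \<sigma>\<^sub>0 t)\<bar> \<le> limit_error / L"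
proof -
  let ?g = "\<lambda>t. ennreal (initial_energy \<alpha> \<sigma>\<^sub>1 \<sigma>\<^sub>0 t)"
  let ?c = "\<sigma>\<^sub>1\<^sup>2"
  let ?E = "limit_energy \<alpha> \<beta> \<sigma>\<^sub>1 \<sigma>\<^sub>0 t"
  have c: "0 \<le> ?c" by simp
  have series_Lg: "(\<Sum>k. ennreal ?c ^ k * (volterra \<beta> ^^ k) (\<lambda>t. ennreal L * ?g t) t) = ennreal L * ?E"
  proof -
    have "(\<Sum>k. ennreal ?c ^ k * (volterra \<beta> ^^ k) (\<lambda>t. ennreal L * ?g t) t) =
        (\<Sum>k. ennreal L * (ennreal (?c ^ k) * (volterra \<beta> ^^ k) ?g t))"
      by (intro suminf_cong) (simp add: volterra_iter_cmult ennreal_power mult_ac)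
    then show ?thesis unfolding limit_energy_def by simp
  qed
  have series_K: "(\<Sum>k. ennreal ?c ^ k * (volterra \<beta> ^^ k) (\<lambda>_. ennreal mass_error) t) \<le> ennreal limit_error"
  proof -
    have "(\<Sum>k. ennreal ?c ^ k * (volterra \<beta> ^^ k) (\<lambda>_. ennreal mass_error) t) \<le> ennreal (mass_error * (2 * exp (?c\<^sup>2 * t / (4 * \<beta>))))"
      by (rule volterra_series_const[OF \<beta> c mass_error_nonneg t(1)])
    also have "\<dots> \<le> ennreal limit_error"
      unfolding limit_error_def using t \<beta> mass_error_nonneg by (intro ennreal_leI mult_left_mono) (auto simp: divide_right_mono mult_left_mono)
    finally show ?thesis .
  qed
  have mass_le: "mass s \<le> ennreal (energy_bound * L)" if s: "0 < s" "s \<le> T" for s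
  proof -
    have "mass s \<le> (\<integral>\<^sup>+y. ennreal energy_bound * indicator {0..L} y \<partial>lborel)"
      using s V_uniform[OF s] by (subst mass_eq) (auto intro!: nn_integral_mono simp: indicator_def)
    also have "\<dots> = ennreal (energy_bound * L)"
      using L energy_bound_nonneg by (subst nn_integral_cmult_indicator) (auto simp: ennreal_mult)
    finally show ?thesis .
  qed
  have upper: "mass t \<le> ennreal L * ?E + ennreal limit_error"
  proof -
    \<comment> \<open>The scalar case of the family version, with the one-element index type
      \<open>unit\<close>.\<close>
    have "mass t \<le> (\<Sum>k. ennreal ?c ^ k * (volterra \<beta> ^^ k) (\<lambda>t. ennreal L * ?g t + ennreal mass_error) t)"
    proof (rule volterra_upper[where v = "\<lambda>_::unit. mass" and I = UNIV and B = "energy_bound * L", OF \<beta> c])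
      fix \<phi> :: "real \<Rightarrow> ennreal" and s :: real
      assume \<phi>: "\<And>(j::unit) s. j \<in> UNIV \<Longrightarrow> 0 < s \<Longrightarrow> s \<le> T \<Longrightarrow> mass s \<le> \<phi> s" and s: "0 < s" "s \<le> T"
      have vol: "volterra \<beta> mass s \<le> volterra \<beta> \<phi> s" using \<phi> s by (intro volterra_mono) auto
      show "mass s \<le> (ennreal L * ?g s + ennreal mass_error) + ennreal ?c * volterra \<beta> \<phi> s"
        by (rule order_trans[OF mass_volterra(1)[OF s] add_left_mono[OF mult_left_mono[OF vol]]]) simp
    qed (use mass_le t in auto)
    also have "\<dots> = (\<Sum>k. ennreal ?c ^ k * (volterra \<beta> ^^ k) (\<lambda>t. ennreal L * ?g t) t +
        ennreal ?c ^ k * (volterra \<beta> ^^ k) (\<lambda>_. ennreal mass_error) t)"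
      by (intro suminf_cong) (subst volterra_iter_add, auto simp: distrib_left)
    also have "\<dots> = ennreal L * ?E + (\<Sum>k. ennreal ?c ^ k * (volterra \<beta> ^^ k) (\<lambda>_. ennreal mass_error) t)"
      unfolding series_Lg[symmetric] by (rule suminf_add[symmetric]) (rule summableI)+
    finally show ?thesis using series_K by (auto intro: order_trans add_left_mono)
  qed
  have lower: "ennreal L * ?E \<le> mass t + ennreal limit_error"
  proof -
    have "ennreal L * ?E \<le> mass t + (\<Sum>k. ennreal ?c ^ k * (volterra \<beta> ^^ k) (\<lambda>_. ennreal mass_error) t)"
      unfolding series_Lg[symmetric]
      by (rule volterra_lower[OF _ _ _ mass_volterra(2) t]) measurable
    then show ?thesis using series_K by (auto intro: order_trans add_left_mono)
  qed
  obtain e where e: "?E = ennreal e" "0 \<le> e"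
    using limit_energy_finite[OF \<beta> t(1), of \<alpha> \<sigma>\<^sub>1 \<sigma>\<^sub>0] by (cases ?E) auto
  show fin: "mass t < \<infinity>" using mass_le[OF t] by (rule le_less_trans) simp
  then obtain m where m: "mass t = ennreal m" "0 \<le> m" by (cases "mass t") auto
  have limit_error: "0 \<le> limit_error" unfolding limit_error_def using mass_error_nonneg by simp
  have "ennreal m \<le> ennreal (L * e + limit_error)" "ennreal (L * e) \<le> ennreal (m + limit_error)"
    using upper lower L e m limit_error by (simp_all add: ennreal_mult)
  then have "m \<le> L * e + limit_error" "L * e \<le> m + limit_error"
    using L e m limit_error by (simp_all add: ennreal_le_iff del: ennreal_plus)
  then have "\<bar>m - L * e\<bar> / L \<le> limit_error / L" using L by (intro divide_right_mono) auto
  moreover have "\<bar>m - L * e\<bar> / L = \<bar>m / L - e\<bar>"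
  proof -
    have "m / L - e = (m - L * e) / L" using L by (simp add: field_simps)
    then show ?thesis using L by (simp add: abs_divide)
  qed
  ultimately show "\<bar>enn2real (mass t) / L - enn2real ?E\<bar> \<le> limit_error / L" using e m by simp
qed

end

section \<open>Transfer to mild solutions\<close>

lemma (in white_noise) mild_solution_energy_balance:
  assumes "0 < \<beta>" "0 < T" "\<And>v. \<sigma> v = \<sigma>\<^sub>1 * v + \<sigma>\<^sub>0" "1 \<le> L" "mild_solution M W bc \<alpha> \<beta> \<sigma> T L u"
  shows "energy_balance bc \<alpha> \<beta> \<sigma>\<^sub>0 \<sigma>\<^sub>1 T L (energy M \<alpha> \<sigma> u)"
  using assms energy_measurable[OF assms(1,3-5)] energy_bounded[OF assms(1,3-5)] energy_equation[OF assms(1,3-5)]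
  by unfold_locales auto

text \<open>The uniform bound keeps the energies finite for \<open>0 < t\<close>, so
  \<open>enn2real\<close> loses nothing when extended integrals are turned into real ones.\<close>

lemma (in white_noise) integral_energy:
  assumes "0 < \<beta>" "0 < T" "\<And>v. \<sigma> v = \<sigma>\<^sub>1 * v + \<sigma>\<^sub>0" "1 \<le> L" "mild_solution M W bc \<alpha> \<beta> \<sigma> T L u"
    and t: "0 < t" "t \<le> T"
  shows "(LINT x:{0..L}|lborel. (LINT \<omega>|M. (\<sigma> (u t x \<omega>))\<^sup>2)) =
    exp (- 2 * \<alpha> * t) * enn2real (energy_balance.mass T L (energy M \<alpha> \<sigma> u) t)"
proof -
  interpret energy_balance bc \<alpha> \<beta> \<sigma>\<^sub>0 \<sigma>\<^sub>1 T L "energy M \<alpha> \<sigma> u"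
    by (rule mild_solution_energy_balance[OF assms(1-5)])
  let ?V = "energy M \<alpha> \<sigma> u t"
  have tT: "t \<in> {0..T}" using t by auto
  have \<sigma>m: "\<sigma> \<in> borel_measurable borel" by (rule sigma_measurable[OF assms(1,3-5)])
  have "(LINT x:{0..L}|lborel. (LINT \<omega>|M. (\<sigma> (u t x \<omega>))\<^sup>2)) =
    (LINT x|lborel. exp (- 2 * \<alpha> * t) * enn2real (?V x * indicator {0..L} x))"
    unfolding set_lebesgue_integral_def
  proof (rule Bochner_Integration.integral_cong[OF refl])
    fix x
    show "indicator {0..L} x *\<^sub>R (LINT \<omega>|M. (\<sigma> (u t x \<omega>))\<^sup>2) = exp (- 2 * \<alpha> * t) * enn2real (?V x * indicator {0..L} x)"
    proof (cases "x \<in> {0..L}")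
      case True
      note um = solution_measurable[OF assms(1,3-5) tT True]
      have "(LINT \<omega>|M. (\<sigma> (u t x \<omega>))\<^sup>2) = enn2real (\<integral>\<^sup>+\<omega>. ennreal ((\<sigma> (u t x \<omega>))\<^sup>2) \<partial>M)"
        by (rule integral_eq_nn_integral) (use measurable_compose[OF um \<sigma>m] in auto)
      moreover have "enn2real (?V x) = exp (2 * \<alpha> * t) * enn2real (\<integral>\<^sup>+\<omega>. ennreal ((\<sigma> (u t x \<omega>))\<^sup>2) \<partial>M)"
        by (simp add: energy_def enn2real_mult)
      moreover have "exp (- 2 * \<alpha> * t) * exp (2 * \<alpha> * t) = 1" by (simp add: exp_add[symmetric])
      ultimately show ?thesis using True by (simp add: mult.assoc[symmetric])
    qed simp
  qed
  also have "\<dots> = exp (- 2 * \<alpha> * t) * (LINT x|lborel. enn2real (?V x * indicator {0..L} x))" by simp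
  also have "(LINT x|lborel. enn2real (?V x * indicator {0..L} x)) = enn2real (mass t)"
  proof -
    note [measurable] = V_section_measurable[OF tT]
    have "(LINT x|lborel. enn2real (?V x * indicator {0..L} x)) =
        enn2real (\<integral>\<^sup>+x. ennreal (enn2real (?V x * indicator {0..L} x)) \<partial>lborel)"
      by (rule integral_eq_nn_integral) auto
    also have "(\<integral>\<^sup>+x. ennreal (enn2real (?V x * indicator {0..L} x)) \<partial>lborel) = mass t"
      unfolding mass_eq[OF tT]
    proof (rule nn_integral_cong)
      fix x
      have "?V x * indicator {0..L} x < \<top>"
        using V_uniform[OF t, of x] by (auto simp: indicator_def intro: le_less_trans)
      then show "ennreal (enn2real (?V x * indicator {0..L} x)) = ?V x * indicator {0..L} x"
        by (rule ennreal_enn2real)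
    qed
    finally show ?thesis .
  qed
  finally show ?thesis .
qed

text \<open>The limit is taken at times up to the arbitrary horizon \<open>T\<close> of the
  solutions, while the statements about \<open>f_sigma\<close> concern all positive times.
  Summability is asserted separately because \<open>suminf\<close> of a divergent series is an
  unspecified number.\<close>

theorem proposition6p3:
  fixes M :: "'w measure" and W :: "(real \<times> real) set \<Rightarrow> 'w \<Rightarrow> real"
    and bc :: boundary_condition
    and \<alpha> \<beta> \<sigma>\<^sub>0 \<sigma>\<^sub>1 T :: real and \<sigma> :: "real \<Rightarrow> real"
    and u :: "real \<Rightarrow> real \<Rightarrow> real \<Rightarrow> 'w \<Rightarrow> real"
  assumes "white_noise M W"
    and "\<beta> > 0" and "T > 0"
    and "\<And>v. \<sigma> v = \<sigma>\<^sub>1 * v + \<sigma>\<^sub>0"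
    and "\<And>L. L \<ge> 1 \<Longrightarrow> mild_solution M W bc \<alpha> \<beta> \<sigma> T L (u L)"
  shows "(\<forall>t\<in>{0<..T}.
            ((\<lambda>L. 1 / L * (LINT x:{0..L}|lborel. (LINT \<omega>|M. (\<sigma> (u L t x \<omega>))\<^sup>2)))
               \<longlongrightarrow> f_sigma \<alpha> \<beta> \<sigma>\<^sub>1 \<sigma>\<^sub>0 t) at_top)
       \<and> (\<forall>t>0. summable (\<lambda>k. f_term \<alpha> \<beta> \<sigma>\<^sub>1 \<sigma>\<^sub>0 k t))
       \<and> (\<forall>t>0. f_sigma \<alpha> \<beta> \<sigma>\<^sub>1 \<sigma>\<^sub>0 t
            \<le> exp (- 2 * \<alpha> * t) * (\<bar>\<sigma>\<^sub>1\<bar> + exp (\<bar>\<alpha>\<bar> * t) * \<bar>\<sigma>\<^sub>0\<bar>)\<^sup>2 * (f_bound (\<sigma>\<^sub>1 ^ 4 * t / \<beta>) - 1)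
              + (\<sigma>\<^sub>1 * exp (- \<alpha> * t) + \<sigma>\<^sub>0)\<^sup>2)
       \<and> (\<forall>S>0. set_integrable lborel {0..S} (f_sigma \<alpha> \<beta> \<sigma>\<^sub>1 \<sigma>\<^sub>0))"
proof (intro conjI ballI allI impI)
  interpret white_noise M W by fact
  fix t assume "t \<in> {0<..T}"
  then have t: "0 < t" "t \<le> T" by auto
  let ?A = "\<lambda>L. 1 / L * (LINT x:{0..L}|lborel. (LINT \<omega>|M. (\<sigma> (u L t x \<omega>))\<^sup>2))"
  \<comment> \<open>The exported constant has no argument for the length or the energies, so a
    single \<open>?K\<close> serves all \<open>L \<ge> 1\<close>.\<close>
  let ?K = "energy_balance.limit_error \<alpha> \<beta> \<sigma>\<^sub>0 \<sigma>\<^sub>1 T"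
  have bound: "\<bar>?A L - f_sigma \<alpha> \<beta> \<sigma>\<^sub>1 \<sigma>\<^sub>0 t\<bar> \<le> exp (- 2 * \<alpha> * t) * ?K / L" if L: "1 \<le> L" for L
  proof -
    note prems = assms(2-4) L assms(5)[OF L]
    interpret E: energy_balance bc \<alpha> \<beta> \<sigma>\<^sub>0 \<sigma>\<^sub>1 T L "energy M \<alpha> \<sigma> (u L)"
      by (rule mild_solution_energy_balance[OF prems])
    have "?A L - f_sigma \<alpha> \<beta> \<sigma>\<^sub>1 \<sigma>\<^sub>0 t =
      exp (- 2 * \<alpha> * t) * (enn2real (E.mass t) / L - enn2real (limit_energy \<alpha> \<beta> \<sigma>\<^sub>1 \<sigma>\<^sub>0 t))"
      unfolding integral_energy[OF prems t] f_sigma_limit_energy[OF assms(2) t(1)] by (simp add: right_diff_distrib)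
    also have "\<bar>\<dots>\<bar> \<le> exp (- 2 * \<alpha> * t) * (?K / L)"
      unfolding abs_mult abs_exp_cancel by (intro mult_left_mono E.mass_limit t) simp
    finally show ?thesis by simp
  qed
  have lim: "((\<lambda>L. exp (- 2 * \<alpha> * t) * ?K / L) \<longlongrightarrow> 0) at_top"
    by (rule real_tendsto_divide_at_top[OF tendsto_const filterlim_ident])
  have "((\<lambda>L. ?A L - f_sigma \<alpha> \<beta> \<sigma>\<^sub>1 \<sigma>\<^sub>0 t) \<longlongrightarrow> 0) at_top"
    by (rule Lim_null_comparison[OF _ lim]) (use bound in \<open>auto simp: eventually_at_top_linorder\<close>)
  then show "(?A \<longlongrightarrow> f_sigma \<alpha> \<beta> \<sigma>\<^sub>1 \<sigma>\<^sub>0 t) at_top"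
    by (rule LIM_zero_cancel)
next
  show "summable (\<lambda>k. f_term \<alpha> \<beta> \<sigma>\<^sub>1 \<sigma>\<^sub>0 k t)" if "0 < t" for t
    by (rule f_term_summable[OF assms(2) that])
  show "f_sigma \<alpha> \<beta> \<sigma>\<^sub>1 \<sigma>\<^sub>0 t
      \<le> exp (- 2 * \<alpha> * t) * (\<bar>\<sigma>\<^sub>1\<bar> + exp (\<bar>\<alpha>\<bar> * t) * \<bar>\<sigma>\<^sub>0\<bar>)\<^sup>2 * (f_bound (\<sigma>\<^sub>1 ^ 4 * t / \<beta>) - 1)
        + (\<sigma>\<^sub>1 * exp (- \<alpha> * t) + \<sigma>\<^sub>0)\<^sup>2" if "0 < t" for t
    by (rule f_sigma_le[OF assms(2) that])
  show "set_integrable lborel {0..S} (f_sigma \<alpha> \<beta> \<sigma>\<^sub>1 \<sigma>\<^sub>0)" if "0 < S" for S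
    by (rule f_sigma_integrable[OF assms(2) that])
qed

end
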